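(* Let $(M,g)$ be a Riemannian manifold of dimension $n$ with Levi-Civita connection $\nabla$ and curvature tensor $R$, and let $\overline\nabla$ be the Levi-Civita connection of the Riemannian metric $\bar g$ on the frame bundle $L(M)$ defined in the context from the functions $\alpha,\beta$. Then for all vector fields $X,Y$ on $M$, all $u=(u_1,\ldots,u_n)\in L(M)$ and all $i,j\in\{1,\ldots,n\}$: $$(\overline\nabla_{X^{h}}Y^{h})_u=(\nabla_XY)^{h}_u-\frac12\sum_k\left(R(X,Y)u_k\right)^{v,k}_u,$$ $$(\overline\nabla_{X^h}Y^{v,i})_u=\frac{\alpha_i}{2}\left(R(u_i,Y)X\right)^h_u+(\nabla_XY)^{v,i}_u,$$ $$(\overline\nabla_{X^{v,i}}Y^h)_u=\frac{\alpha_i}{2}\left(R(u_i,X)Y\right)^h_u,$$ $$(\overline\nabla_{X^{v,i}}Y^{v,j})_u=0\quad\text{for } i\neq j,$$ $$(\overline\nabla_{X^{v,i}}Y^{v,i})_u=\frac{\alpha_i'}{\alpha_i}\left(g(X,u_i)Y^{v,i}+g(Y,u_i)X^{v,i}\right)+\left(\frac{\beta_i'\alpha_i-2\alpha_i'\beta_i}{\alpha_i(\alpha_i+|u_i|^2\beta_i)}g(X,u_i)g(Y,u_i)+\frac{\beta_i-\alpha_i'}{\alpha_i+|u_i|^2\beta_i}g(X,Y)\right)U^i,$$ where $U^i$ is the vector field on $L(M)$ given by $U^i_u=(u_i)^{v,i}_u$, and the right-hand sides are evaluated at $u$.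
   Context: $L(M)$ is the bundle of linear frames; its points over $x\in M$ are the bases $u=(u_1,\ldots,u_n)$ of $T_xM$. $X^h$ denotes the horizontal lift to $L(M)$ (with respect to $\nabla$) of a vector field or tangent vector $X$ on $M$. The vertical lift $X^{v,i}$ ($i=1,\ldots,n$) is given by $X^{v,i}_u=\frac{d}{dt}\big|_{t=0}(u_1,\ldots,u_{i-1},u_i+tX,u_{i+1},\ldots,u_n)$. The curvature convention is $R(X,Y)Z=\nabla_X\nabla_YZ-\nabla_Y\nabla_XZ-\nabla_{[X,Y]}Z$. Let $\alpha,\beta:[0,\infty)\to\mathbb{R}$ be smooth functions with $\alpha(t)>0$ and $\alpha(t)+t\beta(t)>0$ for all $t\ge0$. Write $\alpha_i=\alpha(|u_i|^2)$, $\beta_i=\beta(|u_i|^2)$, $\alpha_i'=\alpha'(|u_i|^2)$, $\beta_i'=\beta'(|u_i|^2)$, where $|u_i|^2=g(u_i,u_i)$. The Riemannian metric $\bar g$ on $L(M)$ is defined by $\bar g(X^h,Y^h)_u=g(X,Y)$; $\bar g(X^h,Y^{v,i})_u=0$; $\bar g(X^{v,i},Y^{v,j})_u=0$ for $i\ne j$; $\bar g(X^{v,i},Y^{v,i})_u=\alpha_i\,g(X,Y)+\beta_i\,g(X,u_i)g(Y,u_i)$. *)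

theory Defs
  imports "HOL-Analysis.Analysis"
begin

section \<open>Smooth maps between normed spaces\<close>

text \<open>
  Used for open \<open>S\<close> in Euclidean spaces and for \<open>S = {0..}\<close> in the reals; in both cases derivatives
  within \<open>S\<close> are unique, and at the endpoint of \<open>{0..}\<close> they are one-sided.
\<close>

primrec k_smooth_on ::
  "nat \<Rightarrow> 'a::real_normed_vector set \<Rightarrow> ('a \<Rightarrow> 'b::real_normed_vector) \<Rightarrow> bool" where
  "k_smooth_on 0 S f \<longleftrightarrow> continuous_on S f"
| "k_smooth_on (Suc k) S f \<longleftrightarrow>
     (\<forall>x\<in>S. f differentiable (at x within S)) \<and>
     (\<forall>v. k_smooth_on k S (\<lambda>x. frechet_derivative f (at x within S) v))"

definition smooth_on :: "'a::real_normed_vector set \<Rightarrow> ('a \<Rightarrow> 'b::real_normed_vector) \<Rightarrow> bool" where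
  "smooth_on S f \<longleftrightarrow> (\<forall>k. k_smooth_on k S f)"

section \<open>Smooth manifolds\<close>

text \<open>
  A chart is a pair of a domain and a coordinate map; the values of the map outside the domain are
  irrelevant. A manifold is given by an atlas, whose chart domains cover it; the topology is the one
  for which the chart domains are open and the charts are homeomorphisms onto their images.
\<close>

type_synonym ('m, 'e) chart = "'m set \<times> ('m \<Rightarrow> 'e)"
type_synonym ('m, 'e) atlas = "('m, 'e) chart set"

abbreviation chart_inv :: "('m, 'e) chart \<Rightarrow> 'e \<Rightarrow> 'm" where
  "chart_inv c \<equiv> inv_into (fst c) (snd c)"

definition carrier_of :: "('m, 'e) atlas \<Rightarrow> 'm set" where
  "carrier_of A = (\<Union>c\<in>A. fst c)"

definition manifold_topology :: "('m, 'e::euclidean_space) atlas \<Rightarrow> 'm topology" where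
  "manifold_topology A = topology_generated_by {fst c \<inter> snd c -` V | c V. c \<in> A \<and> open V}"

definition charts_at :: "('m, 'e) atlas \<Rightarrow> 'm \<Rightarrow> ('m, 'e) chart set" where
  "charts_at A p = {c \<in> A. p \<in> fst c}"

definition smooth_atlas :: "('m, 'e::euclidean_space) atlas \<Rightarrow> bool" where
  "smooth_atlas A \<longleftrightarrow>
     (\<forall>c\<in>A. inj_on (snd c) (fst c) \<and> open (snd c ` fst c)) \<and>
     (\<forall>c\<in>A. \<forall>d\<in>A. open (snd c ` (fst c \<inter> fst d)) \<and>
        smooth_on (snd c ` (fst c \<inter> fst d)) (snd d \<circ> chart_inv c))"

definition smooth_manifold :: "('m, 'e::euclidean_space) atlas \<Rightarrow> bool" where
  "smooth_manifold A \<longleftrightarrow> smooth_atlas A \<and>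
     Hausdorff_space (manifold_topology A) \<and> second_countable (manifold_topology A)"

definition smooth_fun_on :: "('m, 'e::euclidean_space) atlas \<Rightarrow> 'm set \<Rightarrow> ('m \<Rightarrow> real) \<Rightarrow> bool" where
  "smooth_fun_on A W f \<longleftrightarrow> (\<forall>c\<in>A. smooth_on (snd c ` (W \<inter> fst c)) (f \<circ> chart_inv c))"

section \<open>Tangent vectors\<close>

text \<open>
  A tangent vector at \<open>p\<close> assigns to every chart around \<open>p\<close> its coordinate vector in that chart; the
  coordinate vectors are related by the Jacobians of the coordinate changes, and the value at all
  other charts is \<open>0\<close>. The ambient vector space of all assignments is a type of its own so that
  the library notions for real vector spaces apply.
\<close>

typedef (overloaded) ('m, 'e) tvec = "UNIV :: (('m, 'e) chart \<Rightarrow> 'e) set"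
  morphisms coords Tvec by simp

setup_lifting type_definition_tvec

instantiation tvec :: (type, real_vector) real_vector
begin

lift_definition zero_tvec :: "('a, 'b) tvec" is "\<lambda>c. 0" .
lift_definition plus_tvec :: "('a, 'b) tvec \<Rightarrow> ('a, 'b) tvec \<Rightarrow> ('a, 'b) tvec"
  is "\<lambda>v w c. v c + w c" .
lift_definition minus_tvec :: "('a, 'b) tvec \<Rightarrow> ('a, 'b) tvec \<Rightarrow> ('a, 'b) tvec"
  is "\<lambda>v w c. v c - w c" .
lift_definition uminus_tvec :: "('a, 'b) tvec \<Rightarrow> ('a, 'b) tvec" is "\<lambda>v c. - v c" .
lift_definition scaleR_tvec :: "real \<Rightarrow> ('a, 'b) tvec \<Rightarrow> ('a, 'b) tvec" is "\<lambda>r v c. r *\<^sub>R v c" .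

instance
  by standard (transfer; simp add: algebra_simps)+

end

definition tangent_space :: "('m, 'e::euclidean_space) atlas \<Rightarrow> 'm \<Rightarrow> ('m, 'e) tvec set" where
  "tangent_space A p = {v.
     (\<forall>c. c \<notin> charts_at A p \<longrightarrow> coords v c = 0) \<and>
     (\<forall>c\<in>charts_at A p. \<forall>d\<in>charts_at A p.
        coords v d = frechet_derivative (snd d \<circ> chart_inv c) (at (snd c p)) (coords v c))}"

text \<open>
  \<open>at_charts A p F\<close> is the vector with coordinates \<open>F c\<close> in each chart \<open>c\<close> around \<open>p\<close>.
\<close>

definition at_charts ::
  "('m, 'e::euclidean_space) atlas \<Rightarrow> 'm \<Rightarrow> (('m, 'e) chart \<Rightarrow> 'e) \<Rightarrow> ('m, 'e) tvec" where
  "at_charts A p F = Tvec (\<lambda>c. if c \<in> charts_at A p then F c else 0)"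

text \<open>
  In \<open>dir_deriv\<close> and \<open>differential\<close> the chart around \<open>p\<close> is chosen arbitrarily; by the chain rule the
  result does not depend on the choice when \<open>v\<close> is tangent at \<open>p\<close> and \<open>f\<close> is smooth near \<open>p\<close>.
\<close>

definition dir_deriv ::
  "('m, 'e::euclidean_space) atlas \<Rightarrow> 'm \<Rightarrow> ('m, 'e) tvec \<Rightarrow> ('m \<Rightarrow> real) \<Rightarrow> real" where
  "dir_deriv A p v f =
     (let c = (SOME c. c \<in> charts_at A p)
      in frechet_derivative (f \<circ> chart_inv c) (at (snd c p)) (coords v c))"

definition differential ::
  "('m, 'e::euclidean_space) atlas \<Rightarrow> ('p, 'f::euclidean_space) atlas \<Rightarrow> ('m \<Rightarrow> 'p) \<Rightarrow>
   'm \<Rightarrow> ('m, 'e) tvec \<Rightarrow> ('p, 'f) tvec" where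
  "differential A B f p v =
     (let c = (SOME c. c \<in> charts_at A p)
      in at_charts B (f p) (\<lambda>d. frechet_derivative (snd d \<circ> f \<circ> chart_inv c)
            (at (snd c p)) (coords v c)))"

definition velocity ::
  "('m, 'e::euclidean_space) atlas \<Rightarrow> (real \<Rightarrow> 'm) \<Rightarrow> real \<Rightarrow> ('m, 'e) tvec" where
  "velocity A \<gamma> t = at_charts A (\<gamma> t) (\<lambda>c. vector_derivative (snd c \<circ> \<gamma>) (at t))"

section \<open>Vector fields, metrics and connections\<close>

type_synonym ('m, 'e) vfield = "'m \<Rightarrow> ('m, 'e) tvec"

definition vector_field_on ::
  "('m, 'e::euclidean_space) atlas \<Rightarrow> 'm set \<Rightarrow> ('m, 'e) vfield \<Rightarrow> bool" where
  "vector_field_on A W X \<longleftrightarrow>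
     (\<forall>p\<in>W. X p \<in> tangent_space A p) \<and>
     (\<forall>c\<in>A. smooth_on (snd c ` (W \<inter> fst c)) (\<lambda>z. coords (X (chart_inv c z)) c))"

definition field_near ::
  "('m, 'e::euclidean_space) atlas \<Rightarrow> 'm \<Rightarrow> ('m, 'e) vfield \<Rightarrow> bool" where
  "field_near A p X \<longleftrightarrow> (\<exists>W. openin (manifold_topology A) W \<and> p \<in> W \<and> vector_field_on A W X)"

definition smooth_fun_near ::
  "('m, 'e::euclidean_space) atlas \<Rightarrow> 'm \<Rightarrow> ('m \<Rightarrow> real) \<Rightarrow> bool" where
  "smooth_fun_near A p f \<longleftrightarrow> (\<exists>W. openin (manifold_topology A) W \<and> p \<in> W \<and> smooth_fun_on A W f)"

text \<open>In each chart, \<open>[X,Y] = DY(X) - DX(Y)\<close>, i.e. \<open>[X,Y]f = X(Yf) - Y(Xf)\<close>.\<close>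

definition lie_bracket ::
  "('m, 'e::euclidean_space) atlas \<Rightarrow> ('m, 'e) vfield \<Rightarrow> ('m, 'e) vfield \<Rightarrow> ('m, 'e) vfield" where
  "lie_bracket A X Y p = at_charts A p (\<lambda>c.
     frechet_derivative (\<lambda>z. coords (Y (chart_inv c z)) c) (at (snd c p)) (coords (X p) c) -
     frechet_derivative (\<lambda>z. coords (X (chart_inv c z)) c) (at (snd c p)) (coords (Y p) c))"

type_synonym ('m, 'e) metric_tensor = "'m \<Rightarrow> ('m, 'e) tvec \<Rightarrow> ('m, 'e) tvec \<Rightarrow> real"

definition riemannian_metric ::
  "('m, 'e::euclidean_space) atlas \<Rightarrow> ('m, 'e) metric_tensor \<Rightarrow> bool" where
  "riemannian_metric A g \<longleftrightarrow>
     (\<forall>p\<in>carrier_of A.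
        (\<forall>v\<in>tangent_space A p. \<forall>w\<in>tangent_space A p. g p v w = g p w v) \<and>
        (\<forall>v\<in>tangent_space A p. \<forall>w\<in>tangent_space A p. \<forall>z\<in>tangent_space A p. \<forall>a b.
           g p (a *\<^sub>R v + b *\<^sub>R w) z = a * g p v z + b * g p w z) \<and>
        (\<forall>v\<in>tangent_space A p. v \<noteq> 0 \<longrightarrow> g p v v > 0)) \<and>
     (\<forall>W X Y. openin (manifold_topology A) W \<and> vector_field_on A W X \<and> vector_field_on A W Y
        \<longrightarrow> smooth_fun_on A W (\<lambda>p. g p (X p) (Y p)))"

text \<open>
  \<open>D p v Y\<close> is the covariant derivative at \<open>p\<close> of \<open>Y\<close> in the direction of the tangent vector \<open>v\<close>.
  As usual it is defined for every vector field \<open>Y\<close> that is smooth in some neighbourhood of \<open>p\<close>; its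
  dependence on the germ of \<open>Y\<close> only follows from the Leibniz rule, applied to the indicator
  function of a neighbourhood of \<open>p\<close>.
\<close>

type_synonym ('m, 'e) connection = "'m \<Rightarrow> ('m, 'e) tvec \<Rightarrow> ('m, 'e) vfield \<Rightarrow> ('m, 'e) tvec"

abbreviation cov_deriv ::
  "('m, 'e) connection \<Rightarrow> ('m, 'e) vfield \<Rightarrow> ('m, 'e) vfield \<Rightarrow> ('m, 'e) vfield" where
  "cov_deriv D X Y \<equiv> \<lambda>p. D p (X p) Y"

definition affine_connection ::
  "('m, 'e::euclidean_space) atlas \<Rightarrow> ('m, 'e) connection \<Rightarrow> bool" where
  "affine_connection A D \<longleftrightarrow>
     (\<forall>p\<in>carrier_of A. \<forall>Y. field_near A p Y \<longrightarrow>
        (\<forall>v\<in>tangent_space A p. D p v Y \<in> tangent_space A p) \<and>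
        (\<forall>v\<in>tangent_space A p. \<forall>w\<in>tangent_space A p. \<forall>a b.
           D p (a *\<^sub>R v + b *\<^sub>R w) Y = a *\<^sub>R D p v Y + b *\<^sub>R D p w Y) \<and>
        (\<forall>v\<in>tangent_space A p. \<forall>Z. field_near A p Z \<longrightarrow>
           D p v (\<lambda>q. Y q + Z q) = D p v Y + D p v Z) \<and>
        (\<forall>v\<in>tangent_space A p. \<forall>f. smooth_fun_near A p f \<longrightarrow>
           D p v (\<lambda>q. f q *\<^sub>R Y q) = dir_deriv A p v f *\<^sub>R Y p + f p *\<^sub>R D p v Y)) \<and>
     (\<forall>W X Y. openin (manifold_topology A) W \<and> vector_field_on A W X \<and> vector_field_on A W Y
        \<longrightarrow> vector_field_on A W (cov_deriv D X Y))"

definition torsion_free ::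
  "('m, 'e::euclidean_space) atlas \<Rightarrow> ('m, 'e) connection \<Rightarrow> bool" where
  "torsion_free A D \<longleftrightarrow>
     (\<forall>p\<in>carrier_of A. \<forall>X Y. field_near A p X \<and> field_near A p Y \<longrightarrow>
        cov_deriv D X Y p - cov_deriv D Y X p = lie_bracket A X Y p)"

definition metric_connection ::
  "('m, 'e::euclidean_space) atlas \<Rightarrow> ('m, 'e) metric_tensor \<Rightarrow> ('m, 'e) connection \<Rightarrow> bool" where
  "metric_connection A g D \<longleftrightarrow>
     (\<forall>p\<in>carrier_of A. \<forall>v\<in>tangent_space A p. \<forall>Y Z. field_near A p Y \<and> field_near A p Z \<longrightarrow>
        dir_deriv A p v (\<lambda>q. g q (Y q) (Z q)) = g p (D p v Y) (Z p) + g p (Y p) (D p v Z))"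

definition levi_civita ::
  "('m, 'e::euclidean_space) atlas \<Rightarrow> ('m, 'e) metric_tensor \<Rightarrow> ('m, 'e) connection \<Rightarrow> bool" where
  "levi_civita A g D \<longleftrightarrow> affine_connection A D \<and> torsion_free A D \<and> metric_connection A g D"

text \<open>
  \<open>R(a,b)w\<close> for tangent vectors at \<open>p\<close>: the common value of the curvature expression over all
  extensions of \<open>a\<close>, \<open>b\<close>, \<open>w\<close> to vector fields near \<open>p\<close>.
\<close>

definition curvature ::
  "('m, 'e::euclidean_space) atlas \<Rightarrow> ('m, 'e) connection \<Rightarrow> 'm \<Rightarrow>
   ('m, 'e) tvec \<Rightarrow> ('m, 'e) tvec \<Rightarrow> ('m, 'e) tvec \<Rightarrow> ('m, 'e) tvec" where
  "curvature A D p a b w = (THE r. \<exists>X Y Z.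
     field_near A p X \<and> field_near A p Y \<and> field_near A p Z \<and> X p = a \<and> Y p = b \<and> Z p = w \<and>
     r = cov_deriv D X (cov_deriv D Y Z) p - cov_deriv D Y (cov_deriv D X Z) p
           - cov_deriv D (lie_bracket A X Y) Z p)"

section \<open>The frame bundle\<close>

type_synonym ('m, 'n) frame = "'m \<times> ('n \<Rightarrow> ('m, real^'n) tvec)"
type_synonym 'n frame_model = "(real^'n) \<times> ((real^'n)^'n)"

definition frame_bundle :: "('m, real^'n) atlas \<Rightarrow> ('m, 'n::finite) frame set" where
  "frame_bundle A = {(x, u). x \<in> carrier_of A \<and>
     inj u \<and> independent (range u) \<and> span (range u) = tangent_space A x}"

definition frame_chart ::
  "('m, real^'n) atlas \<Rightarrow> ('m, real^'n) chart \<Rightarrow> (('m, 'n::finite) frame, 'n frame_model) chart" where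
  "frame_chart A c =
     ({(x, u) \<in> frame_bundle A. x \<in> fst c}, \<lambda>(x, u). (snd c x, \<chi> i. coords (u i) c))"

definition frame_atlas ::
  "('m, real^'n) atlas \<Rightarrow> (('m, 'n::finite) frame, 'n frame_model) atlas" where
  "frame_atlas A = frame_chart A ` A"

type_synonym ('m, 'n) frame_tvec = "(('m, 'n) frame, 'n frame_model) tvec"

text \<open>
  The horizontal space at \<open>(x, u)\<close>: differentials of local frame fields \<open>s\<close> through \<open>u\<close> in directions
  \<open>v\<close> in which \<open>s\<close> is parallel at \<open>x\<close>.
\<close>

definition horizontal_space ::
  "('m, real^'n) atlas \<Rightarrow> ('m, real^'n) connection \<Rightarrow> ('m, 'n::finite) frame \<Rightarrow>
   ('m, 'n) frame_tvec set" where
  "horizontal_space A D w = {\<xi>. \<exists>v\<in>tangent_space A (fst w). \<exists>W s.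
     openin (manifold_topology A) W \<and> fst w \<in> W \<and>
     (\<forall>i. vector_field_on A W (s i)) \<and>
     (\<forall>q\<in>W. (q, \<lambda>i. s i q) \<in> frame_bundle A) \<and>
     (\<forall>i. s i (fst w) = snd w i) \<and>
     (\<forall>i. D (fst w) v (s i) = 0) \<and>
     \<xi> = differential A (frame_atlas A) (\<lambda>q. (q, \<lambda>i. s i q)) (fst w) v}"

definition hlift ::
  "('m, real^'n) atlas \<Rightarrow> ('m, real^'n) connection \<Rightarrow> ('m, 'n::finite) frame \<Rightarrow>
   ('m, real^'n) tvec \<Rightarrow> ('m, 'n) frame_tvec" where
  "hlift A D w a = (THE \<xi>. \<xi> \<in> horizontal_space A D w \<and>
     differential (frame_atlas A) A fst w \<xi> = a)"

definition vlift ::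
  "('m, real^'n) atlas \<Rightarrow> 'n \<Rightarrow> ('m, 'n::finite) frame \<Rightarrow>
   ('m, real^'n) tvec \<Rightarrow> ('m, 'n) frame_tvec" where
  "vlift A i w a =
     velocity (frame_atlas A) (\<lambda>t. (fst w, (snd w)(i := snd w i + t *\<^sub>R a))) 0"

definition hlift_field ::
  "('m, real^'n) atlas \<Rightarrow> ('m, real^'n) connection \<Rightarrow> ('m, real^'n) vfield \<Rightarrow>
   (('m, 'n::finite) frame, 'n frame_model) vfield" where
  "hlift_field A D X w = hlift A D w (X (fst w))"

definition vlift_field ::
  "('m, real^'n) atlas \<Rightarrow> 'n \<Rightarrow> ('m, real^'n) vfield \<Rightarrow>
   (('m, 'n::finite) frame, 'n frame_model) vfield" where
  "vlift_field A i X w = vlift A i w (X (fst w))"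

definition tautological_field ::
  "('m, real^'n) atlas \<Rightarrow> 'n \<Rightarrow> (('m, 'n::finite) frame, 'n frame_model) vfield" where
  "tautological_field A i w = vlift A i w (snd w i)"

definition frame_bundle_metric ::
  "('m, real^'n) atlas \<Rightarrow> ('m, real^'n) metric_tensor \<Rightarrow> ('m, real^'n) connection \<Rightarrow>
   (real \<Rightarrow> real) \<Rightarrow> (real \<Rightarrow> real) \<Rightarrow>
   (('m, 'n::finite) frame, 'n frame_model) metric_tensor \<Rightarrow> bool" where
  "frame_bundle_metric A g D \<alpha> \<beta> G \<longleftrightarrow>
     riemannian_metric (frame_atlas A) G \<and>
     (\<forall>(x, u)\<in>frame_bundle A. \<forall>X\<in>tangent_space A x. \<forall>Y\<in>tangent_space A x.
        G (x, u) (hlift A D (x, u) X) (hlift A D (x, u) Y) = g x X Y \<and>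
        (\<forall>i. G (x, u) (hlift A D (x, u) X) (vlift A i (x, u) Y) = 0) \<and>
        (\<forall>i j. i \<noteq> j \<longrightarrow> G (x, u) (vlift A i (x, u) X) (vlift A j (x, u) Y) = 0) \<and>
        (\<forall>i. G (x, u) (vlift A i (x, u) X) (vlift A i (x, u) Y) =
           \<alpha> (g x (u i) (u i)) * g x X Y + \<beta> (g x (u i) (u i)) * g x X (u i) * g x Y (u i)))"

end

theory Submission
  imports Defs
begin

text \<open>
  Both sides of each formula are tangent vectors of the frame bundle, and at a frame \<open>(x, u)\<close> the
  tangent space is spanned by the lifts \<open>Z\<^sup>h\<close> and \<open>Z\<^sup>v\<^sup>,\<^sup>k\<close> of local vector fields \<open>Z\<close> on the base. So
  it suffices to compare the inner products with these lifts, and for the left-hand side Koszul's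
  formula computes them from directional derivatives of inner products of lifts and from brackets of
  lifts. In the chart induced by a chart of the base with Christoffel symbols \<open>\<Gamma>\<close>, the horizontal
  lift of \<open>a\<close> at \<open>(z, U)\<close> is \<open>(a, (- \<Gamma>(a, U\<^sub>k))\<^sub>k)\<close> and the \<open>i\<close>-th vertical lift is \<open>(0, (\<delta>\<^sub>i\<^sub>k a)\<^sub>k)\<close>. This gives
  \<open>[X\<^sup>h, Y\<^sup>h] = [X, Y]\<^sup>h - \<Sum>\<^sub>k (R(X, Y) u\<^sub>k)\<^sup>v\<^sup>,\<^sup>k\<close>, \<open>[X\<^sup>h, Y\<^sup>v\<^sup>,\<^sup>i] = (\<nabla>\<^sub>X Y)\<^sup>v\<^sup>,\<^sup>i\<close> and \<open>[X\<^sup>v\<^sup>,\<^sup>i, Y\<^sup>v\<^sup>,\<^sup>j] = 0\<close>,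
  and the \<open>\<alpha>\<close>-terms come from the symmetries of the curvature tensor.
\<close>

section \<open>Calculus of smooth maps\<close>

text \<open>Covariant derivative, curvature and horizontal lift are given only by axioms or by
  definite descriptions, so each must first be shown to depend on the right data. Coordinates do
  this: the covariant derivative takes the form dY(v) + \<Gamma>(v, Y), the derivatives of the
  fields cancel in the curvature, and a frame field parallel at x in direction v has its derivative
  fixed by v and u. All this is pointwise, so fields with constant coordinates in one chart serve as
  extensions of vectors. In the last formula the coefficient of U^i is forced by inner products:
  with t = |u_i|^2, that of the i-th vertical lifts of b and u_i is (\<alpha> + t \<beta>) g(b,
  u_i), hence the denominator. The \<alpha>'/\<alpha> term yields the wanted \<alpha>' terms but
  also 2 \<alpha>' \<beta> / \<alpha> times g(X, u_i) g(Y, u_i) g(b, u_i), which the coefficient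
  takes away again. \<beta> is absent from the mixed formulas because g(R(X, Y) u_i, u_i) = 0. Since
  u_i is nonzero, \<alpha> and \<beta> are differentiated only at t > 0, where their derivatives are
  two-sided.\<close>

lemma has_derivative_cong_on:
  assumes "\<And>x. x \<in> S \<Longrightarrow> f x = g x" "x \<in> S"
  shows "(f has_derivative D) (at x within S) \<longleftrightarrow> (g has_derivative D) (at x within S)"
  using assms by (metis has_derivative_transform)

lemma frechet_derivative_cong_on:
  assumes "\<And>x. x \<in> S \<Longrightarrow> f x = g x" "x \<in> S"
  shows "frechet_derivative f (at x within S) = frechet_derivative g (at x within S)"
  unfolding frechet_derivative_def using has_derivative_cong_on[OF assms] by simp

lemma frechet_derivativeI: "(f has_derivative f') (at x) \<Longrightarrow> frechet_derivative f (at x) = f'"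
  by (metis frechet_derivative_at)

section \<open>Finite orders of differentiability\<close>

lemma k_smooth_on_cong:
  assumes "\<And>x. x \<in> S \<Longrightarrow> f x = g x"
  shows "k_smooth_on k S f \<longleftrightarrow> k_smooth_on k S g"
  using assms
proof (induction k arbitrary: f g)
  case 0
  then show ?case by (simp cong: continuous_on_cong)
next
  case (Suc k)
  have "k_smooth_on k S (\<lambda>x. frechet_derivative f (at x within S) v) \<longleftrightarrow>
      k_smooth_on k S (\<lambda>x. frechet_derivative g (at x within S) v)" for v
    by (rule Suc.IH) (simp add: frechet_derivative_cong_on[OF Suc.prems])
  moreover have "f differentiable (at x within S) \<longleftrightarrow> g differentiable (at x within S)" if "x \<in> S" for x
    unfolding differentiable_def using has_derivative_cong_on[OF Suc.prems that] by simp
  ultimately show ?case by simp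
qed

text \<open>On an open set \<open>at x within S\<close> is \<open>at x\<close>. The closure rules
  below are for open sets for this reason; \<alpha> and \<beta>, which live on a half line, are
  differentiated only at its interior points.\<close>

lemma k_smooth_on_Suc_open:
  assumes "open S"
  shows "k_smooth_on (Suc k) S f \<longleftrightarrow> (\<forall>x\<in>S. f differentiable (at x)) \<and>
     (\<forall>v. k_smooth_on k S (\<lambda>x. frechet_derivative f (at x) v))"
proof -
  have "k_smooth_on k S (\<lambda>x. frechet_derivative f (at x within S) v) \<longleftrightarrow>
      k_smooth_on k S (\<lambda>x. frechet_derivative f (at x) v)" for v
    by (rule k_smooth_on_cong) (simp add: at_within_open[OF _ assms])
  then show ?thesis by (simp add: at_within_open[OF _ assms])
qed

lemma k_smooth_on_SucI:
  assumes "open S" "\<And>x. x \<in> S \<Longrightarrow> (f has_derivative f' x) (at x)"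
    and "\<And>v. k_smooth_on k S (\<lambda>x. f' x v)"
  shows "k_smooth_on (Suc k) S f"
proof -
  have "k_smooth_on k S (\<lambda>x. frechet_derivative f (at x) v)" for v
    using assms(3) by (subst k_smooth_on_cong) (auto simp: frechet_derivativeI[OF assms(2)])
  then show ?thesis
    unfolding k_smooth_on_Suc_open[OF assms(1)] using assms(2) by (auto simp: differentiable_def)
qed

text \<open>Positive orders do not state continuity of \<open>f\<close>; it follows from
  differentiability. The product and chain rules need this lemma because an undifferentiated map
  appears in the derivative and must have order \<open>k\<close>.\<close>

lemma k_smooth_on_SucD:
  assumes "open S" "k_smooth_on (Suc k) S f"
  shows "k_smooth_on k S f"
  using assms(2)
proof (induction k arbitrary: f)
  case 0
  then show ?case
    unfolding k_smooth_on_Suc_open[OF assms(1)]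
    by (auto intro!: continuous_at_imp_continuous_on differentiable_imp_continuous_within)
next
  case (Suc k)
  then show ?case unfolding k_smooth_on_Suc_open[OF assms(1)] by blast
qed

lemma k_smooth_on_derivative:
  assumes "open S" "k_smooth_on (Suc k) S f"
  shows "x \<in> S \<Longrightarrow> (f has_derivative frechet_derivative f (at x)) (at x)"
    and "k_smooth_on k S (\<lambda>x. frechet_derivative f (at x) v)"
  using assms(2) unfolding k_smooth_on_Suc_open[OF assms(1)]
  by (auto simp: frechet_derivative_works)

lemma k_smooth_on_subset:
  assumes "open S" "open T" "T \<subseteq> S" "k_smooth_on k S f"
  shows "k_smooth_on k T f"
  using assms(4)
proof (induction k arbitrary: f)
  case 0
  then show ?case using assms(3) by (auto intro: continuous_on_subset)
next
  case (Suc k)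
  then show ?case
    unfolding k_smooth_on_Suc_open[OF assms(1)] k_smooth_on_Suc_open[OF assms(2)]
    using assms(3) by auto
qed

lemma k_smooth_on_const: "open S \<Longrightarrow> k_smooth_on k S (\<lambda>x. c)"
  by (induction k arbitrary: c) (auto simp: k_smooth_on_Suc_open simp del: k_smooth_on.simps(2))

lemma k_smooth_on_bounded_linear:
  assumes "open S" "bounded_linear f"
  shows "k_smooth_on k S f"
proof (cases k)
  case 0
  then show ?thesis using linear_continuous_on[OF assms(2)] by simp
next
  case (Suc m)
  then show ?thesis
    using bounded_linear_imp_has_derivative[OF assms(2)] k_smooth_on_const[OF assms(1)]
    by (auto intro!: k_smooth_on_SucI[OF assms(1), of f "\<lambda>_. f"] simp del: k_smooth_on.simps(2))
qed

lemma k_smooth_on_compose_bounded_linear: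
  assumes "open S" "bounded_linear h" "k_smooth_on k S f"
  shows "k_smooth_on k S (\<lambda>x. h (f x))"
  using assms(3)
proof (induction k arbitrary: f)
  case 0
  then show ?case using assms(2) by (auto intro: bounded_linear.continuous_on)
next
  case (Suc k)
  show ?case
    by (rule k_smooth_on_SucI[OF assms(1), where f' = "\<lambda>x v. h (frechet_derivative f (at x) v)"])
       (intro bounded_linear.has_derivative[OF assms(2)] Suc.IH
         k_smooth_on_derivative[OF assms(1) Suc.prems], assumption?)+
qed

lemma k_smooth_on_add:
  assumes "open S" "k_smooth_on k S f" "k_smooth_on k S g"
  shows "k_smooth_on k S (\<lambda>x. f x + g x)"
  using assms(2,3)
proof (induction k arbitrary: f g)
  case 0
  then show ?case by (auto intro: continuous_intros)
next
  case (Suc k)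
  note d = k_smooth_on_derivative[OF assms(1) Suc.prems(1)] k_smooth_on_derivative[OF assms(1) Suc.prems(2)]
  show ?case
    using d Suc.IH
    by (intro k_smooth_on_SucI[OF assms(1),
          where f' = "\<lambda>x v. frechet_derivative f (at x) v + frechet_derivative g (at x) v"])
       (auto intro: has_derivative_add)
qed

lemma k_smooth_on_bilinear:
  assumes "open S" "bounded_bilinear pr" "k_smooth_on k S f" "k_smooth_on k S g"
  shows "k_smooth_on k S (\<lambda>x. pr (f x) (g x))"
  using assms(3,4)
proof (induction k arbitrary: f g)
  case 0
  then show ?case using assms(2) by (auto intro: bounded_bilinear.continuous_on)
next
  case (Suc k)
  note d = k_smooth_on_derivative[OF assms(1) Suc.prems(1)] k_smooth_on_derivative[OF assms(1) Suc.prems(2)]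
    k_smooth_on_SucD[OF assms(1) Suc.prems(1)] k_smooth_on_SucD[OF assms(1) Suc.prems(2)]
  show ?case
    using d Suc.IH
    by (intro k_smooth_on_SucI[OF assms(1), where f' = "\<lambda>x v. pr (f x) (frechet_derivative g (at x) v) +
            pr (frechet_derivative f (at x) v) (g x)"])
       (auto intro!: bounded_bilinear.FDERIV[OF assms(2)] k_smooth_on_add[OF assms(1)])
qed

lemma k_smooth_on_sum:
  assumes "open S" "\<And>i. i \<in> I \<Longrightarrow> k_smooth_on k S (f i)"
  shows "k_smooth_on k S (\<lambda>x. \<Sum>i\<in>I. f i x)"
  using assms(2)
  by (induction I rule: infinite_finite_induct)
     (auto intro: k_smooth_on_const[OF assms(1)] k_smooth_on_add[OF assms(1)])

lemma linear_basis_expansion: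
  fixes F :: "'a::euclidean_space \<Rightarrow> 'b::real_vector"
  assumes "linear F"
  shows "F a = (\<Sum>b\<in>Basis. (a \<bullet> b) *\<^sub>R F b)"
proof -
  have "F a = F (\<Sum>b\<in>Basis. (a \<bullet> b) *\<^sub>R b)" by (simp add: euclidean_representation)
  also have "\<dots> = (\<Sum>b\<in>Basis. (a \<bullet> b) *\<^sub>R F b)"
    by (simp add: linear_sum[OF assms] linear_scale[OF assms])
  finally show ?thesis .
qed

text \<open>Smoothness of \<open>F x b\<close> for each fixed \<open>b\<close> suffices, because in
  a finite basis the value is a finite sum of scalar functions times such maps. This replaces
  smoothness of \<open>F\<close> as a map into a space of operators and serves derivatives,
  Jacobians and Christoffel symbols alike.\<close>

lemma k_smooth_on_linear_family:
  fixes F :: "'c::real_normed_vector \<Rightarrow> 'a::euclidean_space \<Rightarrow> 'b::real_normed_vector"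
  assumes "open S" "\<And>x. x \<in> S \<Longrightarrow> linear (F x)"
    and "\<And>b. k_smooth_on k S (\<lambda>x. F x b)" "k_smooth_on k S Y"
  shows "k_smooth_on k S (\<lambda>x. F x (Y x))"
proof -
  have "k_smooth_on k S (\<lambda>x. \<Sum>b\<in>Basis. (Y x \<bullet> b) *\<^sub>R F x b)"
    by (intro k_smooth_on_sum[OF assms(1)] k_smooth_on_bilinear[OF assms(1) bounded_bilinear_scaleR]
        assms(3) k_smooth_on_compose_bounded_linear[OF assms(1) bounded_linear_inner_left assms(4)])
  then show ?thesis
    by (subst k_smooth_on_cong) (auto intro: linear_basis_expansion[OF assms(2)])
qed

text \<open>Induction with \<open>f\<close> arbitrary: the derivative of the composite is the linear
  family \<open>frechet_derivative f (at (g x))\<close> applied to the derivative of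
  \<open>g\<close>, and for a fixed argument this family is again a composite with \<open>g\<close>,
  of lower order.\<close>

lemma k_smooth_on_compose:
  fixes f :: "'b::euclidean_space \<Rightarrow> 'c::real_normed_vector" and g :: "'a::real_normed_vector \<Rightarrow> 'b"
  assumes "open S" "open T" "k_smooth_on k T f" "k_smooth_on k S g" "g ` S \<subseteq> T"
  shows "k_smooth_on k S (\<lambda>x. f (g x))"
  using assms(3,4)
proof (induction k arbitrary: f)
  case 0
  then show ?case using assms(5) by (auto intro: continuous_on_compose2)
next
  case (Suc k)
  note df = k_smooth_on_derivative[OF assms(2) Suc.prems(1)]
   and dg = k_smooth_on_derivative[OF assms(1) Suc.prems(2)]
  show ?case
  proof (rule k_smooth_on_SucI[OF assms(1)])
    show "((\<lambda>x. f (g x)) has_derivative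
      (\<lambda>v. frechet_derivative f (at (g x)) (frechet_derivative g (at x) v))) (at x)" if "x \<in> S" for x
      using diff_chain_at[OF dg(1)[OF that] df(1)] assms(5) that by (auto simp: o_def)
    show "k_smooth_on k S (\<lambda>x. frechet_derivative f (at (g x)) (frechet_derivative g (at x) v))" for v
    proof (rule k_smooth_on_linear_family[OF assms(1)])
      show "linear (frechet_derivative f (at (g x)))" if "x \<in> S" for x
        using df(1) assms(5) that has_derivative_linear by blast
    qed (intro Suc.IH df(2) dg(2) k_smooth_on_SucD[OF assms(1) Suc.prems(2)])+
  qed
qed

section \<open>Smooth maps: the same rules for all orders at once\<close>

lemma smooth_on_cong:
  assumes "\<And>x. x \<in> S \<Longrightarrow> f x = g x"
  shows "smooth_on S f \<longleftrightarrow> smooth_on S g"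
  unfolding smooth_on_def by (intro all_cong1 k_smooth_on_cong assms)

lemma smooth_on_subset: "open S \<Longrightarrow> open T \<Longrightarrow> T \<subseteq> S \<Longrightarrow> smooth_on S f \<Longrightarrow> smooth_on T f"
  unfolding smooth_on_def using k_smooth_on_subset by blast

lemma smooth_on_const: "open S \<Longrightarrow> smooth_on S (\<lambda>x. c)"
  unfolding smooth_on_def using k_smooth_on_const by blast

lemma smooth_on_bounded_linear: "open S \<Longrightarrow> bounded_linear f \<Longrightarrow> smooth_on S f"
  unfolding smooth_on_def using k_smooth_on_bounded_linear by blast

lemma smooth_on_compose_bounded_linear:
  "open S \<Longrightarrow> bounded_linear h \<Longrightarrow> smooth_on S f \<Longrightarrow> smooth_on S (\<lambda>x. h (f x))"
  unfolding smooth_on_def using k_smooth_on_compose_bounded_linear by blast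

lemma smooth_on_add: "open S \<Longrightarrow> smooth_on S f \<Longrightarrow> smooth_on S g \<Longrightarrow> smooth_on S (\<lambda>x. f x + g x)"
  unfolding smooth_on_def using k_smooth_on_add by blast

lemma smooth_on_uminus: "open S \<Longrightarrow> smooth_on S f \<Longrightarrow> smooth_on S (\<lambda>x. - f x)"
  using smooth_on_compose_bounded_linear[OF _ bounded_linear_minus[OF bounded_linear_ident]] .

lemma smooth_on_sum: "open S \<Longrightarrow> (\<And>i. i \<in> I \<Longrightarrow> smooth_on S (f i)) \<Longrightarrow> smooth_on S (\<lambda>x. \<Sum>i\<in>I. f i x)"
  unfolding smooth_on_def by (auto intro!: k_smooth_on_sum)

lemma smooth_on_scaleR:
  assumes "open S" "smooth_on S f" "smooth_on S Y"
  shows "smooth_on S (\<lambda>x. f x *\<^sub>R Y x)"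
  unfolding smooth_on_def
proof
  show "k_smooth_on k S (\<lambda>x. f x *\<^sub>R Y x)" for k
    using assms(2,3) by (intro k_smooth_on_bilinear[OF assms(1) bounded_bilinear_scaleR]) (simp_all add: smooth_on_def)
qed

lemma smooth_on_linear_family:
  fixes F :: "'c::real_normed_vector \<Rightarrow> 'a::euclidean_space \<Rightarrow> 'b::real_normed_vector"
  assumes "open S" "\<And>x. x \<in> S \<Longrightarrow> linear (F x)" "\<And>b. smooth_on S (\<lambda>x. F x b)" "smooth_on S Y"
  shows "smooth_on S (\<lambda>x. F x (Y x))"
  using assms(3,4) k_smooth_on_linear_family[OF assms(1,2)] by (simp add: smooth_on_def)

lemma smooth_on_compose:
  fixes f :: "'b::euclidean_space \<Rightarrow> 'c::real_normed_vector" and g :: "'a::real_normed_vector \<Rightarrow> 'b"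
  assumes "open S" "open T" "smooth_on T f" "smooth_on S g" "g ` S \<subseteq> T"
  shows "smooth_on S (\<lambda>x. f (g x))"
  unfolding smooth_on_def
proof
  fix k show "k_smooth_on k S (\<lambda>x. f (g x))"
    using assms(3,4)
    by (intro k_smooth_on_compose[where f = f and g = g, OF assms(1,2) _ _ assms(5)]) (simp_all add: smooth_on_def)
qed

lemma bounded_linear_axis: "bounded_linear (axis i :: 'a::euclidean_space \<Rightarrow> 'a ^ 'n::finite)"
  by (intro linear_conv_bounded_linear[THEN iffD1] linearI) (simp_all add: vec_eq_iff axis_def)

lemma smooth_on_vec_lambda:
  fixes f :: "'n::finite \<Rightarrow> 'a::real_normed_vector \<Rightarrow> 'b::euclidean_space"
  assumes "open S" "\<And>i. smooth_on S (f i)"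
  shows "smooth_on S (\<lambda>x. \<chi> i. f i x)"
proof -
  have "smooth_on S (\<lambda>x. \<Sum>i\<in>UNIV. axis i (f i x))"
    by (intro smooth_on_sum assms smooth_on_compose_bounded_linear[OF assms(1) bounded_linear_axis])
  moreover have "(\<Sum>i\<in>UNIV. axis i (f i x)) = (\<chi> i. f i x)" for x
    by (simp add: vec_eq_iff axis_def if_distrib cong: if_cong)
  ultimately show ?thesis by simp
qed

lemma smooth_on_Pair:
  fixes f :: "'a::real_normed_vector \<Rightarrow> 'b::real_normed_vector" and g :: "'a \<Rightarrow> 'c::real_normed_vector"
  assumes "open S" "smooth_on S f" "smooth_on S g"
  shows "smooth_on S (\<lambda>x. (f x, g x))"
proof -
  have l: "bounded_linear (\<lambda>y::'b. (y, 0::'c))"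
    by (rule bounded_linear_Pair[OF bounded_linear_ident bounded_linear_zero])
  have r: "bounded_linear (\<lambda>y::'c. (0::'b, y))"
    by (rule bounded_linear_Pair[OF bounded_linear_zero bounded_linear_ident])
  from smooth_on_add[OF assms(1) smooth_on_compose_bounded_linear[OF assms(1) l assms(2)]
      smooth_on_compose_bounded_linear[OF assms(1) r assms(3)]]
  show ?thesis by simp
qed

lemma smooth_on_derivative:
  assumes "open S" "smooth_on S f"
  shows "x \<in> S \<Longrightarrow> (f has_derivative frechet_derivative f (at x)) (at x)"
    and "smooth_on S (\<lambda>x. frechet_derivative f (at x) v)"
proof -
  have "k_smooth_on (Suc k) S f" for k using assms(2) by (auto simp: smooth_on_def)
  note d = k_smooth_on_derivative[OF assms(1) this]
  show "x \<in> S \<Longrightarrow> (f has_derivative frechet_derivative f (at x)) (at x)" by (rule d(1))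
  show "smooth_on S (\<lambda>x. frechet_derivative f (at x) v)" unfolding smooth_on_def using d(2) by blast
qed

lemma smooth_on_imp_continuous_on: "smooth_on S f \<Longrightarrow> continuous_on S f"
  unfolding smooth_on_def by (metis k_smooth_on.simps(1))

text \<open>The product rule for evaluation when only the maps \<open>\<lambda>x. F x b\<close> with
  fixed \<open>b\<close> are known to be differentiable. Linearity is asked only near the point,
  because coordinate expressions such as Christoffel symbols are linear only over the range of a
  chart.\<close>

lemma has_derivative_linear_family:
  fixes F :: "'c::real_normed_vector \<Rightarrow> 'a::euclidean_space \<Rightarrow> 'b::real_normed_vector"
  assumes lin: "\<forall>\<^sub>F x in nhds x. linear (F x)"
    and F: "\<And>b. ((\<lambda>x. F x b) has_derivative F' b) (at x)"
    and Y: "(Y has_derivative Y') (at x)"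
  shows "((\<lambda>x. F x (Y x)) has_derivative (\<lambda>h. F' (Y x) h + F x (Y' h))) (at x)"
proof -
  have linx: "linear (F x)" using lin by (rule eventually_nhds_x_imp_x)
  have lin': "\<forall>\<^sub>F y in at x. linear (F y)" using lin by (simp add: eventually_nhds_conv_at)
  have ev: "\<forall>\<^sub>F y in at x. (\<Sum>b\<in>Basis. (a \<bullet> b) *\<^sub>R F y b) = F y a" for a
    using lin' by eventually_elim (rule linear_basis_expansion[symmetric])
  have ev': "\<forall>\<^sub>F y in at x. (\<Sum>b\<in>Basis. (Y y \<bullet> b) *\<^sub>R F y b) = F y (Y y)"
    using lin' by eventually_elim (rule linear_basis_expansion[symmetric])
  have "((\<lambda>y. \<Sum>b\<in>Basis. (a \<bullet> b) *\<^sub>R F y b) has_derivative (\<lambda>h. \<Sum>b\<in>Basis. (a \<bullet> b) *\<^sub>R F' b h)) (at x)" for a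
    by (auto intro!: derivative_eq_intros F)
  then have Da: "((\<lambda>y. F y a) has_derivative (\<lambda>h. \<Sum>b\<in>Basis. (a \<bullet> b) *\<^sub>R F' b h)) (at x)" for a
    by (rule has_derivative_transform_eventually[OF _ ev]) (auto simp: linear_basis_expansion[OF linx, of a])
  \<comment> \<open>The derivatives \<open>F' b\<close> are given for separate maps; that they
    depend linearly on \<open>b\<close> follows from uniqueness of derivatives.\<close>
  have F'a: "(\<Sum>b\<in>Basis. (a \<bullet> b) *\<^sub>R F' b h) = F' a h" for a h
    by (rule fun_cong[OF has_derivative_unique[OF Da F]])
  have "((\<lambda>y. \<Sum>b\<in>Basis. (Y y \<bullet> b) *\<^sub>R F y b) has_derivative
      (\<lambda>h. \<Sum>b\<in>Basis. (Y x \<bullet> b) *\<^sub>R F' b h + (Y' h \<bullet> b) *\<^sub>R F x b)) (at x)"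
    by (auto intro!: derivative_eq_intros F Y)
  then have "((\<lambda>y. F y (Y y)) has_derivative
      (\<lambda>h. \<Sum>b\<in>Basis. (Y x \<bullet> b) *\<^sub>R F' b h + (Y' h \<bullet> b) *\<^sub>R F x b)) (at x)"
    by (rule has_derivative_transform_eventually[OF _ ev'])
       (auto simp: linear_basis_expansion[OF linx, of "Y x"])
  then show ?thesis
    by (simp add: sum.distrib F'a linear_basis_expansion[OF linx, symmetric])
qed

text \<open>The linear case is used once for each argument. The base point runs through
  \<open>\<zeta>\<close> so that one rule serves a chart of the base and, with \<open>fst\<close>
  for \<open>\<zeta>\<close>, a frame chart.\<close>

lemma has_derivative_bilinear_family:
  fixes F :: "'d::real_normed_vector \<Rightarrow> 'a::euclidean_space \<Rightarrow> 'b::euclidean_space \<Rightarrow> 'c::real_normed_vector"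
    and \<zeta> :: "'e::real_normed_vector \<Rightarrow> 'd"
  assumes lin: "\<forall>\<^sub>F z in nhds (\<zeta> x). (\<forall>a. linear (F z a)) \<and> (\<forall>b. linear (\<lambda>a. F z a b))"
    and F: "\<And>a b. ((\<lambda>z. F z a b) has_derivative F' a b) (at (\<zeta> x))"
    and z: "(\<zeta> has_derivative \<zeta>') (at x)"
    and P: "(P has_derivative P') (at x)" and Q: "(Q has_derivative Q') (at x)"
  shows "((\<lambda>x. F (\<zeta> x) (P x) (Q x)) has_derivative
    (\<lambda>h. F' (P x) (Q x) (\<zeta>' h) + F (\<zeta> x) (P' h) (Q x) + F (\<zeta> x) (P x) (Q' h))) (at x)"
proof -
  have "filterlim \<zeta> (nhds (\<zeta> x)) (nhds x)"
    using has_derivative_continuous[OF z] by (simp add: continuous_within tendsto_at_iff_tendsto_nhds)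
  then have lin': "\<forall>\<^sub>F y in nhds x. (\<forall>a. linear (F (\<zeta> y) a)) \<and> (\<forall>b. linear (\<lambda>a. F (\<zeta> y) a b))"
    using lin by (rule eventually_compose_filterlim[rotated])
  have F\<zeta>: "((\<lambda>y. F (\<zeta> y) a b) has_derivative (\<lambda>h. F' a b (\<zeta>' h))) (at x)" for a b
    using diff_chain_at[OF z F[of a b]] by (simp add: o_def)
  have l1: "\<forall>\<^sub>F y in nhds x. linear (\<lambda>a. F (\<zeta> y) a b)" for b using lin' by eventually_elim simp
  have l2: "\<forall>\<^sub>F y in nhds x. linear (\<lambda>b. F (\<zeta> y) (P y) b)" using lin' by eventually_elim simp
  have "((\<lambda>y. F (\<zeta> y) (P y) b) has_derivative (\<lambda>h. F' (P x) b (\<zeta>' h) + F (\<zeta> x) (P' h) b)) (at x)" for b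
    by (rule has_derivative_linear_family[where F = "\<lambda>y a. F (\<zeta> y) a b", OF l1 F\<zeta> P])
  from has_derivative_linear_family[where F = "\<lambda>y b. F (\<zeta> y) (P y) b", OF l2 this Q]
  show ?thesis by simp
qed

section \<open>Symmetry of second derivatives\<close>

lemma has_field_derivative_along_line:
  fixes f :: "'a::real_normed_vector \<Rightarrow> real"
  assumes w: "(w has_derivative (\<lambda>r. r *\<^sub>R a)) (at s)" and f: "(f has_derivative f') (at (w s))"
  shows "((\<lambda>s. f (w s)) has_field_derivative f' a) (at s)"
proof -
  have "(\<lambda>r. f' (r *\<^sub>R a)) = (*) (f' a)"
    using linear_scale[OF has_derivative_linear[OF f]] by (simp add: fun_eq_iff mult.commute)
  then show ?thesis using diff_chain_at[OF w f] by (simp add: has_field_derivative_def o_def)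
qed

text \<open>The second difference over a parallelogram is the increment in \<open>s\<close> of an
  increment in \<open>t\<close>. The mean value theorem in \<open>s\<close> and then in
  \<open>t\<close> turns it into a second derivative at one point.\<close>

lemma second_difference_mvt:
  fixes f :: "'a::real_normed_vector \<Rightarrow> real"
  assumes S: "open S" and f: "k_smooth_on 2 S f" and h: "h > 0"
    and box: "\<And>s t. 0 \<le> s \<Longrightarrow> s \<le> h \<Longrightarrow> 0 \<le> t \<Longrightarrow> t \<le> h \<Longrightarrow> z + s *\<^sub>R a + t *\<^sub>R b \<in> S"
  obtains s t where "0 \<le> s" "s \<le> h" "0 \<le> t" "t \<le> h"
    "f (z + h *\<^sub>R a + h *\<^sub>R b) - f (z + h *\<^sub>R a) - f (z + h *\<^sub>R b) + f z
      = h * h * frechet_derivative (\<lambda>y. frechet_derivative f (at y) a) (at (z + s *\<^sub>R a + t *\<^sub>R b)) b"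
proof -
  let ?D = "\<lambda>y. frechet_derivative f (at y)"
  let ?E = "\<lambda>y. frechet_derivative (\<lambda>y. ?D y a) (at y)"
  have f2: "k_smooth_on (Suc (Suc 0)) S f" using f by (simp only: numeral_2_eq_2)
  note d1 = k_smooth_on_derivative[OF S f2]
  note d2 = k_smooth_on_derivative(1)[OF S d1(2)]
  let ?w = "\<lambda>s t. z + s *\<^sub>R a + t *\<^sub>R b"
  have D: "((\<lambda>s. f (?w s t)) has_field_derivative ?D (?w s t) a) (at s)"
    if "0 \<le> s" "s \<le> h" "0 \<le> t" "t \<le> h" for s t
    by (rule has_field_derivative_along_line[where w = "\<lambda>s. ?w s t", OF _ d1(1)[OF box[OF that]]]) (auto intro!: derivative_eq_intros)
  have E: "((\<lambda>t. ?D (?w s t) a) has_field_derivative ?E (?w s t) b) (at t)"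
    if "0 \<le> s" "s \<le> h" "0 \<le> t" "t \<le> h" for s t
    by (rule has_field_derivative_along_line[where w = "?w s", OF _ d2[OF box[OF that]]]) (auto intro!: derivative_eq_intros)
  let ?F = "\<lambda>s. f (?w s h) - f (?w s 0)"
  have "(?F has_field_derivative ?D (?w s h) a - ?D (?w s 0) a) (at s)"
    if "0 \<le> s" "s \<le> h" for s
    using that h by (intro DERIV_diff D) auto
  from MVT2[OF h this] obtain s where s: "0 < s" "s < h"
    and Fs: "?F h - ?F 0 = h * (?D (?w s h) a - ?D (?w s 0) a)" by auto
  have "((\<lambda>t. ?D (?w s t) a) has_field_derivative ?E (?w s t) b) (at t)"
    if "0 \<le> t" "t \<le> h" for t using E s that by simp
  from MVT2[OF h this] obtain t where t: "0 < t" "t < h"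
    and "?D (?w s h) a - ?D (?w s 0) a = h * ?E (?w s t) b"
    by auto
  with Fs have "?F h - ?F 0 = h * h * ?E (?w s t) b" by simp
  with s t that[of s t] show thesis by (simp add: algebra_simps)
qed

text \<open>The second difference is the same for \<open>a, b\<close> and for \<open>b, a\<close>,
  so the two mixed derivatives take a common value at points arbitrarily close to \<open>z\<close>,
  and continuity forces equality at \<open>z\<close>. Real values are what the mean value theorem
  works with.\<close>

lemma second_derivative_symmetric_real:
  fixes f :: "'a::real_normed_vector \<Rightarrow> real"
  assumes S: "open S" and f: "k_smooth_on 2 S f" and z: "z \<in> S"
  shows "frechet_derivative (\<lambda>y. frechet_derivative f (at y) a) (at z) b =
         frechet_derivative (\<lambda>y. frechet_derivative f (at y) b) (at z) a" (is "?E a b z = ?E b a z")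
proof (rule ccontr)
  assume ne: "?E a b z \<noteq> ?E b a z"
  \<comment> \<open>Half the gap: no number lies within distance less than \<open>e\<close> of both
    mixed derivatives at \<open>z\<close>.\<close>
  define e where "e = \<bar>?E a b z - ?E b a z\<bar> / 2"
  have e: "e > 0" using ne by (simp add: e_def)
  have f2: "k_smooth_on (Suc (Suc 0)) S f" using f by (simp only: numeral_2_eq_2)
  have "isCont (?E v w) z" for v w
    using k_smooth_on_derivative(2)[OF S k_smooth_on_derivative(2)[OF S f2]] z S
    by (simp add: continuous_on_eq_continuous_at)
  then have T: "((\<lambda>y. ?E v w y) \<longlongrightarrow> ?E v w z) (nhds z)" for v w
    unfolding isCont_def by (rule tendsto_at_iff_tendsto_nhds[of "?E v w" z, THEN iffD1])
  have "\<forall>\<^sub>F y in nhds z. dist (?E a b y) (?E a b z) < e \<and> dist (?E b a y) (?E b a z) < e \<and> y \<in> S"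
    by (intro eventually_conj tendstoD[OF T e] eventually_nhds_in_open[OF S z])
  then obtain r where r: "r > 0"
    and near: "\<And>y. dist y z < r \<Longrightarrow> dist (?E a b y) (?E a b z) < e \<and> dist (?E b a y) (?E b a z) < e \<and> y \<in> S"
    unfolding eventually_nhds_metric by blast
  \<comment> \<open>Small enough for the parallelogram to stay within distance \<open>r\<close> of
    \<open>z\<close>; the 1 keeps the denominator positive when \<open>a\<close> and
    \<open>b\<close> vanish.\<close>
  define h where "h = r / (2 * (norm a + norm b + 1))"
  have np: "norm a + norm b + 1 > 0" by (smt (verit) norm_ge_zero)
  have h: "h > 0" using r np by (simp add: h_def)
  have hr: "h * (norm a + norm b) < r"
  proof -
    have "h * (norm a + norm b) \<le> h * (norm a + norm b + 1)" using h by (intro mult_left_mono) auto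
    also have "\<dots> = r / 2" using np by (simp add: h_def field_simps)
    finally show ?thesis using r by simp
  qed
  have close: "dist (z + s *\<^sub>R v + t *\<^sub>R w) z < r"
    if "0 \<le> s" "s \<le> h" "0 \<le> t" "t \<le> h" "norm v + norm w = norm a + norm b" for s t v w
  proof -
    have "dist (z + s *\<^sub>R v + t *\<^sub>R w) z = norm (s *\<^sub>R v + t *\<^sub>R w)" by (simp add: dist_norm)
    also have "\<dots> \<le> s * norm v + t * norm w" using that by (metis abs_of_nonneg norm_scaleR norm_triangle_ineq)
    also have "\<dots> \<le> h * norm v + h * norm w" using that by (intro add_mono mult_right_mono) auto
    also have "\<dots> < r" using hr that(5) by (metis distrib_left)
    finally show ?thesis .
  qed
  obtain s t where st: "0 \<le> s" "s \<le> h" "0 \<le> t" "t \<le> h"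
    "f (z + h *\<^sub>R a + h *\<^sub>R b) - f (z + h *\<^sub>R a) - f (z + h *\<^sub>R b) + f z = h * h * ?E a b (z + s *\<^sub>R a + t *\<^sub>R b)"
    using near close by (rule_tac second_difference_mvt[OF S f h, of z a b]) auto
  obtain s' t' where st': "0 \<le> s'" "s' \<le> h" "0 \<le> t'" "t' \<le> h"
    "f (z + h *\<^sub>R b + h *\<^sub>R a) - f (z + h *\<^sub>R b) - f (z + h *\<^sub>R a) + f z = h * h * ?E b a (z + s' *\<^sub>R b + t' *\<^sub>R a)"
    using near close by (rule_tac second_difference_mvt[OF S f h, of z b a]) auto
  have "h * h * ?E a b (z + s *\<^sub>R a + t *\<^sub>R b) = h * h * ?E b a (z + s' *\<^sub>R b + t' *\<^sub>R a)"
    using st(5) st'(5) unfolding add.assoc[of z] add.commute[of "h *\<^sub>R b"] by linarith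
  then have "?E a b (z + s *\<^sub>R a + t *\<^sub>R b) = ?E b a (z + s' *\<^sub>R b + t' *\<^sub>R a)" using h by simp
  moreover have "dist (?E a b (z + s *\<^sub>R a + t *\<^sub>R b)) (?E a b z) < e"
    using near[OF close[OF st(1-4)]] by simp
  moreover have "dist (?E b a (z + s' *\<^sub>R b + t' *\<^sub>R a)) (?E b a z) < e"
    using near[OF close[OF st'(1-4)]] by (simp add: add.commute)
  ultimately show False by (simp add: e_def dist_real_def abs_if split: if_splits)
qed

lemma second_derivative_symmetric:
  fixes f :: "'a::real_normed_vector \<Rightarrow> 'b::euclidean_space"
  assumes S: "open S" and f: "smooth_on S f" and z: "z \<in> S"
  shows "frechet_derivative (\<lambda>y. frechet_derivative f (at y) a) (at z) b =
         frechet_derivative (\<lambda>y. frechet_derivative f (at y) b) (at z) a" (is "?E a b = ?E b a")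
proof (rule euclidean_eqI)
  fix e :: 'b assume "e \<in> Basis"
  let ?f = "\<lambda>y. f y \<bullet> e"
  have "smooth_on S ?f" by (rule smooth_on_compose_bounded_linear[OF S bounded_linear_inner_left f])
  then have f2: "k_smooth_on 2 S ?f" by (simp add: smooth_on_def)
  have D: "frechet_derivative ?f (at y) v = frechet_derivative f (at y) v \<bullet> e" if "y \<in> S" for y v
    by (rule fun_cong[OF frechet_derivativeI[OF
          bounded_linear.has_derivative[OF bounded_linear_inner_left smooth_on_derivative(1)[OF S f that]]]])
  have E: "frechet_derivative (\<lambda>y. frechet_derivative ?f (at y) v) (at z) w =
      ?E v w \<bullet> e" for v w
  proof -
    have "((\<lambda>y. frechet_derivative f (at y) v \<bullet> e) has_derivative
       (\<lambda>w. ?E v w \<bullet> e)) (at z)"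
      by (rule bounded_linear.has_derivative[OF bounded_linear_inner_left
            smooth_on_derivative(1)[OF S smooth_on_derivative(2)[OF S f] z]])
    then have "((\<lambda>y. frechet_derivative ?f (at y) v) has_derivative
       (\<lambda>w. ?E v w \<bullet> e)) (at z)"
      by (rule has_derivative_transform_within_open[OF _ S z]) (simp add: D)
    then show ?thesis by (simp add: frechet_derivativeI)
  qed
  show "?E a b \<bullet> e =
         ?E b a \<bullet> e"
    using second_derivative_symmetric_real[OF S f2 z, of a b] by (simp add: E)
qed

declare split_paired_All [simp del] split_paired_Ex [simp del]

section \<open>Charts and tangent vectors\<close>

text \<open>Interpreted for the base and for the frame atlas, so that tangent vectors, brackets and
  derivatives are developed once for both.\<close>

locale atlas =
  fixes A :: "('m, 'e::euclidean_space) atlas"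
  assumes smooth_atlas: "smooth_atlas A"
begin

abbreviation open_in :: "'m set \<Rightarrow> bool" where
  "open_in \<equiv> openin (manifold_topology A)"

abbreviation transition :: "('m, 'e) chart \<Rightarrow> ('m, 'e) chart \<Rightarrow> 'e \<Rightarrow> 'e" where
  "transition c d \<equiv> snd d \<circ> chart_inv c"

abbreviation jacobian :: "('m, 'e) chart \<Rightarrow> ('m, 'e) chart \<Rightarrow> 'e \<Rightarrow> 'e \<Rightarrow> 'e" where
  "jacobian c d z \<equiv> frechet_derivative (transition c d) (at z)"

abbreviation rep :: "('m, 'e) chart \<Rightarrow> ('m, 'e) vfield \<Rightarrow> 'e \<Rightarrow> 'e" where
  "rep c X \<equiv> \<lambda>z. coords (X (chart_inv c z)) c"

abbreviation drep :: "('m, 'e) chart \<Rightarrow> ('m, 'e) vfield \<Rightarrow> 'e \<Rightarrow> 'e \<Rightarrow> 'e" where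
  "drep c X z \<equiv> frechet_derivative (rep c X) (at z)"

abbreviation TM :: "'m \<Rightarrow> ('m, 'e) tvec set" where
  "TM \<equiv> tangent_space A"

abbreviation near :: "'m \<Rightarrow> ('m, 'e) vfield \<Rightarrow> bool" where
  "near \<equiv> field_near A"

abbreviation vf_on :: "'m set \<Rightarrow> ('m, 'e) vfield \<Rightarrow> bool" where
  "vf_on \<equiv> vector_field_on A"

abbreviation charts :: "'m \<Rightarrow> ('m, 'e) chart set" where
  "charts \<equiv> charts_at A"

lemma chart_inv_chart: "c \<in> A \<Longrightarrow> p \<in> fst c \<Longrightarrow> chart_inv c (snd c p) = p"
  using smooth_atlas by (auto simp: smooth_atlas_def intro: inv_into_f_f)

lemma chart_chart_inv: "z \<in> snd c ` fst c \<Longrightarrow> snd c (chart_inv c z) = z"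
  by (rule f_inv_into_f)

lemma chart_inv_in_image: "c \<in> A \<Longrightarrow> z \<in> snd c ` (W \<inter> fst c) \<Longrightarrow> chart_inv c z \<in> W \<inter> fst c"
  using chart_inv_chart by auto

lemma open_overlap: "c \<in> A \<Longrightarrow> d \<in> A \<Longrightarrow> open (snd c ` (fst c \<inter> fst d))"
  using smooth_atlas by (auto simp: smooth_atlas_def)

lemma open_chart_range: "c \<in> A \<Longrightarrow> open (snd c ` fst c)"
  using smooth_atlas by (auto simp: smooth_atlas_def)

lemma smooth_transition:
  "c \<in> A \<Longrightarrow> d \<in> A \<Longrightarrow> smooth_on (snd c ` (fst c \<inter> fst d)) (transition c d)"
  using smooth_atlas by (auto simp: smooth_atlas_def)

lemma charts_atD: "c \<in> charts p \<Longrightarrow> c \<in> A" "c \<in> charts p \<Longrightarrow> p \<in> fst c"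
  by (auto simp: charts_at_def)

lemma charts_at_chart_inv: "c \<in> A \<Longrightarrow> z \<in> snd c ` fst c \<Longrightarrow> c \<in> charts (chart_inv c z)"
  using chart_inv_chart by (auto simp: charts_at_def)

lemma charts_at_nonempty: "p \<in> carrier_of A \<Longrightarrow> charts p \<noteq> {}"
  by (auto simp: charts_at_def carrier_of_def)

lemma chart_in_carrier: "c \<in> A \<Longrightarrow> p \<in> fst c \<Longrightarrow> p \<in> carrier_of A"
  by (auto simp: carrier_of_def)

lemma some_chart: "p \<in> carrier_of A \<Longrightarrow> (SOME c. c \<in> charts p) \<in> charts p"
  using charts_at_nonempty by (metis ex_in_conv someI)

lemma jacobian_has_derivative:
  assumes "c \<in> charts p" "d \<in> charts p"
  shows "(transition c d has_derivative jacobian c d (snd c p)) (at (snd c p))"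
  using assms by (intro smooth_on_derivative(1)[OF open_overlap smooth_transition]) (auto simp: charts_at_def)

lemma linear_jacobian: "c \<in> charts p \<Longrightarrow> d \<in> charts p \<Longrightarrow> linear (jacobian c d (snd c p))"
  using jacobian_has_derivative has_derivative_linear by blast

lemma openin_domain_vimage:
  assumes "c \<in> A" "open V"
  shows "open_in (fst c \<inter> snd c -` V)"
  unfolding manifold_topology_def using assms by (intro topology_generated_by_Basis) blast

lemma openin_domain: "c \<in> A \<Longrightarrow> open_in (fst c)"
  using openin_domain_vimage[of c UNIV] by simp

lemma openin_subset_carrier: "open_in W \<Longrightarrow> W \<subseteq> carrier_of A"
  unfolding manifold_topology_def
  by (drule openin_subset) (fastforce simp: topology_generated_by_topspace carrier_of_def)

lemma openin_carrier: "open_in (carrier_of A)"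
  unfolding carrier_of_def using openin_domain by (intro openin_Union) auto

text \<open>Induction over the generation of the topology. Chart images commute with intersections
  by injectivity, and the image of a generating set is the preimage of an open set under a
  coordinate change on the open overlap.\<close>

lemma open_chart_image:
  assumes "open_in W" "c \<in> A"
  shows "open (snd c ` (W \<inter> fst c))"
proof -
  let ?B = "{fst c \<inter> snd c -` V | c V. c \<in> A \<and> open V}"
  have "generate_topology_on ?B W"
    using assms(1) by (simp add: manifold_topology_def openin_topology_generated_by_iff)
  then show ?thesis
  proof (induction)
    case Empty
    then show ?case by simp
  next
    case (Int a b)
    have "inj_on (snd c) (fst c)" using smooth_atlas assms(2) by (auto simp: smooth_atlas_def)
    then have "snd c ` (a \<inter> b \<inter> fst c) = snd c ` (a \<inter> fst c) \<inter> snd c ` (b \<inter> fst c)"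
      by (auto dest: inj_onD)
    then show ?case using Int by (simp add: open_Int)
  next
    case (UN K)
    have "snd c ` (\<Union> K \<inter> fst c) = (\<Union>k\<in>K. snd c ` (k \<inter> fst c))" by auto
    then show ?case using UN by (simp add: open_UN)
  next
    case (Basis s)
    then obtain d V where s: "s = fst d \<inter> snd d -` V" "d \<in> A" "open V" by auto
    have "snd c ` (s \<inter> fst c) = snd c ` (fst c \<inter> fst d) \<inter> transition c d -` V"
      using chart_inv_chart[OF assms(2)] by (auto simp: s(1))
    moreover have "open (snd c ` (fst c \<inter> fst d) \<inter> transition c d -` V)"
      using smooth_on_imp_continuous_on[OF smooth_transition[OF assms(2) s(2)]] open_overlap[OF assms(2) s(2)] s(3)
      by (metis continuous_on_open_vimage inf_commute)
    ultimately show ?case by simp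
  qed
qed

text \<open>The chain rule with a coordinate change. With a chart for \<open>f\<close> it gives the
  cocycle rule of Jacobians; with a function or a map between manifolds it shows that
  \<open>dir_deriv\<close> and \<open>differential\<close> do not depend on the chosen
  chart.\<close>

lemma has_derivative_change_chart:
  fixes f :: "'m \<Rightarrow> 'b::real_normed_vector"
  assumes c: "c \<in> charts p" and d: "d \<in> charts p"
    and f: "((f \<circ> chart_inv d) has_derivative f') (at (snd d p))"
  shows "((f \<circ> chart_inv c) has_derivative (\<lambda>h. f' (jacobian c d (snd c p) h))) (at (snd c p))"
proof -
  note cd = charts_atD[OF c] charts_atD[OF d]
  have "((f \<circ> chart_inv d) has_derivative f') (at (transition c d (snd c p)))"
    using f cd by (simp add: chart_inv_chart)
  from diff_chain_at[OF jacobian_has_derivative[OF c d] this]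
  have "((\<lambda>z. f (chart_inv d (snd d (chart_inv c z)))) has_derivative (\<lambda>h. f' (jacobian c d (snd c p) h))) (at (snd c p))"
    by (simp add: o_def)
  then show ?thesis
    by (rule has_derivative_transform_within_open[OF _ open_overlap[of c d]])
       (use cd in \<open>auto simp: chart_inv_chart\<close>)
qed

lemma jacobian_cocycle:
  assumes "c \<in> charts p" "d \<in> charts p" "e \<in> charts p"
  shows "jacobian c e (snd c p) h = jacobian d e (snd d p) (jacobian c d (snd c p) h)"
  by (rule fun_cong[OF frechet_derivativeI[OF has_derivative_change_chart[OF assms(1,2) jacobian_has_derivative[OF assms(2,3)]]]])

lemma jacobian_refl:
  assumes "c \<in> charts p"
  shows "jacobian c c (snd c p) h = h"
proof -
  note c = charts_atD[OF assms]
  have "(transition c c has_derivative (\<lambda>h. h)) (at (snd c p))"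
    by (rule has_derivative_transform_within_open[OF has_derivative_ident open_chart_range[OF c(1)]])
       (use c in \<open>auto simp: chart_inv_chart\<close>)
  then show ?thesis by (simp add: frechet_derivativeI)
qed

section \<open>Tangent vectors and their coordinates\<close>

lemma coords_change:
  assumes "v \<in> TM p" "c \<in> charts p" "d \<in> charts p"
  shows "coords v d = jacobian c d (snd c p) (coords v c)"
  using assms unfolding tangent_space_def by blast

lemma coords_outside: "v \<in> TM p \<Longrightarrow> c \<notin> charts p \<Longrightarrow> coords v c = 0"
  unfolding tangent_space_def by blast

lemma tangent_spaceI:
  assumes "\<And>c. c \<notin> charts p \<Longrightarrow> coords v c = 0"
    and "\<And>c d. c \<in> charts p \<Longrightarrow> d \<in> charts p \<Longrightarrow> coords v d = jacobian c d (snd c p) (coords v c)"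
  shows "v \<in> TM p"
  using assms unfolding tangent_space_def by blast

text \<open>One chart determines a tangent vector: Jacobians give the coordinates in the other
  charts around \<open>p\<close>, and elsewhere they are 0. Identities of tangent vectors are
  checked in one chart through this.\<close>

lemma tangent_eqI:
  assumes "v \<in> TM p" "w \<in> TM p" "c \<in> charts p" "coords v c = coords w c"
  shows "v = w"
proof -
  have "coords v d = coords w d" for d
  proof (cases "d \<in> charts p")
    case True
    then show ?thesis using coords_change[OF assms(1,3)] coords_change[OF assms(2,3)] assms(4) by simp
  next
    case False
    then show ?thesis using assms(1,2) by (simp add: coords_outside)
  qed
  then show ?thesis by (metis coords_inject ext)
qed

lemma coords_at_charts: "c \<in> charts p \<Longrightarrow> coords (at_charts A p F) c = F c"
  by (simp add: at_charts_def Tvec_inverse)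

lemma at_charts_tangent:
  assumes "\<And>c d. c \<in> charts p \<Longrightarrow> d \<in> charts p \<Longrightarrow> F d = jacobian c d (snd c p) (F c)"
  shows "at_charts A p F \<in> TM p"
proof (rule tangent_spaceI)
  show "coords (at_charts A p F) c = 0" if "c \<notin> charts p" for c
    using that by (simp add: at_charts_def Tvec_inverse)
  show "coords (at_charts A p F) d = jacobian c d (snd c p) (coords (at_charts A p F) c)"
    if "c \<in> charts p" "d \<in> charts p" for c d
    unfolding coords_at_charts[OF that(1)] coords_at_charts[OF that(2)] by (rule assms[OF that])
qed

lemma coords_simps [simp]:
  "coords (v + w) c = coords v c + coords w c"
  "coords (v - w) c = coords v c - coords w c"
  "coords (- v) c = - coords v c"
  "coords (r *\<^sub>R v) c = r *\<^sub>R coords v c"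
  "coords 0 c = 0"
  by (transfer, simp)+

lemma coords_sum: "coords (\<Sum>i\<in>I. f i) c = (\<Sum>i\<in>I. coords (f i) c)"
  by (induction I rule: infinite_finite_induct) simp_all

lemma subspace_tangent: "subspace (TM p)"
proof (rule subspaceI)
  show "0 \<in> TM p"
    by (rule tangent_spaceI) (simp_all add: linear_0[OF linear_jacobian])
next
  fix v w assume v: "v \<in> TM p" and w: "w \<in> TM p"
  show "v + w \<in> TM p"
  proof (rule tangent_spaceI)
    show "coords (v + w) d = jacobian c d (snd c p) (coords (v + w) c)"
      if "c \<in> charts p" "d \<in> charts p" for c d
      by (simp add: linear_add[OF linear_jacobian[OF that]] coords_change[OF v that] coords_change[OF w that])
  qed (simp add: coords_outside[OF v] coords_outside[OF w])
next
  fix r v assume v: "v \<in> TM p"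
  show "r *\<^sub>R v \<in> TM p"
  proof (rule tangent_spaceI)
    show "coords (r *\<^sub>R v) d = jacobian c d (snd c p) (coords (r *\<^sub>R v) c)"
      if "c \<in> charts p" "d \<in> charts p" for c d
      by (simp add: linear_scale[OF linear_jacobian[OF that]] coords_change[OF v that])
  qed (simp add: coords_outside[OF v])
qed

lemmas tangent_add = subspace_add[OF subspace_tangent]
  and tangent_scale = subspace_scale[OF subspace_tangent]
  and tangent_diff = subspace_diff[OF subspace_tangent]
  and tangent_sum = subspace_sum[OF subspace_tangent]
  and tangent_0 = subspace_0[OF subspace_tangent]

text \<open>The field with constant coordinates \<open>b\<close> in the chart \<open>c\<close>; for
  a basis vector it is a coordinate field. These fields are the local frame behind the Christoffel
  symbols, and they extend a single tangent vector to a field near its base point.\<close>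

definition coord_field :: "('m, 'e) chart \<Rightarrow> 'e \<Rightarrow> ('m, 'e) vfield" where
  "coord_field c b q = (if c \<in> charts q then at_charts A q (\<lambda>d. jacobian c d (snd c q) b) else 0)"

lemma coord_field_tangent: "coord_field c b q \<in> TM q"
proof (cases "c \<in> charts q")
  case True
  then have "at_charts A q (\<lambda>d. jacobian c d (snd c q) b) \<in> TM q"
    by (intro at_charts_tangent jacobian_cocycle)
  then show ?thesis using True by (simp add: coord_field_def)
qed (simp add: coord_field_def tangent_0)

lemma coords_coord_field:
  "c \<in> charts q \<Longrightarrow> d \<in> charts q \<Longrightarrow> coords (coord_field c b q) d = jacobian c d (snd c q) b"
  by (simp add: coord_field_def coords_at_charts)

lemma coords_coord_field_self [simp]: "c \<in> charts q \<Longrightarrow> coords (coord_field c b q) c = b"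
  by (simp add: coords_coord_field jacobian_refl)

lemma coord_field_eqI:
  assumes "c \<in> charts q" "v \<in> TM q"
  shows "coord_field c (coords v c) q = v"
  using assms by (intro tangent_eqI[OF coord_field_tangent assms(2,1)]) simp

lemma coord_field_add: "coord_field c (a + b) q = coord_field c a q + coord_field c b q"
proof (cases "c \<in> charts q")
  case True
  show ?thesis
    by (rule tangent_eqI[OF coord_field_tangent tangent_add[OF coord_field_tangent coord_field_tangent] True])
       (simp add: True)
qed (simp add: coord_field_def)

lemma coord_field_scale: "coord_field c (r *\<^sub>R b) q = r *\<^sub>R coord_field c b q"
proof (cases "c \<in> charts q")
  case True
  show ?thesis
    by (rule tangent_eqI[OF coord_field_tangent tangent_scale[OF coord_field_tangent] True])
       (simp add: True)
qed (simp add: coord_field_def)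

text \<open>Smoothness in one chart whose domain contains \<open>W\<close> suffices: in a chart
  \<open>d\<close> the representative is the Jacobian of the change from \<open>c\<close> to
  \<open>d\<close> applied to the representative in \<open>c\<close>, both taken along the change
  from \<open>d\<close> to \<open>c\<close>.\<close>

lemma vector_field_onI:
  assumes W: "open_in W" and c: "c \<in> A" "W \<subseteq> fst c"
    and tan: "\<And>q. q \<in> W \<Longrightarrow> X q \<in> TM q"
    and smooth: "smooth_on (snd c ` W) (rep c X)"
  shows "vf_on W X"
  unfolding vector_field_on_def
proof (intro conjI ballI)
  fix d assume d: "d \<in> A"
  let ?S = "snd d ` (W \<inter> fst d)" and ?T = "snd c ` (W \<inter> fst d \<inter> fst c)"
  have S: "open ?S" by (rule open_chart_image[OF W d])
  have T: "open ?T" by (rule open_chart_image[OF openin_Int[OF W openin_domain[OF d]] c(1)])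
  have tr: "smooth_on ?T (transition c d)"
    using c(2) by (intro smooth_on_subset[OF open_overlap[OF c(1) d] T _ smooth_transition[OF c(1) d]]) auto
  have oW: "open (snd c ` W)" using open_chart_image[OF W c(1)] c(2) by (simp add: Int_absorb2)
  have *: "smooth_on ?T (\<lambda>y. jacobian c d y (rep c X y))"
  proof (rule smooth_on_linear_family[where F = "jacobian c d" and Y = "rep c X", OF T])
    show "linear (jacobian c d y)" if "y \<in> ?T" for y
      using smooth_on_derivative(1)[OF T tr that] has_derivative_linear by blast
    show "smooth_on ?T (rep c X)" using oW T by (rule smooth_on_subset[OF _ _ _ smooth]) auto
  qed (rule smooth_on_derivative(2)[OF T tr])
  have S1: "smooth_on ?S (\<lambda>z. jacobian c d (transition d c z) (rep c X (transition d c z)))"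
  proof (rule smooth_on_compose[where g = "transition d c", OF S T *])
    show "smooth_on ?S (transition d c)"
      using c(2) by (intro smooth_on_subset[OF open_overlap[OF d c(1)] S _ smooth_transition[OF d c(1)]]) auto
    show "transition d c ` ?S \<subseteq> ?T" using c(2) by (auto simp: chart_inv_chart[OF d])
  qed
  have eq: "jacobian c d (transition d c z) (rep c X (transition d c z)) = rep d X z"
    if "z \<in> ?S" for z
  proof -
    from that obtain q where q: "q \<in> W" "q \<in> fst d" "z = snd d q" by auto
    then have "c \<in> charts q" "d \<in> charts q" using c d by (auto simp: charts_at_def)
    then show ?thesis using q tan by (simp add: chart_inv_chart charts_atD coords_change[of "X q" q c d])
  qed
  show "smooth_on ?S (rep d X)"
    by (rule smooth_on_cong[THEN iffD1, OF eq S1])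
qed (use tan in auto)

lemma coord_field_vector_field: "c \<in> A \<Longrightarrow> vf_on (fst c) (coord_field c b)"
proof (rule vector_field_onI)
  assume c: "c \<in> A"
  show "smooth_on (snd c ` fst c) (rep c (coord_field c b))"
    using smooth_on_const[OF open_chart_range[OF c], of b]
    by (subst smooth_on_cong[where g = "\<lambda>_. b"]) (auto simp: charts_at_chart_inv c)
qed (auto intro: openin_domain coord_field_tangent)

lemma coord_field_near: "c \<in> charts p \<Longrightarrow> field_near A p (coord_field c b)"
  unfolding field_near_def using charts_atD[of c p]
  by (intro exI[of _ "fst c"] conjI openin_domain coord_field_vector_field)

lemma vector_field_on_subset:
  assumes "vf_on W X" "open_in W" "open_in V" "V \<subseteq> W"
  shows "vf_on V X"
  unfolding vector_field_on_def
proof (intro conjI ballI)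
  fix c assume c: "c \<in> A"
  have "smooth_on (snd c ` (W \<inter> fst c)) (rep c X)" using assms(1) c by (auto simp: vector_field_on_def)
  then show "smooth_on (snd c ` (V \<inter> fst c)) (rep c X)"
    using assms(4) by (rule_tac smooth_on_subset[OF open_chart_image[OF assms(2) c] open_chart_image[OF assms(3) c]]) auto
qed (use assms in \<open>auto simp: vector_field_on_def\<close>)

lemma field_nearE:
  assumes "near p X" "c \<in> charts p"
  obtains W where "open_in W" "p \<in> W" "W \<subseteq> fst c" "vf_on W X"
    "open (snd c ` W)" "smooth_on (snd c ` W) (rep c X)"
proof -
  from assms(1) obtain V where V: "open_in V" "p \<in> V" "vf_on V X" by (auto simp: field_near_def)
  let ?W = "V \<inter> fst c"
  have W: "open_in ?W" using V(1) openin_domain[OF charts_atD(1)[OF assms(2)]] by (rule openin_Int)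
  have vf: "vf_on ?W X" by (rule vector_field_on_subset[OF V(3,1) W]) auto
  have "snd c ` (?W \<inter> fst c) = snd c ` ?W" by auto
  then show thesis
    using that[OF W _ _ vf] V(2) assms(2) open_chart_image[OF W, of c] vf
    by (auto simp: charts_at_def vector_field_on_def)
qed

lemma vector_field_onD:
  assumes "vf_on W X" "c \<in> A" "W \<subseteq> fst c"
  shows "smooth_on (snd c ` W) (rep c X)"
proof -
  have "smooth_on (snd c ` (W \<inter> fst c)) (rep c X)" using assms(1,2) unfolding vector_field_on_def by blast
  then show ?thesis using assms(3) by (simp add: Int_absorb2)
qed

lemma open_chart_image_subset: "open_in W \<Longrightarrow> c \<in> A \<Longrightarrow> W \<subseteq> fst c \<Longrightarrow> open (snd c ` W)"
  using open_chart_image[of W c] by (simp add: Int_absorb2)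

lemma field_nearE2:
  assumes "near p X" "near p Y" "c \<in> charts p"
  obtains W where "open_in W" "p \<in> W" "W \<subseteq> fst c" "vf_on W X" "vf_on W Y"
proof -
  obtain V where V: "open_in V" "p \<in> V" "V \<subseteq> fst c" "vf_on V X"
    by (rule field_nearE[OF assms(1,3)])
  obtain U where U: "open_in U" "p \<in> U" "U \<subseteq> fst c" "vf_on U Y"
    by (rule field_nearE[OF assms(2,3)])
  have o: "open_in (V \<inter> U)" by (rule openin_Int[OF V(1) U(1)])
  show thesis
    by (rule that[OF o _ _ vector_field_on_subset[OF V(4,1) o] vector_field_on_subset[OF U(4,1) o]])
       (use V(2,3) U(2) in auto)
qed

lemma vector_field_on_add:
  assumes "open_in W" "vf_on W X" "vf_on W Y"
  shows "vf_on W (\<lambda>q. X q + Y q)"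
  unfolding vector_field_on_def
proof (intro conjI ballI)
  fix c assume c: "c \<in> A"
  show "smooth_on (snd c ` (W \<inter> fst c)) (rep c (\<lambda>q. X q + Y q))"
    unfolding coords_simps using assms c
    by (intro smooth_on_add[OF open_chart_image]) (auto simp: vector_field_on_def)
qed (use assms in \<open>auto simp: vector_field_on_def intro: tangent_add\<close>)

lemma vector_field_on_scale:
  assumes "open_in W" "smooth_fun_on A W f" "vf_on W Y"
  shows "vf_on W (\<lambda>q. f q *\<^sub>R Y q)"
  unfolding vector_field_on_def
proof (intro conjI ballI)
  fix c assume c: "c \<in> A"
  have "smooth_on (snd c ` (W \<inter> fst c)) (\<lambda>z. f (chart_inv c z))"
    using assms(2) c by (auto simp: smooth_fun_on_def o_def)
  then show "smooth_on (snd c ` (W \<inter> fst c)) (rep c (\<lambda>q. f q *\<^sub>R Y q))"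
    unfolding coords_simps using assms(3) c
    by (intro smooth_on_scaleR[OF open_chart_image[OF assms(1) c]]) (auto simp: vector_field_on_def)
qed (use assms in \<open>auto simp: vector_field_on_def intro: tangent_scale\<close>)

lemma smooth_fun_onI:
  assumes W: "open_in W" and c: "c \<in> A" "W \<subseteq> fst c" and smooth: "smooth_on (snd c ` W) (f \<circ> chart_inv c)"
  shows "smooth_fun_on A W f"
  unfolding smooth_fun_on_def
proof
  fix d assume d: "d \<in> A"
  let ?S = "snd d ` (W \<inter> fst d)"
  have S: "open ?S" by (rule open_chart_image[OF W d])
  have S1: "smooth_on ?S (\<lambda>z. (f \<circ> chart_inv c) (transition d c z))"
  proof (rule smooth_on_compose[where g = "transition d c", OF S open_chart_image_subset[OF W c] smooth])
    show "smooth_on ?S (transition d c)"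
      using c(2) by (intro smooth_on_subset[OF open_overlap[OF d c(1)] S _ smooth_transition[OF d c(1)]]) auto
    show "transition d c ` ?S \<subseteq> snd c ` W" using c(2) by (auto simp: chart_inv_chart[OF d])
  qed
  have eq: "(f \<circ> chart_inv c) (transition d c z) = (f \<circ> chart_inv d) z" if "z \<in> ?S" for z
    using that c d by (auto simp: chart_inv_chart subset_iff)
  show "smooth_on ?S (f \<circ> chart_inv d)"
    by (rule smooth_on_cong[THEN iffD1, OF eq S1])
qed

lemma field_near_cong:
  assumes "near p Y" "open_in W" "p \<in> W" and eq: "\<And>q. q \<in> W \<Longrightarrow> Y q = Y' q"
  shows "near p Y'"
proof -
  from assms(1) obtain V where V: "open_in V" "p \<in> V" "vf_on V Y" by (auto simp: field_near_def)
  have o: "open_in (V \<inter> W)" by (rule openin_Int[OF V(1) assms(2)])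
  have vf: "vf_on (V \<inter> W) Y" by (rule vector_field_on_subset[OF V(3,1) o]) auto
  have "vf_on (V \<inter> W) Y'"
    unfolding vector_field_on_def
  proof (intro conjI ballI)
    fix c assume c: "c \<in> A"
    have e: "rep c Y z = rep c Y' z" if "z \<in> snd c ` (V \<inter> W \<inter> fst c)" for z
      using chart_inv_in_image[OF c that] eq by simp
    have s: "smooth_on (snd c ` (V \<inter> W \<inter> fst c)) (rep c Y)"
      using vf c unfolding vector_field_on_def by blast
    show "smooth_on (snd c ` (V \<inter> W \<inter> fst c)) (rep c Y')"
      by (rule smooth_on_cong[THEN iffD1, OF e s])
  qed (use vf eq in \<open>auto simp: vector_field_on_def\<close>)
  then show ?thesis using o V(2) assms(3) by (auto simp: field_near_def)
qed

lemma field_near_tangent: "near p X \<Longrightarrow> X p \<in> TM p"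
  by (auto simp: field_near_def vector_field_on_def)

lemma field_near_carrier: "near p X \<Longrightarrow> p \<in> carrier_of A"
  using openin_subset_carrier by (auto simp: field_near_def)

lemma field_near_has_derivative:
  assumes "near p X" "c \<in> charts p"
  shows "(rep c X has_derivative drep c X (snd c p)) (at (snd c p))"
proof -
  obtain W where "p \<in> W" "open (snd c ` W)" "smooth_on (snd c ` W) (rep c X)"
    by (rule field_nearE[OF assms])
  then show ?thesis by (intro smooth_on_derivative(1)[of "snd c ` W"] imageI)
qed

lemma field_nearI:
  assumes "open_in W" "p \<in> W" "vf_on W X"
  shows "near p X"
  using assms by (auto simp: field_near_def)

lemma dir_deriv_chart:
  assumes "c \<in> charts p" "v \<in> TM p"
    and "((f \<circ> chart_inv c) has_derivative f') (at (snd c p))"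
  shows "dir_deriv A p v f = f' (coords v c)"
proof -
  define d where "d = (SOME d. d \<in> charts p)"
  have d: "d \<in> charts p" unfolding d_def using assms(1) by (rule someI)
  have "frechet_derivative (f \<circ> chart_inv d) (at (snd d p)) = (\<lambda>h. f' (jacobian d c (snd d p) h))"
    by (rule frechet_derivativeI[OF has_derivative_change_chart[OF d assms(1,3)]])
  then show ?thesis
    by (simp add: dir_deriv_def Let_def d_def[symmetric] coords_change[OF assms(2) d assms(1)])
qed

lemma lie_bracket_coords:
  assumes "c \<in> charts p"
    and "(rep c X has_derivative X') (at (snd c p))" "(rep c Y has_derivative Y') (at (snd c p))"
  shows "coords (lie_bracket A X Y p) c = Y' (coords (X p) c) - X' (coords (Y p) c)"
  unfolding lie_bracket_def coords_at_charts[OF assms(1)]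
  using frechet_derivativeI[OF assms(2)] frechet_derivativeI[OF assms(3)] by simp

end

section \<open>Levi-Civita connections in coordinates\<close>

locale riemannian = atlas A for A :: "('m, 'e::euclidean_space) atlas" +
  fixes g :: "('m, 'e) metric_tensor" and D :: "('m, 'e) connection"
  assumes metric: "riemannian_metric A g" and levi_civita: "levi_civita A g D"
begin

section \<open>Consequences of the axioms for metric and connection\<close>

lemma affine: "affine_connection A D" and torsion: "torsion_free A D" and compatible: "metric_connection A g D"
  using levi_civita by (auto simp: levi_civita_def)

lemmas affine_at = affine[unfolded affine_connection_def, THEN conjunct1, THEN bspec, THEN spec, THEN mp]

lemma D_tangent:
  assumes "near p Y" "v \<in> TM p"
  shows "D p v Y \<in> TM p"
  by (rule affine_at[OF field_near_carrier[OF assms(1)] assms(1), THEN conjunct1, THEN bspec, OF assms(2)])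

lemma D_linear:
  assumes "near p Y" "v \<in> TM p" "w \<in> TM p"
  shows "D p (a *\<^sub>R v + b *\<^sub>R w) Y = a *\<^sub>R D p v Y + b *\<^sub>R D p w Y"
  by (rule affine_at[OF field_near_carrier[OF assms(1)] assms(1), THEN conjunct2, THEN conjunct1,
        THEN bspec, OF assms(2), THEN bspec, OF assms(3), THEN spec, THEN spec])

lemma D_add:
  assumes "near p Y" "near p Z" "v \<in> TM p"
  shows "D p v (\<lambda>q. Y q + Z q) = D p v Y + D p v Z"
  by (rule affine_at[OF field_near_carrier[OF assms(1)] assms(1), THEN conjunct2, THEN conjunct2, THEN conjunct1,
        THEN bspec, OF assms(3), THEN spec, THEN mp, OF assms(2)])

lemma D_leibniz:
  assumes "near p Y" "smooth_fun_near A p f" "v \<in> TM p"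
  shows "D p v (\<lambda>q. f q *\<^sub>R Y q) = dir_deriv A p v f *\<^sub>R Y p + f p *\<^sub>R D p v Y"
  by (rule affine_at[OF field_near_carrier[OF assms(1)] assms(1), THEN conjunct2, THEN conjunct2, THEN conjunct2,
        THEN bspec, OF assms(3), THEN spec, THEN mp, OF assms(2)])

lemma D_field:
  assumes "open_in W" "vf_on W X" "vf_on W Y"
  shows "vf_on W (cov_deriv D X Y)"
  using assms affine[unfolded affine_connection_def, THEN conjunct2, THEN spec, THEN spec, THEN spec, THEN mp] by simp

lemma D_field_near:
  assumes "near p X" "near p Y"
  shows "field_near A p (cov_deriv D X Y)"
proof -
  obtain c where c: "c \<in> charts p" using some_chart[OF field_near_carrier[OF assms(1)]] by blast
  obtain W where "open_in W" "p \<in> W" "vf_on W X" "vf_on W Y"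
    by (rule field_nearE2[OF assms c])
  then show ?thesis using D_field[of W X Y] by (auto simp: field_near_def)
qed

lemma torsion_freeD:
  assumes "near p X" "near p Y"
  shows "lie_bracket A X Y p = D p (X p) Y - D p (Y p) X"
  using torsion[unfolded torsion_free_def, THEN bspec, OF field_near_carrier[OF assms(1)], THEN spec, THEN spec, THEN mp] assms
  by simp

lemma lie_bracket_swap:
  "near p X \<Longrightarrow> near p Y \<Longrightarrow> lie_bracket A X Y p = - lie_bracket A Y X p"
  by (simp add: torsion_freeD)

text \<open>As a difference of covariant derivatives the bracket is tangent, without differentiating
  Jacobians of coordinate changes.\<close>

lemma lie_bracket_tangent: "near p X \<Longrightarrow> near p Y \<Longrightarrow> lie_bracket A X Y p \<in> TM p"
  by (simp add: torsion_freeD tangent_diff D_tangent field_near_tangent)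

lemma compatibleD:
  assumes "near p Y" "near p Z" "v \<in> TM p"
  shows "dir_deriv A p v (\<lambda>q. g q (Y q) (Z q)) = g p (D p v Y) (Z p) + g p (Y p) (D p v Z)"
  using compatible[unfolded metric_connection_def, THEN bspec, OF field_near_carrier[OF assms(1)],
      THEN bspec, OF assms(3), THEN spec, THEN spec, THEN mp] assms by simp

lemmas metric_at = metric[unfolded riemannian_metric_def, THEN conjunct1, THEN bspec]

lemma g_sym:
  assumes "v \<in> TM p" "w \<in> TM p" "p \<in> carrier_of A"
  shows "g p v w = g p w v"
  by (rule metric_at[OF assms(3), THEN conjunct1, THEN bspec, OF assms(1), THEN bspec, OF assms(2)])

lemma g_linear:
  assumes "v \<in> TM p" "w \<in> TM p" "z \<in> TM p" "p \<in> carrier_of A"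
  shows "g p (a *\<^sub>R v + b *\<^sub>R w) z = a * g p v z + b * g p w z"
  by (rule metric_at[OF assms(4), THEN conjunct2, THEN conjunct1, THEN bspec, OF assms(1),
        THEN bspec, OF assms(2), THEN bspec, OF assms(3), THEN spec, THEN spec])

lemma g_pos: "v \<in> TM p \<Longrightarrow> p \<in> carrier_of A \<Longrightarrow> v \<noteq> 0 \<Longrightarrow> g p v v > 0"
  using metric_at[of p, THEN conjunct2, THEN conjunct2] by blast

lemma g_smooth:
  "open_in W \<Longrightarrow> vf_on W X \<Longrightarrow> vf_on W Y \<Longrightarrow> smooth_fun_on A W (\<lambda>p. g p (X p) (Y p))"
  using metric[unfolded riemannian_metric_def, THEN conjunct2] by blast

lemma g_left:
  assumes "v \<in> TM p" "w \<in> TM p" "z \<in> TM p" "p \<in> carrier_of A"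
  shows "g p (v + w) z = g p v z + g p w z" "g p (v - w) z = g p v z - g p w z" "g p (r *\<^sub>R v) z = r * g p v z"
  using g_linear[OF assms, of 1 1] g_linear[OF assms, of 1 "-1"] g_linear[OF assms, of r 0] by simp_all

lemma g_minus_left:
  assumes "v \<in> TM p" "z \<in> TM p" "p \<in> carrier_of A"
  shows "g p (- v) z = - g p v z"
  using g_left(3)[OF assms(1,1,2,3), of "-1"] by simp

lemma g_right:
  assumes "v \<in> TM p" "w \<in> TM p" "z \<in> TM p" "p \<in> carrier_of A"
  shows "g p z (v + w) = g p z v + g p z w" "g p z (v - w) = g p z v - g p z w" "g p z (r *\<^sub>R v) = r * g p z v"
  using g_left[OF assms] assms(1,2)
  by (simp_all add: g_sym[OF assms(3) _ assms(4)] tangent_add tangent_diff tangent_scale)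

lemma g_zero:
  assumes "z \<in> TM p" "p \<in> carrier_of A"
  shows "g p 0 z = 0" "g p z 0 = 0"
  using g_left(3)[OF tangent_0 tangent_0 assms, of 0] g_right(3)[OF tangent_0 tangent_0 assms, of 0] by simp_all

lemma g_sum_left:
  assumes "\<And>i. i \<in> I \<Longrightarrow> v i \<in> TM p" "z \<in> TM p" "p \<in> carrier_of A"
  shows "g p (\<Sum>i\<in>I. v i) z = (\<Sum>i\<in>I. g p (v i) z)"
  using assms(1)
  by (induction I rule: infinite_finite_induct)
     (simp_all add: g_zero[OF assms(2,3)] g_left(1)[OF _ _ assms(2,3)] tangent_sum)

lemma nondegenerate:
  assumes "v \<in> TM p" "w \<in> TM p" "p \<in> carrier_of A"
    and "\<And>z. z \<in> TM p \<Longrightarrow> g p v z = g p w z"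
  shows "v = w"
proof (rule ccontr)
  assume "v \<noteq> w"
  moreover have vw: "v - w \<in> TM p" using assms(1,2) by (rule tangent_diff)
  ultimately have "g p (v - w) (v - w) > 0" using g_pos[OF vw assms(3)] by simp
  then show False using assms(4)[OF vw] g_left(2)[OF assms(1,2) vw assms(3)] by simp
qed

text \<open>Compatibility expands the three derivatives and torsion-freeness the three brackets; by
  symmetry of \<open>g\<close> everything cancels except the covariant derivative of
  \<open>Y\<close> along \<open>X\<close>, which occurs twice.\<close>

lemma koszul:
  assumes X: "near p X" and Y: "near p Y" and Z: "near p Z"
  shows "2 * g p (D p (X p) Y) (Z p) =
    dir_deriv A p (X p) (\<lambda>q. g q (Y q) (Z q)) + dir_deriv A p (Y p) (\<lambda>q. g q (X q) (Z q))
    - dir_deriv A p (Z p) (\<lambda>q. g q (X q) (Y q)) + g p (lie_bracket A X Y p) (Z p)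
    - g p (lie_bracket A X Z p) (Y p) - g p (lie_bracket A Y Z p) (X p)"
proof -
  note T = field_near_tangent[OF X] field_near_tangent[OF Y] field_near_tangent[OF Z]
  note p = field_near_carrier[OF X]
  show ?thesis
    unfolding compatibleD[OF X Y T(3)] compatibleD[OF X Z T(2)] compatibleD[OF Y Z T(1)]
      torsion_freeD[OF X Y] torsion_freeD[OF X Z] torsion_freeD[OF Y Z]
    by (simp add: g_left(2) D_tangent T X Y Z p g_sym[of "X p" p "D _ _ _"] g_sym[of "Y p" p "D _ _ _"])
qed

lemma smooth_fun_near_const: "p \<in> carrier_of A \<Longrightarrow> smooth_fun_near A p (\<lambda>_. r)"
proof -
  assume "p \<in> carrier_of A"
  then obtain c where c: "c \<in> charts p" using some_chart by blast
  have "smooth_fun_on A (fst c) (\<lambda>_. r)"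
    using c by (intro smooth_fun_onI[OF openin_domain])
      (auto simp: charts_at_def o_def intro: smooth_on_const open_chart_range)
  then show ?thesis using c openin_domain unfolding smooth_fun_near_def by (metis charts_atD)
qed

lemma dir_deriv_locally_const:
  assumes "open_in W" "p \<in> W" "v \<in> TM p" "\<And>q. q \<in> W \<Longrightarrow> f q = r"
  shows "dir_deriv A p v f = 0"
proof -
  have "p \<in> carrier_of A" using openin_subset_carrier assms(1,2) by blast
  then obtain c where c: "c \<in> charts p" using some_chart by blast
  have "((f \<circ> chart_inv c) has_derivative (\<lambda>h. 0)) (at (snd c p))"
  proof (rule has_derivative_transform_within_open[OF has_derivative_const open_chart_image[OF assms(1) charts_atD(1)[OF c]]])
    show "snd c p \<in> snd c ` (W \<inter> fst c)" using assms(2) charts_atD[OF c] by blast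
    show "r = (f \<circ> chart_inv c) z" if "z \<in> snd c ` (W \<inter> fst c)" for z
      using chart_inv_in_image[OF charts_atD(1)[OF c] that] assms(4) by simp
  qed
  then show ?thesis using dir_deriv_chart[OF c assms(3)] by blast
qed

text \<open>Multiplying by the indicator function of \<open>W\<close> turns agreement on \<open>W\<close> into equality.\<close>

lemma D_local:
  assumes Y: "near p Y" and W: "open_in W" "p \<in> W" and eq: "\<And>q. q \<in> W \<Longrightarrow> Y q = Y' q"
    and v: "v \<in> TM p"
  shows "D p v Y = D p v Y'"
proof -
  define f :: "'m \<Rightarrow> real" where "f q = (if q \<in> W then 1 else 0)" for q
  have Y': "near p Y'" by (rule field_near_cong[OF Y W eq])
  obtain c where c: "c \<in> charts p" using some_chart[OF field_near_carrier[OF Y]] by blast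
  note cA = charts_atD[OF c]
  have o: "open_in (W \<inter> fst c)" by (rule openin_Int[OF W(1) openin_domain[OF cA(1)]])
  have "smooth_on (snd c ` (W \<inter> fst c)) (f \<circ> chart_inv c)"
  proof (rule smooth_on_cong[THEN iffD1, OF _ smooth_on_const[OF open_chart_image[OF W(1) cA(1)], of 1]])
    show "1 = (f \<circ> chart_inv c) z" if "z \<in> snd c ` (W \<inter> fst c)" for z
      using chart_inv_in_image[OF cA(1) that] by (simp add: f_def)
  qed
  then have "smooth_fun_on A (W \<inter> fst c) f"
    using smooth_fun_onI[OF o cA(1)] by simp
  then have f: "smooth_fun_near A p f" using o W(2) cA unfolding smooth_fun_near_def by blast
  have d: "dir_deriv A p v f = 0"
    by (rule dir_deriv_locally_const[OF W v, of f 1]) (simp add: f_def)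
  have "(\<lambda>q. f q *\<^sub>R Y q) = (\<lambda>q. f q *\<^sub>R Y' q)" using eq by (auto simp: f_def)
  then have "D p v (\<lambda>q. f q *\<^sub>R Y q) = D p v (\<lambda>q. f q *\<^sub>R Y' q)" by simp
  then show ?thesis
    unfolding D_leibniz[OF Y f v] D_leibniz[OF Y' f v] using W(2) by (simp add: d) (simp add: f_def)
qed

text \<open>The Christoffel symbols contracted with \<open>a\<close> and \<open>b\<close>: for
  fields with constant coordinates the derivative part of the connection vanishes and just
  \<Gamma>(a, b) remains.\<close>

definition christoffel :: "('m, 'e) chart \<Rightarrow> 'e \<Rightarrow> 'e \<Rightarrow> 'e \<Rightarrow> 'e" where
  "christoffel c z a b =
     coords (D (chart_inv c z) (coord_field c a (chart_inv c z)) (coord_field c b)) c"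

lemma christoffel_at:
  assumes "c \<in> charts p" "v \<in> TM p"
  shows "christoffel c (snd c p) (coords v c) b = coords (D p v (coord_field c b)) c"
  using assms by (simp add: christoffel_def chart_inv_chart charts_atD coord_field_eqI)

lemma D_scale:
  assumes "near p Y" "v \<in> TM p"
  shows "D p v (\<lambda>q. r *\<^sub>R Y q) = r *\<^sub>R D p v Y"
  using D_leibniz[OF assms(1) smooth_fun_near_const[OF field_near_carrier[OF assms(1)]] assms(2), of r]
    dir_deriv_locally_const[of _ p v "\<lambda>_. r"] assms unfolding field_near_def by fastforce

lemma linear_christoffel_right:
  assumes "c \<in> A" "z \<in> snd c ` fst c"
  shows "linear (christoffel c z a)"
proof -
  let ?p = "chart_inv c z"
  note c = charts_at_chart_inv[OF assms]
  have add: "coord_field c (a + b) = (\<lambda>q. coord_field c a q + coord_field c b q)" for a b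
    by (rule ext) (rule coord_field_add)
  have scale: "coord_field c (r *\<^sub>R b) = (\<lambda>q. r *\<^sub>R coord_field c b q)" for r b
    by (rule ext) (rule coord_field_scale)
  show ?thesis
    unfolding christoffel_def
  proof (rule linearI)
    show "coords (D ?p (coord_field c a ?p) (coord_field c (b + b'))) c =
      coords (D ?p (coord_field c a ?p) (coord_field c b)) c + coords (D ?p (coord_field c a ?p) (coord_field c b')) c" for b b'
      unfolding add[of b b'] by (simp add: D_add coord_field_near[OF c] coord_field_tangent)
    show "coords (D ?p (coord_field c a ?p) (coord_field c (r *\<^sub>R b))) c =
      r *\<^sub>R coords (D ?p (coord_field c a ?p) (coord_field c b)) c" for r b
      unfolding scale[of r b] by (simp add: D_scale coord_field_near[OF c] coord_field_tangent)
  qed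
qed

lemma linear_christoffel_left:
  assumes "c \<in> A" "z \<in> snd c ` fst c"
  shows "linear (\<lambda>a. christoffel c z a b)"
proof -
  let ?p = "chart_inv c z"
  note c = charts_at_chart_inv[OF assms]
  show ?thesis
    unfolding christoffel_def
  proof (rule linearI)
    show "coords (D ?p (coord_field c (a + a') ?p) (coord_field c b)) c =
      coords (D ?p (coord_field c a ?p) (coord_field c b)) c + coords (D ?p (coord_field c a' ?p) (coord_field c b)) c" for a a'
      using D_linear[OF coord_field_near[OF c] coord_field_tangent coord_field_tangent, of 1 _ _ 1]
      by (simp add: coord_field_add)
    show "coords (D ?p (coord_field c (r *\<^sub>R a) ?p) (coord_field c b)) c =
      r *\<^sub>R coords (D ?p (coord_field c a ?p) (coord_field c b)) c" for r a
      using D_linear[OF coord_field_near[OF c] coord_field_tangent tangent_0, of r _ _ 0]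
      by (simp add: coord_field_scale)
  qed
qed

lemma christoffel_linear_family:
  assumes "c \<in> A" "z \<in> snd c ` fst c"
  shows "\<forall>\<^sub>F z in nhds z. (\<forall>a. linear (christoffel c z a)) \<and> (\<forall>b. linear (\<lambda>a. christoffel c z a b))"
  using eventually_nhds_in_open[OF open_chart_range[OF assms(1)] assms(2)]
  by eventually_elim (simp add: linear_christoffel_left[OF assms(1)] linear_christoffel_right[OF assms(1)])

text \<open>A connection takes smooth fields to smooth fields; for fields with constant coordinates
  this is smoothness of \<Gamma>.\<close>

lemma smooth_christoffel: "c \<in> A \<Longrightarrow> smooth_on (snd c ` fst c) (\<lambda>z. christoffel c z a b)"
  unfolding christoffel_def
  using vector_field_onD[OF D_field[OF openin_domain coord_field_vector_field coord_field_vector_field], of c c a b]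
  by simp

definition dchristoffel :: "('m, 'e) chart \<Rightarrow> 'e \<Rightarrow> 'e \<Rightarrow> 'e \<Rightarrow> 'e \<Rightarrow> 'e" where
  "dchristoffel c z h a b = frechet_derivative (\<lambda>z. christoffel c z a b) (at z) h"

lemma dchristoffel_has_derivative:
  assumes "c \<in> A" "z \<in> snd c ` fst c"
  shows "((\<lambda>z. christoffel c z a b) has_derivative (\<lambda>h. dchristoffel c z h a b)) (at z)"
  using smooth_on_derivative(1)[OF open_chart_range[OF assms(1)] smooth_christoffel[OF assms(1)] assms(2)]
  by (simp add: dchristoffel_def)

lemma christoffel_has_derivative:
  fixes \<zeta> :: "'b::real_normed_vector \<Rightarrow> 'e"
  assumes "c \<in> A" "\<zeta> x \<in> snd c ` fst c"
    and "(\<zeta> has_derivative \<zeta>') (at x)" "(P has_derivative P') (at x)" "(Q has_derivative Q') (at x)"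
  shows "((\<lambda>x. christoffel c (\<zeta> x) (P x) (Q x)) has_derivative
    (\<lambda>h. dchristoffel c (\<zeta> x) (\<zeta>' h) (P x) (Q x) + christoffel c (\<zeta> x) (P' h) (Q x) + christoffel c (\<zeta> x) (P x) (Q' h))) (at x)"
  by (rule has_derivative_bilinear_family[OF christoffel_linear_family[OF assms(1,2)]
        dchristoffel_has_derivative[OF assms(1,2)] assms(3-5)])

lemma smooth_fun_near_coord:
  assumes "near p Y" "c \<in> charts p"
  shows "smooth_fun_near A p (\<lambda>q. coords (Y q) c \<bullet> b)"
proof -
  obtain W where W: "open_in W" "p \<in> W" "W \<subseteq> fst c" "open (snd c ` W)" "smooth_on (snd c ` W) (rep c Y)"
    by (rule field_nearE[OF assms])
  have "smooth_on (snd c ` W) (\<lambda>z. rep c Y z \<bullet> b)"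
    by (rule smooth_on_compose_bounded_linear[OF W(4) bounded_linear_inner_left W(5)])
  then have "smooth_fun_on A W (\<lambda>q. coords (Y q) c \<bullet> b)"
    by (intro smooth_fun_onI[OF W(1) charts_atD(1)[OF assms(2)] W(3)]) (simp add: o_def)
  then show ?thesis using W(1,2) unfolding smooth_fun_near_def by blast
qed

lemma field_near_scale:
  assumes "smooth_fun_near A p f" "near p Y"
  shows "field_near A p (\<lambda>q. f q *\<^sub>R Y q)"
proof -
  obtain V where V: "open_in V" "p \<in> V" "smooth_fun_on A V f" using assms(1) unfolding smooth_fun_near_def by blast
  obtain U where U: "open_in U" "p \<in> U" "vf_on U Y" using assms(2) unfolding field_near_def by blast
  have o: "open_in (V \<inter> U)" by (rule openin_Int[OF V(1) U(1)])
  have f: "smooth_fun_on A (V \<inter> U) f"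
    unfolding smooth_fun_on_def
  proof
    fix c assume c: "c \<in> A"
    show "smooth_on (snd c ` (V \<inter> U \<inter> fst c)) (f \<circ> chart_inv c)"
      using V(3) c
      by (intro smooth_on_subset[OF open_chart_image[OF V(1) c] open_chart_image[OF o c]]) (auto simp: smooth_fun_on_def)
  qed
  have "vf_on (V \<inter> U) (\<lambda>q. f q *\<^sub>R Y q)"
    by (rule vector_field_on_scale[OF o f vector_field_on_subset[OF U(3,1) o]]) simp
  then show ?thesis using o V(2) U(2) unfolding field_near_def by blast
qed

lemma field_near_add:
  assumes "near p X" "near p Y"
  shows "field_near A p (\<lambda>q. X q + Y q)"
proof -
  obtain c where c: "c \<in> charts p" using some_chart[OF field_near_carrier[OF assms(1)]] by blast
  obtain W where "open_in W" "p \<in> W" "vf_on W X" "vf_on W Y"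
    by (rule field_nearE2[OF assms c])
  then show ?thesis using vector_field_on_add[of W X Y] unfolding field_near_def by blast
qed

text \<open>Near \<open>p\<close> the field is a combination of coordinate fields with its own
  coordinates as coefficients. In the Leibniz rule the coefficients give the derivative part and the
  coordinate fields give \<Gamma>.\<close>

lemma D_coords:
  assumes Y: "near p Y" and c: "c \<in> charts p" and v: "v \<in> TM p"
  shows "coords (D p v Y) c = drep c Y (snd c p) (coords v c)
    + christoffel c (snd c p) (coords v c) (coords (Y p) c)"
proof -
  let ?f = "\<lambda>b q. coords (Y q) c \<bullet> b" and ?E = "coord_field c"
  let ?d = "drep c Y (snd c p) (coords v c)"
  let ?\<Gamma> = "christoffel c (snd c p) (coords v c)"
  have fE: "field_near A p (\<lambda>q. ?f b q *\<^sub>R ?E b q)" for b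
    by (rule field_near_scale[OF smooth_fun_near_coord[OF Y c] coord_field_near[OF c]])
  have deriv: "coords (D p v (\<lambda>q. ?f b q *\<^sub>R ?E b q)) c = (?d \<bullet> b) *\<^sub>R b + (coords (Y p) c \<bullet> b) *\<^sub>R ?\<Gamma> b" for b
  proof -
    have "((?f b \<circ> chart_inv c) has_derivative
        (\<lambda>h. drep c Y (snd c p) h \<bullet> b)) (at (snd c p))"
      using bounded_linear.has_derivative[OF bounded_linear_inner_left field_near_has_derivative[OF Y c]]
      by (simp add: o_def)
    then have "dir_deriv A p v (?f b) = ?d \<bullet> b" by (rule dir_deriv_chart[OF c v])
    then show ?thesis
      by (simp add: D_leibniz[OF coord_field_near[OF c] smooth_fun_near_coord[OF Y c] v] c christoffel_at[OF c v])
  qed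
  \<comment> \<open>Additivity of \<open>D\<close> holds for fields smooth near \<open>p\<close>, so
    the induction carries that property along with the formula.\<close>
  have sum: "field_near A p (\<lambda>q. \<Sum>b\<in>B. ?f b q *\<^sub>R ?E b q) \<and>
      coords (D p v (\<lambda>q. \<Sum>b\<in>B. ?f b q *\<^sub>R ?E b q)) c = (\<Sum>b\<in>B. (?d \<bullet> b) *\<^sub>R b + (coords (Y p) c \<bullet> b) *\<^sub>R ?\<Gamma> b)"
    if "finite B" for B
    using that
  proof (induction B)
    case empty
    have "coord_field c 0 = (\<lambda>q. 0)" using coord_field_scale[of c 0 0] by (simp add: fun_eq_iff)
    then have z: "field_near A p (\<lambda>q. 0)" using coord_field_near[OF c, of 0] by simp
    then show ?case using D_scale[OF z v, of 0] by simp
  next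
    case (insert b B)
    then show ?case
      using field_near_add[OF fE[of b]] D_add[OF fE[of b] _ v] by (simp add: deriv)
  qed
  have W: "open_in (fst c)" "p \<in> fst c" using charts_atD[OF c] openin_domain by auto
  obtain V where V: "open_in V" "p \<in> V" "V \<subseteq> fst c" "vf_on V Y" by (rule field_nearE[OF Y c])
  have eq: "Y q = (\<Sum>b\<in>Basis. ?f b q *\<^sub>R ?E b q)" if "q \<in> V" for q
  proof -
    have cq: "c \<in> charts q" using that V(3) charts_atD[OF c] by (auto simp: charts_at_def)
    have Yq: "Y q \<in> TM q" using that V(4) by (auto simp: vector_field_on_def)
    show ?thesis
      by (rule tangent_eqI[OF Yq _ cq])
         (auto simp: coords_sum cq euclidean_representation intro!: tangent_sum tangent_scale coord_field_tangent)
  qed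
  have lin: "linear ?\<Gamma>" using linear_christoffel_right[OF charts_atD(1)[OF c]] charts_atD(2)[OF c] by blast
  \<comment> \<open>The expansion of \<open>Y\<close> holds only on \<open>V\<close>; locality of
    \<open>D\<close> makes this enough.\<close>
  have "D p v Y = D p v (\<lambda>q. \<Sum>b\<in>Basis. ?f b q *\<^sub>R ?E b q)" by (rule D_local[OF Y V(1,2) eq v])
  then show ?thesis
    using sum[of Basis] linear_basis_expansion[OF lin, of "coords (Y p) c"]
    by (simp add: sum.distrib euclidean_representation)
qed

lemma lie_bracket_coord_fields:
  assumes "c \<in> charts p"
  shows "lie_bracket A (coord_field c a) (coord_field c b) p = 0"
proof -
  have d: "(rep c (coord_field c b) has_derivative (\<lambda>h. 0)) (at (snd c p))" for b
    by (rule has_derivative_transform_within_open[OF has_derivative_const[of b] open_chart_range])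
       (use charts_atD[OF assms] in \<open>auto simp: charts_at_def chart_inv_chart\<close>)
  have "lie_bracket A (coord_field c a) (coord_field c b) p \<in> TM p"
    by (intro lie_bracket_tangent coord_field_near assms)
  then show ?thesis
    by (rule tangent_eqI[OF _ tangent_0 assms]) (simp add: lie_bracket_coords[OF assms d d])
qed

text \<open>Coordinate fields commute, so torsion-freeness becomes symmetry of \<Gamma>.\<close>

lemma christoffel_sym:
  assumes "c \<in> A" "z \<in> snd c ` fst c"
  shows "christoffel c z a b = christoffel c z b a"
  using torsion_freeD[OF coord_field_near coord_field_near, of c "chart_inv c z" c a b]
    lie_bracket_coord_fields[OF charts_at_chart_inv[OF assms], of a b] charts_at_chart_inv[OF assms]
  by (simp add: christoffel_def)

lemma dchristoffel_sym:
  assumes "c \<in> A" "z \<in> snd c ` fst c"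
  shows "dchristoffel c z h a b = dchristoffel c z h b a"
proof -
  have "((\<lambda>z. christoffel c z a b) has_derivative (\<lambda>h. dchristoffel c z h b a)) (at z)"
    by (rule has_derivative_transform_within_open[OF dchristoffel_has_derivative[OF assms]
          open_chart_range[OF assms(1)] assms(2)]) (rule christoffel_sym[OF assms(1)])
  from has_derivative_unique[OF dchristoffel_has_derivative[OF assms] this] show ?thesis by metis
qed

definition gram :: "('m, 'e) chart \<Rightarrow> 'e \<Rightarrow> 'e \<Rightarrow> 'e \<Rightarrow> real" where
  "gram c z a b = g (chart_inv c z) (coord_field c a (chart_inv c z)) (coord_field c b (chart_inv c z))"

lemma gram_at:
  assumes "c \<in> charts p" "v \<in> TM p" "w \<in> TM p"
  shows "gram c (snd c p) (coords v c) (coords w c) = g p v w"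
  using assms by (simp add: gram_def chart_inv_chart charts_atD coord_field_eqI)

lemma linear_gram:
  assumes "c \<in> A" "z \<in> snd c ` fst c"
  shows "linear (gram c z a)" "linear (\<lambda>a. gram c z a b)"
proof -
  let ?p = "chart_inv c z"
  have p: "?p \<in> carrier_of A" using charts_at_chart_inv[OF assms] by (auto simp: charts_at_def intro: chart_in_carrier)
  show "linear (gram c z a)" "linear (\<lambda>a. gram c z a b)"
    by (auto intro!: linearI simp: gram_def coord_field_add coord_field_scale
        g_left(1)[OF coord_field_tangent coord_field_tangent coord_field_tangent p]
        g_left(3)[OF coord_field_tangent coord_field_tangent coord_field_tangent p]
        g_right(1)[OF coord_field_tangent coord_field_tangent coord_field_tangent p]
        g_right(3)[OF coord_field_tangent coord_field_tangent coord_field_tangent p])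
qed

text \<open>Metric compatibility for coordinate fields, whose covariant derivatives are the
  Christoffel symbols. Smoothness is obtained first, so that \<open>dir_deriv\<close> can be
  identified with the derivative in the chart.\<close>

lemma gram_basic_derivative:
  assumes "c \<in> A" "z \<in> snd c ` fst c"
  shows "((\<lambda>z. gram c z a b) has_derivative
    (\<lambda>h. gram c z (christoffel c z h a) b + gram c z a (christoffel c z h b))) (at z)"
    and "smooth_on (snd c ` fst c) (\<lambda>z. gram c z a b)"
proof -
  let ?p = "chart_inv c z" and ?f = "\<lambda>q. g q (coord_field c a q) (coord_field c b q)"
  note c = charts_at_chart_inv[OF assms] and o = open_chart_range[OF assms(1)]
  have "smooth_fun_on A (fst c) ?f"
    by (intro g_smooth openin_domain coord_field_vector_field assms(1))
  then have "smooth_on (snd c ` (fst c \<inter> fst c)) (?f \<circ> chart_inv c)"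
    using assms(1) unfolding smooth_fun_on_def by blast
  then show sm: "smooth_on (snd c ` fst c) (\<lambda>z. gram c z a b)"
    by (simp add: gram_def o_def)
  have d: "((\<lambda>z. gram c z a b) has_derivative frechet_derivative (\<lambda>z. gram c z a b) (at z)) (at z)"
    by (rule smooth_on_derivative(1)[OF o sm assms(2)])
  have eq: "frechet_derivative (\<lambda>z. gram c z a b) (at z) h =
      gram c z (christoffel c z h a) b + gram c z a (christoffel c z h b)" for h
  proof -
    have "dir_deriv A ?p (coord_field c h ?p) ?f = frechet_derivative (\<lambda>z. gram c z a b) (at z) (coords (coord_field c h ?p) c)"
      by (rule dir_deriv_chart[OF c coord_field_tangent])
         (use d chart_chart_inv[OF assms(2)] in \<open>simp add: gram_def o_def\<close>)
    then show ?thesis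
      unfolding compatibleD[OF coord_field_near[OF c] coord_field_near[OF c] coord_field_tangent]
      using c by (simp add: gram_def christoffel_def coord_field_eqI D_tangent coord_field_near coord_field_tangent)
  qed
  show "((\<lambda>z. gram c z a b) has_derivative
    (\<lambda>h. gram c z (christoffel c z h a) b + gram c z a (christoffel c z h b))) (at z)"
    by (rule has_derivative_eq_rhs[OF d ext[OF eq]])
qed

text \<open>The product rule regrouped: each factor contributes its covariant derivative along
  \<open>\<zeta>\<close>, which is the derivative of its coordinates corrected by \<Gamma>.\<close>

lemma gram_has_derivative:
  fixes \<zeta> :: "'b::real_normed_vector \<Rightarrow> 'e"
  assumes c: "c \<in> A" "\<zeta> x \<in> snd c ` fst c"
    and d: "(\<zeta> has_derivative \<zeta>') (at x)" "(P has_derivative P') (at x)" "(Q has_derivative Q') (at x)"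
  shows "((\<lambda>x. gram c (\<zeta> x) (P x) (Q x)) has_derivative
    (\<lambda>h. gram c (\<zeta> x) (P' h + christoffel c (\<zeta> x) (\<zeta>' h) (P x)) (Q x)
       + gram c (\<zeta> x) (P x) (Q' h + christoffel c (\<zeta> x) (\<zeta>' h) (Q x)))) (at x)"
proof -
  have "\<forall>\<^sub>F z in nhds (\<zeta> x). (\<forall>a. linear (gram c z a)) \<and> (\<forall>b. linear (\<lambda>a. gram c z a b))"
    using eventually_nhds_in_open[OF open_chart_range[OF c(1)] c(2)]
    by eventually_elim (simp add: linear_gram[OF c(1)])
  from has_derivative_bilinear_family[OF this gram_basic_derivative(1)[OF c] d]
  show ?thesis
    by (rule has_derivative_eq_rhs)
       (simp add: fun_eq_iff linear_add[OF linear_gram(1)[OF c]] linear_add[OF linear_gram(2)[OF c]])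
qed

text \<open>The classical expression of R(a, b)w by Christoffel symbols. No derivative of a field
  occurs in it, so it depends on values at the point alone.\<close>

definition curvature_rep :: "('m, 'e) chart \<Rightarrow> 'e \<Rightarrow> 'e \<Rightarrow> 'e \<Rightarrow> 'e \<Rightarrow> 'e" where
  "curvature_rep c z a b w = dchristoffel c z a b w - dchristoffel c z b a w
     + christoffel c z a (christoffel c z b w) - christoffel c z b (christoffel c z a w)"

text \<open>The coordinate formula for the covariant derivative of \<open>Z\<close> along
  \<open>Y\<close> is itself differentiated along \<open>v\<close>. Besides the part that survives
  in the curvature, this produces the second derivative of \<open>Z\<close> and first derivatives of
  \<open>Y\<close> and \<open>Z\<close>.\<close>

lemma second_covariant_derivative_coords:
  assumes Y: "near p Y" and Z: "near p Z" and c: "c \<in> charts p" and v: "v \<in> TM p"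
  defines "z0 \<equiv> snd c p"
  shows "coords (D p v (cov_deriv D Y Z)) c =
    frechet_derivative (\<lambda>z. drep c Z z (coords (Y p) c)) (at z0) (coords v c)
    + drep c Z z0 (drep c Y z0 (coords v c))
    + dchristoffel c z0 (coords v c) (coords (Y p) c) (coords (Z p) c)
    + christoffel c z0 (drep c Y z0 (coords v c)) (coords (Z p) c)
    + christoffel c z0 (coords (Y p) c) (drep c Z z0 (coords v c))
    + christoffel c z0 (coords v c) (drep c Z z0 (coords (Y p) c)
        + christoffel c z0 (coords (Y p) c) (coords (Z p) c))"
proof -
  note cA = charts_atD[OF c]
  have p: "chart_inv c z0 = p" by (simp add: z0_def chart_inv_chart cA)
  obtain W where W: "open_in W" "p \<in> W" "W \<subseteq> fst c" "vf_on W Y" "vf_on W Z"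
    by (rule field_nearE2[OF Y Z c])
  note o = open_chart_image_subset[OF W(1) cA(1) W(3)]
  note sZ = vector_field_onD[OF W(5) cA(1) W(3)]
  have z0: "z0 \<in> snd c ` W" "z0 \<in> snd c ` fst c" using W(2) cA by (auto simp: z0_def)
  have dY: "(rep c Y has_derivative drep c Y z0) (at z0)"
    and dZ: "(rep c Z has_derivative drep c Z z0) (at z0)"
    unfolding z0_def by (rule field_near_has_derivative[OF Y c] field_near_has_derivative[OF Z c])+
  have rep: "drep c Z z (rep c Y z) + christoffel c z (rep c Y z) (rep c Z z)
      = rep c (cov_deriv D Y Z) z" if "z \<in> snd c ` W" for z
  proof -
    from that obtain q where q: "q \<in> W" "z = snd c q" by blast
    have cq: "c \<in> charts q" using q(1) W(3) cA(1) by (auto simp: charts_at_def)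
    have "Y q \<in> TM q" using W(4) q(1) by (auto simp: vector_field_on_def)
    from D_coords[OF field_nearI[OF W(1) q(1) W(5)] cq this]
    show ?thesis using q(2) charts_atD[OF cq] by (simp add: chart_inv_chart)
  qed
  have lin: "\<forall>\<^sub>F z in nhds z0. linear (drep c Z z)"
    using eventually_nhds_in_open[OF o z0(1)]
    by eventually_elim (blast intro: has_derivative_linear smooth_on_derivative(1)[OF o sZ])
  have d1: "((\<lambda>z. drep c Z z (rep c Y z)) has_derivative
     (\<lambda>h. frechet_derivative (\<lambda>z. drep c Z z (rep c Y z0)) (at z0) h
       + drep c Z z0 (drep c Y z0 h))) (at z0)"
    by (rule has_derivative_linear_family[where F = "\<lambda>z. drep c Z z"
        and F' = "\<lambda>b. frechet_derivative (\<lambda>z. drep c Z z b) (at z0)", OF lin _ dY])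
       (rule smooth_on_derivative(1)[OF o smooth_on_derivative(2)[OF o sZ] z0(1)])
  have d2: "((\<lambda>z. christoffel c z (rep c Y z) (rep c Z z)) has_derivative
    (\<lambda>h. dchristoffel c z0 h (rep c Y z0) (rep c Z z0)
      + christoffel c z0 (drep c Y z0 h) (rep c Z z0)
      + christoffel c z0 (rep c Y z0) (drep c Z z0 h))) (at z0)"
    by (rule christoffel_has_derivative[OF cA(1) z0(2) has_derivative_ident dY dZ])
  have "frechet_derivative (rep c (cov_deriv D Y Z)) (at z0) = (\<lambda>h.
       frechet_derivative (\<lambda>z. drep c Z z (rep c Y z0)) (at z0) h
       + drep c Z z0 (drep c Y z0 h)
       + (dchristoffel c z0 h (rep c Y z0) (rep c Z z0)
      + christoffel c z0 (drep c Y z0 h) (rep c Z z0)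
      + christoffel c z0 (rep c Y z0) (drep c Z z0 h)))"
    by (rule frechet_derivativeI[OF has_derivative_transform_within_open[OF has_derivative_add[OF d1 d2] o z0(1) rep]])
  then show ?thesis
    unfolding D_coords[OF D_field_near[OF Y Z] c v] z0_def[symmetric]
    by (simp add: p D_coords[OF Z c field_near_tangent[OF Y]] z0_def[symmetric])
qed

text \<open>Tensoriality: second derivatives of \<open>Z\<close> cancel by their symmetry,
  derivatives of \<open>X\<close> and \<open>Y\<close> cancel against the bracket term, and the
  remaining derivatives of \<open>Z\<close> enter symmetrically in \<open>X\<close> and
  \<open>Y\<close>.\<close>

lemma curvature_fields_coords:
  assumes X: "near p X" and Y: "near p Y" and Z: "near p Z" and c: "c \<in> charts p"
  shows "coords (cov_deriv D X (cov_deriv D Y Z) p - cov_deriv D Y (cov_deriv D X Z) p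
           - cov_deriv D (lie_bracket A X Y) Z p) c
    = curvature_rep c (snd c p) (coords (X p) c) (coords (Y p) c) (coords (Z p) c)"
proof -
  note T = field_near_tangent[OF X] field_near_tangent[OF Y] field_near_tangent[OF Z]
  note cA = charts_atD[OF c]
  let ?z = "snd c p"
  have z: "?z \<in> snd c ` fst c" using cA by blast
  obtain W where W: "p \<in> W" "open (snd c ` W)" "smooth_on (snd c ` W) (rep c Z)"
    by (rule field_nearE[OF Z c])
  have sym: "frechet_derivative (\<lambda>z. drep c Z z a) (at ?z) b =
      frechet_derivative (\<lambda>z. drep c Z z b) (at ?z) a" for a b
    using W by (intro second_derivative_symmetric[OF W(2,3)]) blast
  have linZ: "linear (drep c Z ?z)"
    using field_near_has_derivative[OF Z c] has_derivative_linear by blast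
  have br: "coords (lie_bracket A X Y p) c = drep c Y ?z (coords (X p) c)
      - drep c X ?z (coords (Y p) c)"
    by (rule lie_bracket_coords[OF c field_near_has_derivative[OF X c] field_near_has_derivative[OF Y c]])
  note l = linear_add[OF linear_christoffel_right[OF cA(1) z]]
    linear_diff[OF linear_christoffel_left[OF cA(1) z]] linear_diff[OF linZ]
  show ?thesis
    unfolding coords_simps second_covariant_derivative_coords[OF Y Z c T(1)] second_covariant_derivative_coords[OF X Z c T(2)]
      D_coords[OF Z c lie_bracket_tangent[OF X Y]] br l curvature_rep_def
    using sym[of "coords (X p) c" "coords (Y p) c"] by simp
qed

text \<open>The definite description is meaningful: fields with constant coordinates are admissible
  extensions, and by the coordinate formula any two admissible results agree in a chart.\<close>

lemma curvature:
  assumes a: "a \<in> TM p" and b: "b \<in> TM p" and w: "w \<in> TM p"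
    and c: "c \<in> charts p"
  shows curvature_tangent: "curvature A D p a b w \<in> TM p"
    and curvature_coords: "coords (curvature A D p a b w) c =
      curvature_rep c (snd c p) (coords a c) (coords b c) (coords w c)"
proof -
  let ?K = "\<lambda>X Y Z. cov_deriv D X (cov_deriv D Y Z) p - cov_deriv D Y (cov_deriv D X Z) p
           - cov_deriv D (lie_bracket A X Y) Z p"
  let ?E = "\<lambda>v. coord_field c (coords v c)"
  define P where "P r \<longleftrightarrow> (\<exists>X Y Z.
     near p X \<and> near p Y \<and> near p Z \<and> X p = a \<and> Y p = b \<and> Z p = w \<and> r = ?K X Y Z)" for r
  have PQ: "r \<in> TM p"
    "coords r c = curvature_rep c (snd c p) (coords a c) (coords b c) (coords w c)" if "P r" for r
  proof -
    from that[unfolded P_def] obtain X Y Z where XYZ: "near p X" "near p Y" "near p Z"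
      "X p = a" "Y p = b" "Z p = w" and r: "r = ?K X Y Z" by (elim exE conjE)
    show "r \<in> TM p" unfolding r
      by (intro tangent_diff D_tangent D_field_near XYZ(1-3) lie_bracket_tangent field_near_tangent)
    show "coords r c = curvature_rep c (snd c p) (coords a c) (coords b c) (coords w c)"
      using curvature_fields_coords[OF XYZ(1-3) c] XYZ(4-6) r by simp
  qed
  have ex: "P (?K (?E a) (?E b) (?E w))"
    unfolding P_def
    by (rule exI[of _ "?E a"], rule exI[of _ "?E b"], rule exI[of _ "?E w"])
       (intro conjI refl coord_field_near[OF c] coord_field_eqI[OF c] a b w)
  have "P (THE r. P r)"
  proof (rule theI[of P, OF ex])
    fix r assume "P r"
    show "r = ?K (?E a) (?E b) (?E w)"
      by (rule tangent_eqI[OF PQ(1)[OF \<open>P r\<close>] PQ(1)[OF ex] c]) (simp only: PQ(2)[OF \<open>P r\<close>] PQ(2)[OF ex])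
  qed
  moreover have "(THE r. P r) = curvature A D p a b w"
    unfolding curvature_def P_def ..
  ultimately have "P (curvature A D p a b w)" by simp
  from PQ[OF this] show "curvature A D p a b w \<in> TM p"
    "coords (curvature A D p a b w) c =
      curvature_rep c (snd c p) (coords a c) (coords b c) (coords w c)" .
qed

text \<open>The second derivatives of g(w, w') in the directions a and b commute. Expressed through
  \<Gamma> twice, their mixed products g(\<Gamma>(b, w), \<Gamma>(a, w')) are symmetric in a and b
  after summation, and what is left of the difference is the claim.\<close>

lemma metric_curvature_rep_skew:
  assumes "c \<in> A" "z \<in> snd c ` fst c"
  shows "gram c z (curvature_rep c z a b w) w' + gram c z w (curvature_rep c z a b w') = 0"
proof -
  let ?\<Gamma> = "christoffel c" and ?g = "gram c" and ?S = "snd c ` fst c"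
  note o = open_chart_range[OF assms(1)]
  note G = dchristoffel_has_derivative[OF assms]
  \<comment> \<open>The summands 0 are the derivatives of the constant arguments \<open>w\<close>
    and \<open>w'\<close>.\<close>
  have D2: "frechet_derivative (\<lambda>z. frechet_derivative (\<lambda>z. ?g z w w') (at z) b) (at z) a =
     ?g z (dchristoffel c z a b w + ?\<Gamma> z a (?\<Gamma> z b w)) w' + ?g z (?\<Gamma> z b w) (0 + ?\<Gamma> z a w')
     + (?g z (0 + ?\<Gamma> z a w) (?\<Gamma> z b w') + ?g z w (dchristoffel c z a b w' + ?\<Gamma> z a (?\<Gamma> z b w')))" for a b
  proof (rule fun_cong[OF frechet_derivativeI])
    note d = has_derivative_add[OF
      gram_has_derivative[OF assms(1) _ has_derivative_ident G[of b w] has_derivative_const[of w']]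
      gram_has_derivative[OF assms(1) _ has_derivative_ident has_derivative_const[of w] G[of b w']]]
    show "((\<lambda>z. frechet_derivative (\<lambda>z. ?g z w w') (at z) b) has_derivative
      (\<lambda>a. ?g z (dchristoffel c z a b w + ?\<Gamma> z a (?\<Gamma> z b w)) w' + ?g z (?\<Gamma> z b w) (0 + ?\<Gamma> z a w')
     + (?g z (0 + ?\<Gamma> z a w) (?\<Gamma> z b w') + ?g z w (dchristoffel c z a b w' + ?\<Gamma> z a (?\<Gamma> z b w'))))) (at z)"
      using frechet_derivativeI[OF gram_basic_derivative(1)[OF assms(1)]]
      by (intro has_derivative_transform_within_open[OF d o assms(2)] assms(2)) simp
  qed
  note l = linear_add[OF linear_gram(1)[OF assms]] linear_add[OF linear_gram(2)[OF assms]]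
    linear_diff[OF linear_gram(1)[OF assms]] linear_diff[OF linear_gram(2)[OF assms]]
  from second_derivative_symmetric[OF o gram_basic_derivative(2)[OF assms] assms(2), of w w' b a]
  show ?thesis unfolding D2 curvature_rep_def by (simp add: l)
qed

text \<open>Skewness comes from the metric and the first Bianchi identity from the symmetry of
  \<Gamma>; pair symmetry follows from these by algebra.\<close>

lemma
  assumes T: "a \<in> TM p" "b \<in> TM p" "v \<in> TM p" "w \<in> TM p"
    and p: "p \<in> carrier_of A"
  shows curvature_skew: "g p (curvature A D p a b v) w = - g p v (curvature A D p a b w)"
    and curvature_pair_sym: "g p (curvature A D p a b v) w = g p (curvature A D p v w a) b"
proof -
  obtain c where c: "c \<in> charts p" using some_chart[OF p] by blast
  note cA = charts_atD[OF c]
  let ?z = "snd c p" and ?R = "\<lambda>a b v w. g p (curvature A D p a b v) w"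
  have z: "?z \<in> snd c ` fst c" using cA by blast
  have skew: "?R a b v w = - g p v (curvature A D p a b w)"
    if "a \<in> TM p" "b \<in> TM p" "v \<in> TM p" "w \<in> TM p" for a b v w
    using metric_curvature_rep_skew[OF cA(1) z, of "coords a c" "coords b c" "coords v c" "coords w c"]
      gram_at[OF c curvature_tangent[OF that(1-3) c] that(4)]
      gram_at[OF c that(3) curvature_tangent[OF that(1,2,4) c]]
    by (simp add: curvature_coords[OF _ _ _ c] that)
  then show "?R a b v w = - g p v (curvature A D p a b w)" using T by blast
  have s34: "?R a b v w = - ?R a b w v"
    if "a \<in> TM p" "b \<in> TM p" "v \<in> TM p" "w \<in> TM p" for a b v w
    using skew[OF that] g_sym[OF that(3) curvature_tangent[OF that(1,2,4) c] p] by simp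
  have anti: "curvature A D p a b v = - curvature A D p b a v"
    if "a \<in> TM p" "b \<in> TM p" "v \<in> TM p" for a b v
    by (rule tangent_eqI[OF _ subspace_neg[OF subspace_tangent] c])
       (simp_all add: curvature_tangent[OF _ _ _ c] curvature_coords[OF _ _ _ c] that, simp add: curvature_rep_def)
  have s12: "?R a b v w = - ?R b a v w"
    if "a \<in> TM p" "b \<in> TM p" "v \<in> TM p" "w \<in> TM p" for a b v w
    unfolding anti[OF that(1-3)]
    by (rule g_minus_left[OF curvature_tangent[OF that(2,1,3) c] that(4) p])
  have sum0: "curvature A D p a b v + curvature A D p b v a + curvature A D p v a b = 0"
    if "a \<in> TM p" "b \<in> TM p" "v \<in> TM p" for a b v
  proof (rule tangent_eqI[OF _ tangent_0 c])
    show "coords (curvature A D p a b v + curvature A D p b v a + curvature A D p v a b) c = coords 0 c"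
      by (simp add: curvature_coords[OF _ _ _ c] that)
         (simp add: curvature_rep_def dchristoffel_sym[OF cA(1) z] christoffel_sym[OF cA(1) z])
  qed (intro tangent_add curvature_tangent[OF _ _ _ c] that)
  have bianchi: "?R a b v w + ?R b v a w + ?R v a b w = 0"
    if "a \<in> TM p" "b \<in> TM p" "v \<in> TM p" "w \<in> TM p" for a b v w
  proof -
    note t = curvature_tangent[OF that(1,2,3) c] curvature_tangent[OF that(2,3,1) c] curvature_tangent[OF that(3,1,2) c]
    show ?thesis
      using arg_cong[OF sum0[OF that(1-3)], of "\<lambda>r. g p r w"]
      unfolding g_left(1)[OF tangent_add[OF t(1,2)] t(3) that(4) p] g_left(1)[OF t(1,2) that(4) p]
        g_zero(1)[OF that(4) p] .
  qed
  \<comment> \<open>The Bianchi identities for the four cyclic shifts of \<open>a, b, v, w\<close>;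
    skewness in the first pair and in the last pair eliminates all but the two wanted terms.\<close>
  show "?R a b v w = ?R v w a b"
    using bianchi[OF T(1,2,3,4)] bianchi[OF T(2,3,4,1)] bianchi[OF T(3,4,1,2)] bianchi[OF T(4,1,2,3)]
      s12[OF T(1,3,2,4)] s12[OF T(1,3,4,2)] s12[OF T(2,4,1,3)] s12[OF T(2,4,3,1)]
      s34[OF T(1,2,3,4)] s34[OF T(2,3,4,1)] s34[OF T(3,4,1,2)] s34[OF T(4,1,2,3)] s34[OF T(1,3,2,4)] s34[OF T(2,4,1,3)]
    by linarith
qed

end

section \<open>The smooth structure of the frame bundle\<close>

lemma open_det_nonzero: "open {U :: real^'n^'n. det U \<noteq> 0}"
proof -
  have "continuous_on UNIV (det :: real^'n^'n \<Rightarrow> real)"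
    unfolding det_def by (intro continuous_intros)
  then have "open ((det :: real^'n^'n \<Rightarrow> real) -` (- {0}))"
    by (intro open_vimage) auto
  then show ?thesis by (simp add: vimage_def)
qed

text \<open>A frame is a family, while \<open>independent\<close> speaks of sets. This links it to
  relations between the members of the family, the form of the criterion for the rows of a
  matrix.\<close>

lemma independent_family_iff:
  fixes u :: "'n::finite \<Rightarrow> 'v::real_vector"
  shows "inj u \<and> independent (range u) \<longleftrightarrow> (\<forall>k. (\<Sum>i\<in>UNIV. k i *\<^sub>R u i) = 0 \<longrightarrow> (\<forall>i. k i = 0))"
proof
  assume u: "inj u \<and> independent (range u)"
  show "\<forall>k. (\<Sum>i\<in>UNIV. k i *\<^sub>R u i) = 0 \<longrightarrow> (\<forall>i. k i = 0)"
  proof (intro allI impI)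
    fix k :: "'n \<Rightarrow> real" and i assume k: "(\<Sum>i\<in>UNIV. k i *\<^sub>R u i) = 0"
    have s: "(\<Sum>v\<in>range u. k (inv u v) *\<^sub>R v) = 0"
      using u k by (subst sum.reindex) auto
    show "k i = 0"
    proof (rule ccontr)
      assume "k i \<noteq> 0"
      then have "\<exists>v\<in>range u. k (inv u v) \<noteq> 0" using u by auto
      then have "dependent (range u)"
        unfolding dependent_finite[OF finite_imageI[OF finite]] using s by (intro exI[of _ "\<lambda>v. k (inv u v)"] conjI)
      then show False using u by simp
    qed
  qed
next
  assume *: "\<forall>k. (\<Sum>i\<in>UNIV. k i *\<^sub>R u i) = 0 \<longrightarrow> (\<forall>i. k i = 0)"
  have inj: "inj u"
  proof (rule injI, rule ccontr)
    fix i j assume ij: "u i = u j" "i \<noteq> j"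
    \<comment> \<open>The coefficients are 1 at \<open>i\<close> and -1 at \<open>j\<close>: a
      nontrivial relation as soon as the family repeats a vector.\<close>
    have "(\<Sum>l\<in>UNIV. ((if l = i then 1 else 0) - (if l = j then 1 else 0)) *\<^sub>R u l) = 0"
      using ij by (simp add: scaleR_left_diff_distrib sum_subtractf if_distrib[of "\<lambda>a. a *\<^sub>R _"] cong: if_cong)
    from *[rule_format, OF this, of i] ij(2) show False by simp
  qed
  moreover have "independent (range u)"
  proof
    assume "dependent (range u)"
    then obtain k v where k: "v \<in> range u" "k v \<noteq> 0" "(\<Sum>v\<in>range u. k v *\<^sub>R v) = 0"
      by (auto simp: dependent_finite)
    then have "(\<Sum>i\<in>UNIV. k (u i) *\<^sub>R u i) = 0" using inj by (simp add: sum.reindex)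
    from *[rule_format, OF this] k show False by auto
  qed
  ultimately show "inj u \<and> independent (range u)" ..
qed

locale frames = riemannian A g D
  for A :: "('m, real^'n::finite) atlas" and g :: "('m, real^'n) metric_tensor" and D :: "('m, real^'n) connection"
begin

abbreviation FB :: "(('m, 'n) frame, 'n frame_model) atlas" where "FB \<equiv> frame_atlas A"

abbreviation LM :: "('m, 'n) frame set" where "LM \<equiv> frame_bundle A"

abbreviation fchart :: "('m, real^'n) chart \<Rightarrow> (('m, 'n) frame, 'n frame_model) chart" where
  "fchart \<equiv> frame_chart A"

text \<open>In a chart a frame is an invertible matrix whose rows are the coordinates of its
  vectors. The range of a frame chart is therefore the product of the range of \<open>c\<close> with
  the open set of invertible matrices.\<close>

lemma frame_iff:
  assumes c: "c \<in> charts x"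
  shows "(x, u) \<in> LM \<longleftrightarrow> (\<forall>i. u i \<in> TM x) \<and> det (\<chi> i. coords (u i) c) \<noteq> 0"
proof -
  let ?M = "(\<chi> i. coords (u i) c) :: real^'n^'n"
  have x: "x \<in> carrier_of A" using charts_atD[OF c] by (rule chart_in_carrier)
  have det: "det ?M \<noteq> 0 \<longleftrightarrow> inj u \<and> independent (range u)" if u: "\<forall>i. u i \<in> TM x"
  proof -
    have "(\<Sum>i\<in>UNIV. k i *s row i ?M) = coords (\<Sum>i\<in>UNIV. k i *\<^sub>R u i) c" for k :: "'n \<Rightarrow> real"
      by (simp add: coords_sum row_def scalar_mult_eq_scaleR vec_lambda_eta)
    moreover have "coords (\<Sum>i\<in>UNIV. k i *\<^sub>R u i) c = 0 \<longleftrightarrow> (\<Sum>i\<in>UNIV. k i *\<^sub>R u i) = 0" for k :: "'n \<Rightarrow> real"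
      using tangent_eqI[OF tangent_sum tangent_0 c, of UNIV "\<lambda>i. k i *\<^sub>R u i"] u tangent_scale by auto
    ultimately show ?thesis
      unfolding independent_family_iff invertible_det_nz[symmetric] invertible_right_inverse
        matrix_right_invertible_independent_rows by simp
  qed
  have span: "span (range u) = TM x" if u: "\<forall>i. u i \<in> TM x" and d: "det ?M \<noteq> 0"
  proof
    show "span (range u) \<subseteq> TM x" using u by (intro span_minimal subspace_tangent) auto
    show "TM x \<subseteq> span (range u)"
    proof
      fix v assume v: "v \<in> TM x"
      obtain N where N: "N ** ?M = mat 1" using d invertible_det_nz invertible_left_inverse by metis
      \<comment> \<open>The coefficients of \<open>v\<close> with respect to the frame: its
        coordinate row times a left inverse of the matrix.\<close>
      define k where "k = coords v c v* N"
      have "coords v c = k v* ?M" by (simp add: k_def vector_matrix_mul_assoc N)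
      also have "\<dots> = coords (\<Sum>i\<in>UNIV. k $ i *\<^sub>R u i) c"
        by (simp add: vector_matrix_mult_def coords_sum vec_eq_iff mult.commute)
      finally have "v = (\<Sum>i\<in>UNIV. k $ i *\<^sub>R u i)"
        using u by (intro tangent_eqI[OF v _ c] tangent_sum tangent_scale) auto
      then show "v \<in> span (range u)" by (simp add: span_sum span_scale span_base)
    qed
  qed
  show ?thesis
  proof
    assume "(x, u) \<in> LM"
    then have u: "inj u" "independent (range u)" "span (range u) = TM x" by (auto simp: frame_bundle_def)
    then have "\<forall>i. u i \<in> TM x" by (metis rangeI span_base)
    then show "(\<forall>i. u i \<in> TM x) \<and> det ?M \<noteq> 0" using det u by blast
  next
    assume "(\<forall>i. u i \<in> TM x) \<and> det ?M \<noteq> 0"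
    then show "(x, u) \<in> LM" using det span x by (auto simp: frame_bundle_def)
  qed
qed

lemma frame_carrier: "(x, u) \<in> LM \<Longrightarrow> x \<in> carrier_of A"
  by (simp add: frame_bundle_def)

lemma frame_tangent: "(x, u) \<in> LM \<Longrightarrow> u i \<in> TM x"
  using span_base[of "u i" "range u"] by (simp add: frame_bundle_def)

abbreviation GL :: "(real^'n^'n) set" where "GL \<equiv> {U. det U \<noteq> 0}"

lemma frame_chart_domain: "(x, u) \<in> fst (fchart c) \<longleftrightarrow> (x, u) \<in> LM \<and> x \<in> fst c"
  by (simp add: frame_chart_def)

lemma frame_chart_map: "snd (fchart c) (x, u) = (snd c x, \<chi> i. coords (u i) c)"
  by (simp add: frame_chart_def)

text \<open>An explicit inverse of the frame chart on its range, in place of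
  \<open>inv_into\<close>: coordinate rows become tangent vectors through fields with constant
  coordinates.\<close>

definition frame_point :: "('m, real^'n) chart \<Rightarrow> 'n frame_model \<Rightarrow> ('m, 'n) frame" where
  "frame_point c w = (chart_inv c (fst w), \<lambda>i. coord_field c (snd w $ i) (chart_inv c (fst w)))"

lemma frame_point_in:
  assumes "c \<in> A" "w \<in> (snd c ` fst c) \<times> GL"
  shows "frame_point c w \<in> fst (fchart c)" "snd (fchart c) (frame_point c w) = w"
proof -
  have z: "fst w \<in> snd c ` fst c" using assms(2) by auto
  note c = charts_at_chart_inv[OF assms(1) z]
  have M: "(\<chi> i. coords (coord_field c (snd w $ i) (chart_inv c (fst w))) c) = snd w"
    using c by (simp add: vec_lambda_eta)
  have "det (snd w) \<noteq> 0" using assms(2) by auto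
  then show "frame_point c w \<in> fst (fchart c)"
    unfolding frame_point_def frame_chart_domain frame_iff[OF c] M
    using charts_atD(2)[OF c] coord_field_tangent by simp
  show "snd (fchart c) (frame_point c w) = w"
    unfolding frame_point_def frame_chart_map M chart_chart_inv[OF z] by simp
qed

lemma frame_point_chart:
  assumes "c \<in> A" "(x, u) \<in> LM" "x \<in> fst c"
  shows "frame_point c (snd c x, \<chi> i. coords (u i) c) = (x, u)"
proof -
  have c: "c \<in> charts x" using assms by (simp add: charts_at_def)
  show ?thesis using assms
    by (simp add: frame_point_def chart_inv_chart fun_eq_iff coord_field_eqI[OF c frame_tangent])
qed

lemma frame_chart_image:
  assumes "c \<in> A"
  shows "snd (fchart c) ` {(x, u) \<in> LM. x \<in> W \<and> x \<in> fst c} = (snd c ` (W \<inter> fst c)) \<times> GL"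
proof (intro equalityI subsetI)
  fix w assume "w \<in> snd (fchart c) ` {(x, u) \<in> LM. x \<in> W \<and> x \<in> fst c}"
  then obtain x u where xu: "(x, u) \<in> LM" "x \<in> W" "x \<in> fst c" "w = (snd c x, \<chi> i. coords (u i) c)"
    by (auto simp: frame_chart_map)
  have "c \<in> charts x" using assms xu by (simp add: charts_at_def)
  then show "w \<in> (snd c ` (W \<inter> fst c)) \<times> GL" using xu frame_iff by auto
next
  fix w assume w: "w \<in> (snd c ` (W \<inter> fst c)) \<times> GL"
  then have "w \<in> (snd c ` fst c) \<times> GL" by auto
  note f = frame_point_in[OF assms this]
  have "chart_inv c (fst w) \<in> W" using w chart_inv_in_image[OF assms, of "fst w" W] by auto
  then have "frame_point c w \<in> {(x, u) \<in> LM. x \<in> W \<and> x \<in> fst c}"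
    using f(1) by (simp add: frame_point_def frame_chart_domain)
  from imageI[OF this, of "snd (fchart c)"]
  show "w \<in> snd (fchart c) ` {(x, u) \<in> LM. x \<in> W \<and> x \<in> fst c}"
    unfolding f(2) .
qed

lemma frame_chart_inj:
  assumes "c \<in> A"
  shows "inj_on (snd (fchart c)) (fst (fchart c))"
proof (rule inj_on_inverseI)
  show "frame_point c (snd (fchart c) p) = p" if "p \<in> fst (fchart c)" for p
    using that by (cases p) (simp add: frame_chart_map frame_chart_domain frame_point_chart[OF assms])
qed

lemma frame_chart_range:
  assumes "c \<in> A"
  shows "snd (fchart c) ` fst (fchart c) = (snd c ` fst c) \<times> GL"
  using frame_chart_image[OF assms, of "fst c"] by (simp add: frame_chart_def)

lemma frame_chart_inv:
  assumes "c \<in> A" "w \<in> (snd c ` fst c) \<times> GL"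
  shows "chart_inv (fchart c) w = frame_point c w"
  using inv_into_f_f[OF frame_chart_inj[OF assms(1)] frame_point_in(1)[OF assms]] frame_point_in(2)[OF assms] by simp

lemma frame_overlap:
  assumes "c \<in> A" "d \<in> A"
  shows "snd (fchart c) ` (fst (fchart c) \<inter> fst (fchart d)) = (snd c ` (fst c \<inter> fst d)) \<times> GL"
proof -
  have "fst (fchart c) \<inter> fst (fchart d) = {(x, u) \<in> LM. x \<in> fst d \<and> x \<in> fst c}"
    by (auto simp: frame_chart_def)
  then show ?thesis using frame_chart_image[OF assms(1), of "fst d"] by (simp add: inf_commute)
qed

lemma frame_transition:
  assumes "c \<in> A" "d \<in> A" "w \<in> (snd c ` (fst c \<inter> fst d)) \<times> GL"
  shows "(snd (fchart d) \<circ> chart_inv (fchart c)) w =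
    (transition c d (fst w), \<chi> i. jacobian c d (fst w) (snd w $ i))"
proof -
  have w: "w \<in> (snd c ` fst c) \<times> GL" "fst w \<in> snd c ` fst c" using assms(3) by auto
  note c = charts_at_chart_inv[OF assms(1) w(2)]
  have "chart_inv c (fst w) \<in> fst d" using assms(3) chart_inv_chart[OF assms(1)] by auto
  then have d: "d \<in> charts (chart_inv c (fst w))" using assms(2) by (simp add: charts_at_def)
  show ?thesis
    unfolding o_def frame_chart_inv[OF assms(1) w(1)] frame_point_def frame_chart_map coords_coord_field[OF c d]
    by (simp add: chart_chart_inv[OF w(2)] o_def)
qed

lemma smooth_on_fst:
  assumes "open S" "open T" "smooth_on S (f :: real^'n \<Rightarrow> 'b::real_normed_vector)"
  shows "smooth_on (S \<times> T) (\<lambda>w :: 'n frame_model. f (fst w))"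
  by (rule smooth_on_compose[where g = fst, OF open_Times[OF assms(1,2)] assms(1,3)
        smooth_on_bounded_linear[OF open_Times[OF assms(1,2)] bounded_linear_fst]]) auto

lemma smooth_on_frame_entry:
  assumes "open S"
  shows "smooth_on S (\<lambda>w :: 'n frame_model. snd w $ i)"
  by (rule smooth_on_bounded_linear[OF assms bounded_linear_compose[OF bounded_linear_vec_nth bounded_linear_snd]])

text \<open>A coordinate change of frames applies the Jacobian of the base to each row, so it is
  smooth by the rule for linear families.\<close>

lemma smooth_frame_atlas: "smooth_atlas FB"
  unfolding smooth_atlas_def frame_atlas_def ball_simps
proof (intro conjI ballI)
  fix c assume c: "c \<in> A"
  show "inj_on (snd (fchart c)) (fst (fchart c))" by (rule frame_chart_inj[OF c])
  show "open (snd (fchart c) ` fst (fchart c))"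
    unfolding frame_chart_range[OF c] by (intro open_Times open_det_nonzero open_chart_range c)
  fix d assume d: "d \<in> A"
  let ?S = "(snd c ` (fst c \<inter> fst d)) \<times> GL"
  have o: "open (snd c ` (fst c \<inter> fst d))" by (rule open_overlap[OF c d])
  have oS: "open ?S" by (intro open_Times open_det_nonzero o)
  show "open (snd (fchart c) ` (fst (fchart c) \<inter> fst (fchart d)))"
    unfolding frame_overlap[OF c d] by (rule oS)
  have jac: "smooth_on ?S (\<lambda>w. jacobian c d (fst w) (snd w $ i))" for i
  proof (rule smooth_on_linear_family[where F = "\<lambda>w. jacobian c d (fst w)" and Y = "\<lambda>w. snd w $ i", OF oS])
    show "linear (jacobian c d (fst w))" if "w \<in> ?S" for w
      by (rule has_derivative_linear[OF smooth_on_derivative(1)[OF o smooth_transition[OF c d]]]) (use that in auto)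
    show "smooth_on ?S (\<lambda>w. jacobian c d (fst w) b)" for b
      by (rule smooth_on_fst[OF o open_det_nonzero smooth_on_derivative(2)[OF o smooth_transition[OF c d]]])
  qed (rule smooth_on_frame_entry[OF oS])
  have S1: "smooth_on ?S (\<lambda>w. (transition c d (fst w), \<chi> i. jacobian c d (fst w) (snd w $ i)))"
    by (rule smooth_on_Pair[OF oS smooth_on_fst[OF o open_det_nonzero smooth_transition[OF c d]]
          smooth_on_vec_lambda[OF oS jac]])
  show "smooth_on (snd (fchart c) ` (fst (fchart c) \<inter> fst (fchart d)))
     (snd (fchart d) \<circ> chart_inv (fchart c))"
    unfolding frame_overlap[OF c d]
    by (rule smooth_on_cong[THEN iffD1, OF frame_transition[OF c d, symmetric] S1])
qed

end

section \<open>Horizontal and vertical lifts in coordinates\<close>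

lemma has_derivative_vec_lambda:
  fixes f :: "'n::finite \<Rightarrow> 'a::real_normed_vector \<Rightarrow> 'b::euclidean_space"
  assumes "\<And>i. (f i has_derivative f' i) (at x)"
  shows "((\<lambda>x. \<chi> i. f i x) has_derivative (\<lambda>h. \<chi> i. f' i h)) (at x)"
proof -
  have "((\<lambda>x. \<Sum>i\<in>UNIV. axis i (f i x)) has_derivative (\<lambda>h. \<Sum>i\<in>UNIV. axis i (f' i h))) (at x)"
    by (intro has_derivative_sum bounded_linear.has_derivative[OF bounded_linear_axis] assms)
  moreover have "(\<Sum>i\<in>UNIV. axis i (w i)) = (\<chi> i. w i)" for w :: "'n \<Rightarrow> 'b"
    by (simp add: vec_eq_iff axis_def if_distrib cong: if_cong)
  ultimately show ?thesis by simp
qed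

context atlas
begin

lemma coords_differential:
  assumes c: "c \<in> charts p" and v: "v \<in> TM p" and d: "d \<in> charts_at B (f p)"
    and f': "((snd d \<circ> f \<circ> chart_inv c) has_derivative f') (at (snd c p))"
  shows "coords (differential A B f p v) d = f' (coords v c)"
proof -
  define c0 where "c0 = (SOME c. c \<in> charts p)"
  have c0: "c0 \<in> charts p" unfolding c0_def using c by (rule someI)
  have "frechet_derivative (snd d \<circ> f \<circ> chart_inv c0) (at (snd c0 p)) = (\<lambda>h. f' (jacobian c0 c (snd c0 p) h))"
    by (rule frechet_derivativeI[OF has_derivative_change_chart[OF c0 c f']])
  then show ?thesis
    using d by (simp add: differential_def Let_def c0_def[symmetric] at_charts_def Tvec_inverse coords_change[OF v c0 c])
qed

lemma coords_differential_outside: "d \<notin> charts_at B (f p) \<Longrightarrow> coords (differential A B f p v) d = 0"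
  by (simp add: differential_def Let_def at_charts_def Tvec_inverse)

text \<open>The chain rule through the target charts. Besides differentiability, each target chart
  must contain the image of a neighbourhood of \<open>p\<close>: there the coordinates of
  \<open>f\<close> in two target charts are related by the coordinate change.\<close>

lemma differential_tangent:
  fixes B :: "('p, 'f::euclidean_space) atlas"
  assumes B: "atlas B" and v: "v \<in> TM p"
    and f: "\<And>d. d \<in> charts_at B (f p) \<Longrightarrow> \<exists>c\<in>charts p. \<exists>f' W. open_in W \<and> p \<in> W \<and> f ` W \<subseteq> fst d \<and>
      ((snd d \<circ> f \<circ> chart_inv c) has_derivative f') (at (snd c p))"
  shows "differential A B f p v \<in> tangent_space B (f p)"
proof -
  interpret B: atlas B by (rule B)
  show ?thesis
  proof (rule B.tangent_spaceI)
    fix d e assume d: "d \<in> charts_at B (f p)" and e: "e \<in> charts_at B (f p)"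
    from f[OF d] obtain c f' W where c: "c \<in> charts p" and W: "open_in W" "p \<in> W" "f ` W \<subseteq> fst d"
      and f': "((snd d \<circ> f \<circ> chart_inv c) has_derivative f') (at (snd c p))" by blast
    from f[OF e] obtain V where V: "open_in V" "p \<in> V" "f ` V \<subseteq> fst e" by blast
    note cA = charts_atD[OF c] and dB = B.charts_atD[OF d]
    have o: "open (snd c ` (W \<inter> V \<inter> fst c))" by (rule open_chart_image[OF openin_Int[OF W(1) V(1)] cA(1)])
    have p: "(snd d \<circ> f \<circ> chart_inv c) (snd c p) = snd d (f p)" by (simp add: chart_inv_chart cA)
    have J: "(B.transition d e has_derivative B.jacobian d e (snd d (f p))) (at ((snd d \<circ> f \<circ> chart_inv c) (snd c p)))"
      unfolding p by (rule B.jacobian_has_derivative[OF d e])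
    have "((snd e \<circ> f \<circ> chart_inv c) has_derivative (B.jacobian d e (snd d (f p)) \<circ> f')) (at (snd c p))"
    proof (rule has_derivative_transform_within_open[OF diff_chain_at[OF f' J] o])
      show "snd c p \<in> snd c ` (W \<inter> V \<inter> fst c)" using W(2) V(2) cA by blast
      show "(B.transition d e \<circ> (snd d \<circ> f \<circ> chart_inv c)) z = (snd e \<circ> f \<circ> chart_inv c) z"
        if "z \<in> snd c ` (W \<inter> V \<inter> fst c)" for z
      proof -
        have "f (chart_inv c z) \<in> fst d" using chart_inv_in_image[OF cA(1) that] W(3) by blast
        then show ?thesis by (simp add: B.chart_inv_chart[OF dB(1)])
      qed
    qed
    from coords_differential[OF c v e this] coords_differential[OF c v d f']
    show "coords (differential A B f p v) e = B.jacobian d e (snd d (f p)) (coords (differential A B f p v) d)"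
      by simp
  qed (rule coords_differential_outside)
qed

end

locale frame_metric = frames A g D + F: riemannian "frame_atlas A" G DL
  for A :: "('m, real^'n::finite) atlas" and g :: "('m, real^'n) metric_tensor" and D :: "('m, real^'n) connection"
    and G :: "(('m, 'n) frame, 'n frame_model) metric_tensor" and DL :: "(('m, 'n) frame, 'n frame_model) connection"
begin

abbreviation hor :: "('m, real^'n) vfield \<Rightarrow> (('m, 'n) frame, 'n frame_model) vfield" where
  "hor \<equiv> hlift_field A D"

abbreviation ver :: "'n \<Rightarrow> ('m, real^'n) vfield \<Rightarrow> (('m, 'n) frame, 'n frame_model) vfield" where
  "ver \<equiv> vlift_field A"

abbreviation frames_over :: "'m set \<Rightarrow> ('m, 'n) frame set" where
  "frames_over W \<equiv> {(x, u) \<in> LM. x \<in> W}"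

lemma frame_charts_at: "(x, u) \<in> LM \<Longrightarrow> charts_at FB (x, u) = fchart ` charts x"
  unfolding charts_at_def frame_atlas_def by (auto simp: frame_chart_domain)

lemma frame_chart_at: "(x, u) \<in> LM \<Longrightarrow> c \<in> charts x \<Longrightarrow> fchart c \<in> charts_at FB (x, u)"
  by (simp add: frame_charts_at)

lemma frame_chart_in_atlas: "c \<in> A \<Longrightarrow> fchart c \<in> FB"
  by (simp add: frame_atlas_def)

lemma FB_carrier: "carrier_of FB = LM"
proof -
  have "(x, u) \<in> carrier_of FB \<longleftrightarrow> (x, u) \<in> LM" for x u
    unfolding carrier_of_def frame_atlas_def
    using frame_carrier by (auto simp: frame_chart_domain carrier_of_def)
  then show ?thesis by auto
qed

lemma openin_frames_over:
  assumes W: "open_in W" and c: "c \<in> A" "W \<subseteq> fst c"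
  shows "F.open_in (frames_over W)"
proof -
  have "frames_over W = fst (fchart c) \<inter> snd (fchart c) -` ((snd c ` W) \<times> UNIV)"
    using c(2) chart_inv_chart[OF c(1)] by (auto simp: frame_chart_def) (metis subsetD)
  then show ?thesis
    using F.openin_domain_vimage[OF frame_chart_in_atlas[OF c(1)] open_Times[OF open_chart_image_subset[OF W c] open_UNIV]]
    by simp
qed

lemma frames_over_image:
  assumes "c \<in> A"
  shows "snd (fchart c) ` (frames_over W \<inter> fst (fchart c)) = (snd c ` (W \<inter> fst c)) \<times> GL"
proof -
  have "frames_over W \<inter> fst (fchart c) = {(x, u) \<in> LM. x \<in> W \<and> x \<in> fst c}"
    by (auto simp: frame_chart_def)
  then show ?thesis using frame_chart_image[OF assms] by simp
qed

abbreviation frame_coords :: "('m, real^'n) chart \<Rightarrow> ('n \<Rightarrow> ('m, real^'n) tvec) \<Rightarrow> (real^'n)^'n" where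
  "frame_coords c u \<equiv> \<chi> i. coords (u i) c"

lemma frame_coords_GL: "(x, u) \<in> LM \<Longrightarrow> c \<in> charts x \<Longrightarrow> frame_coords c u \<in> GL"
  using frame_iff by auto

section \<open>Vertical lifts\<close>

lemma vlift_curve_derivative:
  "vector_derivative (snd (fchart c) \<circ> (\<lambda>t. (x, u(i := u i + t *\<^sub>R a)))) (at 0) = (0, axis i (coords a c))"
proof -
  have "snd (fchart c) \<circ> (\<lambda>t. (x, u(i := u i + t *\<^sub>R a))) =
      (\<lambda>t. (snd c x, frame_coords c u) + t *\<^sub>R (0, axis i (coords a c)))"
    by (auto simp: fun_eq_iff frame_chart_map vec_eq_iff axis_def)
  moreover have "((\<lambda>t. (snd c x, frame_coords c u) + t *\<^sub>R (0, axis i (coords a c)))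
      has_vector_derivative (0, axis i (coords a c))) (at 0)"
    by (auto intro!: derivative_eq_intros)
  ultimately show ?thesis by (simp add: vector_derivative_at)
qed

lemma vlift_eq:
  "vlift A i (x, u) a = at_charts FB (x, u) (\<lambda>d. vector_derivative (snd d \<circ> (\<lambda>t. (x, u(i := u i + t *\<^sub>R a)))) (at 0))"
  by (simp add: vlift_def velocity_def)

lemma vlift_coords:
  assumes "(x, u) \<in> LM" "c \<in> charts x"
  shows "coords (vlift A i (x, u) a) (fchart c) = (0, axis i (coords a c))"
  unfolding vlift_eq F.coords_at_charts[OF frame_chart_at[OF assms]] by (rule vlift_curve_derivative)

text \<open>Over a fixed base point the coordinate change is linear in the frame, so it maps the
  line that defines the lift to the corresponding line in the other chart. Comparing derivatives
  gives the Jacobian on vertical vectors without differentiating the Jacobian of the base.\<close>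

lemma vlift_tangent:
  assumes xu: "(x, u) \<in> LM" and a: "a \<in> TM x"
  shows "vlift A i (x, u) a \<in> F.TM (x, u)"
  unfolding vlift_eq
proof (rule F.at_charts_tangent)
  fix c' d' assume "c' \<in> charts_at FB (x, u)" "d' \<in> charts_at FB (x, u)"
  then obtain c d where c: "c \<in> charts x" and d: "d \<in> charts x"
    and cd': "c' = fchart c" "d' = fchart d"
    by (auto simp: frame_charts_at[OF xu])
  note cA = charts_atD[OF c] and dA = charts_atD[OF d]
  define w where "w = (snd c x, frame_coords c u)"
  define h where "h = (0 :: real^'n, axis i (coords a c))"
  let ?S = "(snd c ` (fst c \<inter> fst d)) \<times> GL"
  let ?J = "F.jacobian (fchart c) (fchart d) w"
  let ?tr = "\<lambda>w. (transition c d (fst w), \<chi> i. jacobian c d (fst w) (snd w $ i))"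
  have w: "w \<in> ?S" using frame_coords_GL[OF xu c] cA dA by (auto simp: w_def)
  have wp: "w = snd (fchart c) (x, u)" by (simp add: w_def frame_chart_map)
  have oS: "open ?S" by (intro open_Times open_det_nonzero open_overlap cA dA)
  have J0: "(F.transition (fchart c) (fchart d) has_derivative ?J) (at w)"
    unfolding wp by (rule F.jacobian_has_derivative[OF frame_chart_at[OF xu c] frame_chart_at[OF xu d]])
  have J: "(?tr has_derivative ?J) (at w)"
    by (rule has_derivative_transform_within_open[OF J0 oS w frame_transition[OF cA(1) dA(1)]])
  have "((\<lambda>t. w + t *\<^sub>R h) has_derivative (\<lambda>t. t *\<^sub>R h)) (at 0)" by (auto intro!: derivative_eq_intros)
  from diff_chain_at[OF this, of ?tr ?J] J
  have 1: "((\<lambda>t. ?tr (w + t *\<^sub>R h)) has_derivative (\<lambda>t. ?J (t *\<^sub>R h))) (at (0::real))"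
    by (simp add: o_def)
  \<comment> \<open>The base component of \<open>h\<close> is 0, so the Jacobian of the base is
    evaluated at the same point for every \<open>t\<close>.\<close>
  have "?tr (w + t *\<^sub>R h) = ?tr w + t *\<^sub>R (0, axis i (coords a d))" for t
    by (simp add: w_def h_def vec_eq_iff axis_def coords_change[OF a c d] linear_add[OF linear_jacobian[OF c d]]
        linear_scale[OF linear_jacobian[OF c d]] linear_0[OF linear_jacobian[OF c d]])
  moreover have "((\<lambda>t. ?tr w + t *\<^sub>R (0, axis i (coords a d))) has_derivative (\<lambda>t. t *\<^sub>R (0, axis i (coords a d)))) (at (0::real))"
    by (auto intro!: derivative_eq_intros)
  ultimately have 2: "((\<lambda>t. ?tr (w + t *\<^sub>R h)) has_derivative (\<lambda>t. t *\<^sub>R (0, axis i (coords a d)))) (at (0::real))"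
    by simp
  have "?J h = (0, axis i (coords a d))"
    using fun_cong[OF has_derivative_unique[OF 1 2], of 1] by simp
  then show "vector_derivative (snd d' \<circ> (\<lambda>t. (x, u(i := u i + t *\<^sub>R a)))) (at 0) =
      F.jacobian c' d' (snd c' (x, u)) (vector_derivative (snd c' \<circ> (\<lambda>t. (x, u(i := u i + t *\<^sub>R a)))) (at 0))"
    unfolding cd' vlift_curve_derivative wp[symmetric] h_def by simp
qed

section \<open>Horizontal lifts\<close>

definition horizontal_rep :: "('m, real^'n) chart \<Rightarrow> real^'n \<Rightarrow> real^'n \<Rightarrow> (real^'n)^'n \<Rightarrow> 'n frame_model" where
  "horizontal_rep c z a U = (a, \<chi> k. - christoffel c z a (U $ k))"

lemma frame_chartE:
  assumes "(x, u) \<in> LM"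
  obtains c where "c \<in> charts x"
  using some_chart[OF frame_carrier[OF assms]] by blast

lemma section_has_derivative:
  assumes s: "\<And>i. near x (s i)" and c: "c \<in> charts x"
  shows "((snd (fchart c) \<circ> (\<lambda>q. (q, \<lambda>i. s i q)) \<circ> chart_inv c) has_derivative
    (\<lambda>h. (h, \<chi> i. drep c (s i) (snd c x) h))) (at (snd c x))"
proof (rule has_derivative_transform_within_open[OF has_derivative_Pair[OF has_derivative_ident
        has_derivative_vec_lambda[OF field_near_has_derivative[OF s c]]] open_chart_range])
  show "(z, \<chi> i. rep c (s i) z) = (snd (fchart c) \<circ> (\<lambda>q. (q, \<lambda>i. s i q)) \<circ> chart_inv c) z" if "z \<in> snd c ` fst c" for z
    by (simp add: frame_chart_map chart_chart_inv[OF that])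
qed (use charts_atD[OF c] in auto)

text \<open>Being parallel at x in direction v fixes the derivative of the i-th frame field along v
  as -\<Gamma>(v, u_i). A horizontal vector thus depends on v and the frame but not on the
  section.\<close>

lemma horizontal_space_coords:
  assumes xu: "(x, u) \<in> LM" and "\<xi> \<in> horizontal_space A D (x, u)"
  obtains v where "v \<in> TM x" "\<xi> \<in> F.TM (x, u)"
    "\<And>c. c \<in> charts x \<Longrightarrow> coords \<xi> (fchart c) = horizontal_rep c (snd c x) (coords v c) (frame_coords c u)"
proof -
  from assms(2)[unfolded horizontal_space_def fst_conv snd_conv]
  obtain v W s where v: "v \<in> TM x" and W: "open_in W" "x \<in> W"
    and s': "\<forall>i. vf_on W (s i)" "\<forall>q\<in>W. (q, \<lambda>i. s i q) \<in> LM"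
    "\<forall>i. s i x = u i" "\<forall>i. D x v (s i) = 0"
    and \<xi>: "\<xi> = differential A FB (\<lambda>q. (q, \<lambda>i. s i q)) x v"
    by (elim CollectE bexE exE conjE)
  note s = s'(1)[THEN spec] s'(2)[THEN bspec] and su = s'(3)[THEN spec] and Ds = s'(4)[THEN spec]
  let ?\<sigma> = "\<lambda>q. (q, \<lambda>i. s i q)"
  have \<sigma>x: "?\<sigma> x = (x, u)" using su by auto
  have near: "near x (s i)" for i by (rule field_nearI[OF W s(1)])
  note der = section_has_derivative[of x s, OF near]
  have "\<xi> \<in> F.TM (?\<sigma> x)"
    unfolding \<xi>
  proof (rule differential_tangent[OF F.atlas_axioms v])
    fix d assume "d \<in> charts_at FB (?\<sigma> x)"
    then obtain c where c: "c \<in> charts x" "d = fchart c" unfolding \<sigma>x by (auto simp: frame_charts_at[OF xu])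
    have "open_in (W \<inter> fst c)" by (rule openin_Int[OF W(1) openin_domain[OF charts_atD(1)[OF c(1)]]])
    moreover have "?\<sigma> ` (W \<inter> fst c) \<subseteq> fst d" using s(2) by (auto simp: c(2) frame_chart_domain)
    ultimately show "\<exists>c\<in>charts x. \<exists>f' W. open_in W \<and> x \<in> W \<and> ?\<sigma> ` W \<subseteq> fst d \<and>
        ((snd d \<circ> ?\<sigma> \<circ> chart_inv c) has_derivative f') (at (snd c x))"
      using der[OF c(1)] W(2) charts_atD[OF c(1)] c unfolding c(2) by blast
  qed
  then have T: "\<xi> \<in> F.TM (x, u)" unfolding \<sigma>x .
  have "coords \<xi> (fchart c) = horizontal_rep c (snd c x) (coords v c) (frame_coords c u)"
    if c: "c \<in> charts x" for c
  proof -
    have fc: "fchart c \<in> charts_at FB (?\<sigma> x)" unfolding \<sigma>x by (rule frame_chart_at[OF xu c])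
    have "frechet_derivative (rep c (s i)) (at (snd c x)) (coords v c) = - christoffel c (snd c x) (coords v c) (coords (u i) c)" for i
      using D_coords[OF near c v, of i] by (simp add: Ds su eq_neg_iff_add_eq_0)
    then show ?thesis
      unfolding \<xi> coords_differential[OF c v fc der[OF c]] horizontal_rep_def by simp
  qed
  with v T show thesis by (rule that)
qed

lemma differential_projection:
  assumes xu: "(x, u) \<in> LM" and \<xi>: "\<xi> \<in> F.TM (x, u)" and v: "v \<in> TM x"
    and fst: "\<And>c. c \<in> charts x \<Longrightarrow> fst (coords \<xi> (fchart c)) = coords v c"
  shows "differential FB A fst (x, u) \<xi> = v"
proof -
  have "coords (differential FB A fst (x, u) \<xi>) c = coords v c" for c
  proof (cases "c \<in> charts x")
    case True
    note cA = charts_atD[OF True]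
    have "((snd c \<circ> fst \<circ> chart_inv (fchart c)) has_derivative fst) (at (snd (fchart c) (x, u)))"
    proof (rule has_derivative_transform_within_open[OF bounded_linear_imp_has_derivative[OF bounded_linear_fst]])
      show "open ((snd c ` fst c) \<times> GL)" by (intro open_Times open_det_nonzero open_chart_range cA)
      show "snd (fchart c) (x, u) \<in> (snd c ` fst c) \<times> GL"
        using frame_coords_GL[OF xu True] cA by (simp add: frame_chart_map)
      show "fst w = (snd c \<circ> fst \<circ> chart_inv (fchart c)) w" if "w \<in> (snd c ` fst c) \<times> GL" for w
        using that chart_chart_inv[of "fst w" c] by (auto simp: frame_chart_inv[OF cA(1) that] frame_point_def)
    qed
    from F.coords_differential[OF frame_chart_at[OF xu True] \<xi> _ this, of A] True fst[OF True]
    show ?thesis by simp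
  next
    case False
    then show ?thesis using F.coords_differential_outside[of c A fst "(x, u)" \<xi>] coords_outside[OF v False] by simp
  qed
  then show ?thesis by (metis coords_inject ext)
qed

text \<open>The frame field has to be parallel at the single point \<open>x\<close> only, so affine
  coordinates do instead of a solution of the parallel transport equation.\<close>

lemma horizontal_space_exists:
  assumes xu: "(x, u) \<in> LM" and v: "v \<in> TM x"
  obtains \<xi> where "\<xi> \<in> horizontal_space A D (x, u)"
    "\<And>c. c \<in> charts x \<Longrightarrow> fst (coords \<xi> (fchart c)) = coords v c" "\<xi> \<in> F.TM (x, u)"
proof -
  obtain c where c: "c \<in> charts x" by (rule frame_chartE[OF xu])
  note cA = charts_atD[OF c]
  define z0 where "z0 = snd c x"
  have z0: "z0 \<in> snd c ` fst c" using cA by (auto simp: z0_def)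
  \<comment> \<open>Affine with value u_i at \<open>z0\<close> and derivative -\<Gamma>(h, u_i) in
    direction h, so the covariant derivative at \<open>x\<close> vanishes in every
    direction.\<close>
  define S where "S i z = coords (u i) c - christoffel c z0 (z - z0) (coords (u i) c)" for i z
  have bl: "bounded_linear (\<lambda>z. christoffel c z0 z b)" for b
    using linear_christoffel_left[OF cA(1) z0] by (simp add: linear_conv_bounded_linear)
  have S_smooth: "smooth_on T (S i)" if "open T" for T i
  proof -
    have "smooth_on T (\<lambda>z. (coords (u i) c + christoffel c z0 z0 (coords (u i) c)) + - christoffel c z0 z (coords (u i) c))"
      by (intro smooth_on_add smooth_on_const smooth_on_uminus smooth_on_bounded_linear bl that)
    moreover have "S i = (\<lambda>z. (coords (u i) c + christoffel c z0 z0 (coords (u i) c)) + - christoffel c z0 z (coords (u i) c))"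
      by (simp add: fun_eq_iff S_def linear_diff[OF linear_christoffel_left[OF cA(1) z0]])
    ultimately show ?thesis by simp
  qed
  have dS: "(S i has_derivative (\<lambda>h. - christoffel c z0 h (coords (u i) c))) (at z0)" for i
    unfolding S_def
    by (rule has_derivative_eq_rhs, rule has_derivative_diff[OF has_derivative_const
          bounded_linear.has_derivative[OF bl has_derivative_diff[OF has_derivative_ident has_derivative_const]]]) simp
  have S0: "S i z0 = coords (u i) c" for i
    by (simp add: S_def linear_0[OF linear_christoffel_left[OF cA(1) z0]])
  define s where "s i q = coord_field c (S i (snd c q)) q" for i q
  \<comment> \<open>The fields remain a frame where the determinant of their coordinates is nonzero,
    which is an open condition.\<close>
  define V where "V = (\<lambda>z. \<chi> i. S i z) -` GL"
  have "continuous_on UNIV (\<lambda>z. \<chi> i. S i z)"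
    by (rule smooth_on_imp_continuous_on[OF smooth_on_vec_lambda[OF open_UNIV S_smooth[OF open_UNIV]]])
  then have "open V" unfolding V_def by (intro open_vimage open_det_nonzero)
  define W where "W = fst c \<inter> snd c -` V"
  have W: "open_in W" "W \<subseteq> fst c" unfolding W_def using openin_domain_vimage[OF cA(1) \<open>open V\<close>] by auto
  have xW: "x \<in> W"
    using frame_coords_GL[OF xu c] cA by (simp add: W_def V_def z0_def[symmetric] S0)
  have cq: "c \<in> charts q" if "q \<in> W" for q using that W(2) cA(1) by (auto simp: charts_at_def)
  have rep: "S i z = rep c (s i) z" if "z \<in> snd c ` W" for i z
  proof -
    from that obtain q where q: "q \<in> W" "z = snd c q" by blast
    then have "chart_inv c z = q" using chart_inv_chart[OF cA(1)] W(2) by blast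
    then show ?thesis using q cq by (simp add: s_def)
  qed
  have oW: "open (snd c ` W)" by (rule open_chart_image_subset[OF W(1) cA(1) W(2)])
  have vf: "vf_on W (s i)" for i
    by (rule vector_field_onI[OF W(1) cA(1) W(2) _ smooth_on_cong[THEN iffD1, OF rep S_smooth[OF oW]]])
       (simp add: s_def coord_field_tangent)
  have frame: "(q, \<lambda>i. s i q) \<in> LM" if "q \<in> W" for q
    unfolding frame_iff[OF cq[OF that]]
    using that by (simp add: s_def coord_field_tangent cq W_def V_def)
  have sx: "s i x = u i" for i
    unfolding s_def z0_def[symmetric] S0 by (rule coord_field_eqI[OF c frame_tangent[OF xu]])
  have near: "near x (s i)" for i by (rule field_nearI[OF W(1) xW vf])
  have Ds: "D x v (s i) = 0" for i
  proof (rule tangent_eqI[OF D_tangent[OF near v] tangent_0 c])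
    have "(rep c (s i) has_derivative (\<lambda>h. - christoffel c z0 h (coords (u i) c))) (at z0)"
      by (rule has_derivative_transform_within_open[OF dS oW _ rep]) (use xW in \<open>auto simp: z0_def\<close>)
    then show "coords (D x v (s i)) c = coords 0 c"
      unfolding D_coords[OF near c v] z0_def[symmetric] by (simp add: frechet_derivativeI sx)
  qed
  let ?\<xi> = "differential A FB (\<lambda>q. (q, \<lambda>i. s i q)) x v"
  have \<xi>: "?\<xi> \<in> horizontal_space A D (x, u)"
    unfolding horizontal_space_def fst_conv snd_conv
    by (intro CollectI bexI[OF _ v] exI[of _ W] exI[of _ s] conjI allI ballI W(1) xW vf frame sx Ds refl)
  have \<sigma>x: "(\<lambda>q. (q, \<lambda>i. s i q)) x = (x, u)" using sx by auto
  have fst: "fst (coords ?\<xi> (fchart d)) = coords v d" if d: "d \<in> charts x" for d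
  proof -
    have fd: "fchart d \<in> charts_at FB ((\<lambda>q. (q, \<lambda>i. s i q)) x)" unfolding \<sigma>x by (rule frame_chart_at[OF xu d])
    from coords_differential[OF d v fd section_has_derivative[of x s, OF near d]] show ?thesis by simp
  qed
  have "?\<xi> \<in> F.TM (x, u)" using horizontal_space_coords[OF xu \<xi>] by blast
  from that[OF \<xi> fst this] show thesis .
qed

text \<open>The definite description picks out one vector: projecting a horizontal vector returns
  its direction, and the direction determines all its coordinates.\<close>

lemma
  assumes xu: "(x, u) \<in> LM" and a: "a \<in> TM x"
  shows hlift_tangent: "hlift A D (x, u) a \<in> F.TM (x, u)"
    and hlift_coords: "c \<in> charts x \<Longrightarrow> coords (hlift A D (x, u) a) (fchart c) =
      horizontal_rep c (snd c x) (coords a c) (frame_coords c u)"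
proof -
  have uniq: "\<xi> \<in> F.TM (x, u) \<and> (\<forall>c\<in>charts x. coords \<xi> (fchart c) =
      horizontal_rep c (snd c x) (coords a c) (frame_coords c u))"
    if \<xi>: "\<xi> \<in> horizontal_space A D (x, u)" and proj: "differential FB A fst (x, u) \<xi> = a" for \<xi>
  proof -
    obtain v where v: "v \<in> TM x" "\<xi> \<in> F.TM (x, u)"
      and co: "\<And>c. c \<in> charts x \<Longrightarrow> coords \<xi> (fchart c) = horizontal_rep c (snd c x) (coords v c) (frame_coords c u)"
      using horizontal_space_coords[OF xu \<xi>] by blast
    have "differential FB A fst (x, u) \<xi> = v"
      by (rule differential_projection[OF xu v(2,1)]) (simp add: co horizontal_rep_def)
    then show ?thesis using v co proj by simp
  qed
  obtain c where c: "c \<in> charts x" by (rule frame_chartE[OF xu])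
  obtain \<xi> where \<xi>: "\<xi> \<in> horizontal_space A D (x, u)"
    "\<And>c. c \<in> charts x \<Longrightarrow> fst (coords \<xi> (fchart c)) = coords a c" "\<xi> \<in> F.TM (x, u)"
    using horizontal_space_exists[OF xu a] by blast
  have proj: "differential FB A fst (x, u) \<xi> = a" by (rule differential_projection[OF xu \<xi>(3) a \<xi>(2)])
  have "hlift A D (x, u) a = \<xi>"
    unfolding hlift_def
  proof (rule the_equality)
    show "\<xi> \<in> horizontal_space A D (x, u) \<and> differential FB A fst (x, u) \<xi> = a" using \<xi>(1) proj by blast
    fix \<eta> assume "\<eta> \<in> horizontal_space A D (x, u) \<and> differential FB A fst (x, u) \<eta> = a"
    then have \<eta>: "\<eta> \<in> horizontal_space A D (x, u)" "differential FB A fst (x, u) \<eta> = a" by auto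
    show "\<eta> = \<xi>"
      by (rule F.tangent_eqI[OF _ _ frame_chart_at[OF xu c]])
         (use uniq[OF \<eta>] uniq[OF \<xi>(1) proj] c in simp_all)
  qed
  with uniq[OF \<xi>(1) proj] show "hlift A D (x, u) a \<in> F.TM (x, u)"
    "c \<in> charts x \<Longrightarrow> coords (hlift A D (x, u) a) (fchart c) =
      horizontal_rep c (snd c x) (coords a c) (frame_coords c u)" for c
    by auto
qed

end

section \<open>Lifted vector fields\<close>

context frame_metric
begin

lemma frame_chart_invE:
  assumes c: "c \<in> A" and w: "w \<in> (snd c ` (W \<inter> fst c)) \<times> GL"
  obtains y u where "chart_inv (fchart c) w = (y, u)" "chart_inv c (fst w) = y" "(y, u) \<in> LM" "y \<in> W"
    "c \<in> charts y" "fst w = snd c y" "snd w = frame_coords c u"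
proof -
  have w': "w \<in> (snd c ` fst c) \<times> GL" using w by auto
  obtain y u where yu: "frame_point c w = (y, u)" by (cases "frame_point c w")
  have y: "y = chart_inv c (fst w)" using yu by (simp add: frame_point_def)
  have f: "(y, u) \<in> LM" "y \<in> fst c" and eq: "(snd c y, frame_coords c u) = w"
    using frame_point_in[OF c w'] unfolding yu frame_chart_domain frame_chart_map by auto
  have W: "y \<in> W" using w chart_inv_in_image[OF c, of "fst w" W] y by auto
  have i: "chart_inv (fchart c) w = (y, u)" unfolding frame_chart_inv[OF c w'] by (rule yu)
  have cy: "c \<in> charts y" using c f(2) by (simp add: charts_at_def)
  show thesis by (rule that[OF i y[symmetric] f(1) W cy]) (simp_all add: eq[symmetric])
qed

text \<open>Oriented from the explicit expression to the lift, the direction in which smoothness and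
  derivatives are transferred.\<close>

lemma hlift_field_rep:
  assumes "c \<in> A" "\<And>q. q \<in> W \<Longrightarrow> X q \<in> TM q" "w \<in> (snd c ` (W \<inter> fst c)) \<times> GL"
  shows "horizontal_rep c (fst w) (rep c X (fst w)) (snd w) = F.rep (fchart c) (hor X) w"
proof -
  obtain y u where yu: "chart_inv (fchart c) w = (y, u)" "chart_inv c (fst w) = y" "(y, u) \<in> LM" "y \<in> W"
    "c \<in> charts y" "fst w = snd c y" "snd w = frame_coords c u"
    by (rule frame_chart_invE[OF assms(1,3)])
  show ?thesis unfolding yu(1,2) hlift_field_def fst_conv hlift_coords[OF yu(3) assms(2)[OF yu(4)] yu(5)]
    by (simp add: yu(6,7))
qed

lemma vlift_field_rep:
  assumes "c \<in> A" "w \<in> (snd c ` (W \<inter> fst c)) \<times> GL"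
  shows "(0, axis i (rep c X (fst w))) = F.rep (fchart c) (ver i X) w"
proof -
  obtain y u where yu: "chart_inv (fchart c) w = (y, u)" "chart_inv c (fst w) = y" "(y, u) \<in> LM" "y \<in> W"
    "c \<in> charts y" "fst w = snd c y" "snd w = frame_coords c u"
    by (rule frame_chart_invE[OF assms])
  show ?thesis unfolding yu(1,2) vlift_field_def fst_conv vlift_coords[OF yu(3,5)] ..
qed

lemma frame_vector_field_onI:
  assumes "\<And>x u. (x, u) \<in> LM \<Longrightarrow> x \<in> W \<Longrightarrow> \<Xi> (x, u) \<in> F.TM (x, u)"
    and "\<And>c. c \<in> A \<Longrightarrow> smooth_on ((snd c ` (W \<inter> fst c)) \<times> GL) (F.rep (fchart c) \<Xi>)"
  shows "vector_field_on FB (frames_over W) \<Xi>"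
  unfolding vector_field_on_def
proof (intro conjI ballI)
  fix d assume "d \<in> FB"
  then obtain c where c: "c \<in> A" "d = fchart c" by (auto simp: frame_atlas_def)
  show "smooth_on (snd d ` (frames_over W \<inter> fst d)) (F.rep d \<Xi>)"
    unfolding c(2) frames_over_image[OF c(1)] by (rule assms(2)[OF c(1)])
qed (use assms(1) in auto)

lemma open_frame_domain: "open_in W \<Longrightarrow> c \<in> A \<Longrightarrow> open ((snd c ` (W \<inter> fst c)) \<times> GL)"
  by (intro open_Times open_det_nonzero open_chart_image)

text \<open>\<Gamma> is linear in each argument, so the rule for linear families applies once with
  the coordinates of \<open>X\<close> and once with each row of the frame.\<close>

lemma hlift_field_vector_field:
  assumes W: "open_in W" and X: "vf_on W X"
  shows "vector_field_on FB (frames_over W) (hor X)"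
proof (rule frame_vector_field_onI)
  have T: "X q \<in> TM q" if "q \<in> W" for q using X that by (simp add: vector_field_on_def)
  show "hor X (x, u) \<in> F.TM (x, u)" if "(x, u) \<in> LM" "x \<in> W" for x u
    using hlift_tangent[OF that(1) T[OF that(2)]] by (simp add: hlift_field_def)
  fix c assume c: "c \<in> A"
  let ?T = "snd c ` (W \<inter> fst c)"
  have o: "open ?T" and oS: "open (?T \<times> GL)" using open_chart_image[OF W c] open_frame_domain[OF W c] by auto
  have sX: "smooth_on ?T (rep c X)" using X c by (simp add: vector_field_on_def)
  have \<Gamma>: "smooth_on ?T (\<lambda>z. christoffel c z a b)" for a b
    by (rule smooth_on_subset[OF open_chart_range[OF c] o _ smooth_christoffel[OF c]]) auto
  have \<Gamma>X: "smooth_on ?T (\<lambda>z. christoffel c z (rep c X z) b)" for b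
    by (rule smooth_on_linear_family[where F = "\<lambda>z a. christoffel c z a b" and Y = "rep c X", OF o _ \<Gamma> sX])
       (use linear_christoffel_left[OF c] in auto)
  have 1: "smooth_on (?T \<times> GL) (\<lambda>w. christoffel c (fst w) (rep c X (fst w)) (snd w $ k))" for k
    by (rule smooth_on_linear_family[where F = "\<lambda>w. christoffel c (fst w) (rep c X (fst w))" and Y = "\<lambda>w. snd w $ k",
          OF oS _ smooth_on_fst[OF o open_det_nonzero \<Gamma>X] smooth_on_frame_entry[OF oS]])
       (use linear_christoffel_right[OF c] in auto)
  have 2: "smooth_on (?T \<times> GL) (\<lambda>w. horizontal_rep c (fst w) (rep c X (fst w)) (snd w))"
    unfolding horizontal_rep_def
    by (rule smooth_on_Pair[OF oS smooth_on_fst[OF o open_det_nonzero sX] smooth_on_vec_lambda[OF oS smooth_on_uminus[OF oS 1]]])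
  show "smooth_on (?T \<times> GL) (F.rep (fchart c) (hor X))"
    by (rule smooth_on_cong[THEN iffD1, OF hlift_field_rep[OF c T] 2])
qed

lemma vlift_field_vector_field:
  assumes W: "open_in W" and X: "vf_on W X"
  shows "vector_field_on FB (frames_over W) (ver i X)"
proof (rule frame_vector_field_onI)
  have T: "X q \<in> TM q" if "q \<in> W" for q using X that by (simp add: vector_field_on_def)
  show "ver i X (x, u) \<in> F.TM (x, u)" if "(x, u) \<in> LM" "x \<in> W" for x u
    using vlift_tangent[OF that(1) T[OF that(2)]] by (simp add: vlift_field_def)
  fix c assume c: "c \<in> A"
  let ?T = "snd c ` (W \<inter> fst c)"
  have o: "open ?T" and oS: "open (?T \<times> GL)" using open_chart_image[OF W c] open_frame_domain[OF W c] by auto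
  have sX: "smooth_on ?T (rep c X)" using X c by (simp add: vector_field_on_def)
  have 1: "smooth_on (?T \<times> GL) (\<lambda>w. (0 :: real^'n, axis i (rep c X (fst w)) :: (real^'n)^'n))"
    by (rule smooth_on_Pair[OF oS smooth_on_const[OF oS] smooth_on_compose_bounded_linear[OF oS bounded_linear_axis
          smooth_on_fst[OF o open_det_nonzero sX]]])
  show "smooth_on (?T \<times> GL) (F.rep (fchart c) (ver i X))"
    by (rule smooth_on_cong[THEN iffD1, OF vlift_field_rep[OF c, where X = X and i = i] 1])
qed

lemma
  assumes X: "near x X" and xu: "(x, u) \<in> LM"
  shows hlift_field_near: "field_near FB (x, u) (hor X)"
    and vlift_field_near: "field_near FB (x, u) (ver i X)"
proof -
  obtain c where c: "c \<in> charts x" by (rule frame_chartE[OF xu])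
  obtain W where W: "open_in W" "x \<in> W" "W \<subseteq> fst c" "vf_on W X" by (rule field_nearE[OF X c])
  have o: "F.open_in (frames_over W)" by (rule openin_frames_over[OF W(1) charts_atD(1)[OF c] W(3)])
  have in_W: "(x, u) \<in> frames_over W" using xu W(2) by simp
  show "field_near FB (x, u) (hor X)"
    by (rule F.field_nearI[OF o in_W hlift_field_vector_field[OF W(1,4)]])
  show "field_near FB (x, u) (ver i X)"
    by (rule F.field_nearI[OF o in_W vlift_field_vector_field[OF W(1,4)]])
qed

text \<open>For \<open>h\<close> consisting of a base and a frame increment, the frame increment
  enters the horizontal lift only through \<Gamma>(X, .) and the vertical lift not at all, since
  that is constant along fibres. The brackets below rest on this.\<close>

lemma
  assumes X: "near x X" and xu: "(x, u) \<in> LM" and c: "c \<in> charts x"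
  defines "z \<equiv> snd c x" and "X' \<equiv> drep c X (snd c x)"
  shows hlift_field_has_derivative:
    "(F.rep (fchart c) (hor X) has_derivative
      (\<lambda>h. (X' (fst h), \<chi> k. - (dchristoffel c z (fst h) (coords (X x) c) (coords (u k) c)
        + christoffel c z (X' (fst h)) (coords (u k) c) + christoffel c z (coords (X x) c) (snd h $ k)))))
      (at (snd (fchart c) (x, u)))"
    and vlift_field_has_derivative:
    "(F.rep (fchart c) (ver i X) has_derivative (\<lambda>h. (0, axis i (X' (fst h)))))
      (at (snd (fchart c) (x, u)))"
proof -
  note cA = charts_atD[OF c]
  obtain W where W: "open_in W" "x \<in> W" "W \<subseteq> fst c" "vf_on W X" by (rule field_nearE[OF X c])
  have T: "X q \<in> TM q" if "q \<in> W" for q using W(4) that by (simp add: vector_field_on_def)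
  let ?w = "(z, frame_coords c u)"
  let ?S = "(snd c ` (W \<inter> fst c)) \<times> GL"
  have w: "snd (fchart c) (x, u) = ?w" by (simp add: frame_chart_map z_def)
  have wS: "?w \<in> ?S" using frame_coords_GL[OF xu c] cA W(2) by (auto simp: z_def)
  have zc: "z \<in> snd c ` fst c" using cA by (auto simp: z_def)
  have X0: "rep c X z = coords (X x) c" by (simp add: z_def chart_inv_chart cA)
  have oS: "open ?S" by (rule open_frame_domain[OF W(1) cA(1)])
  have dfst: "(fst has_derivative fst) (at ?w)" by (rule bounded_linear_imp_has_derivative[OF bounded_linear_fst])
  have dk: "((\<lambda>w. snd w $ k) has_derivative (\<lambda>h. snd h $ k)) (at ?w)" for k
    by (rule bounded_linear_imp_has_derivative[OF bounded_linear_compose[OF bounded_linear_vec_nth bounded_linear_snd]])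
  have dX: "((\<lambda>w. rep c X (fst w)) has_derivative (\<lambda>h. X' (fst h))) (at ?w)"
    using diff_chain_at[OF dfst, of "rep c X" X'] field_near_has_derivative[OF X c]
    by (simp add: o_def X'_def z_def)
  have "((\<lambda>w. christoffel c (fst w) (rep c X (fst w)) (snd w $ k)) has_derivative
    (\<lambda>h. dchristoffel c z (fst h) (coords (X x) c) (coords (u k) c)
        + christoffel c z (X' (fst h)) (coords (u k) c) + christoffel c z (coords (X x) c) (snd h $ k))) (at ?w)" for k
    using christoffel_has_derivative[OF cA(1) _ dfst dX dk[of k]] zc by (simp add: X0)
  then have "((\<lambda>w. horizontal_rep c (fst w) (rep c X (fst w)) (snd w)) has_derivative
     (\<lambda>h. (X' (fst h), \<chi> k. - (dchristoffel c z (fst h) (coords (X x) c) (coords (u k) c)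
        + christoffel c z (X' (fst h)) (coords (u k) c) + christoffel c z (coords (X x) c) (snd h $ k))))) (at ?w)"
    unfolding horizontal_rep_def by (intro has_derivative_Pair has_derivative_vec_lambda has_derivative_minus dX)
  then show "(F.rep (fchart c) (hor X) has_derivative
      (\<lambda>h. (X' (fst h), \<chi> k. - (dchristoffel c z (fst h) (coords (X x) c) (coords (u k) c)
        + christoffel c z (X' (fst h)) (coords (u k) c) + christoffel c z (coords (X x) c) (snd h $ k)))))
      (at (snd (fchart c) (x, u)))"
    unfolding w by (rule has_derivative_transform_within_open[OF _ oS wS hlift_field_rep[OF cA(1) T]])
  have "((\<lambda>w. (0 :: real^'n, axis i (rep c X (fst w)))) has_derivative (\<lambda>h. (0, axis i (X' (fst h))))) (at ?w)"
    by (intro has_derivative_Pair has_derivative_const bounded_linear.has_derivative[OF bounded_linear_axis dX])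
  then show "(F.rep (fchart c) (ver i X) has_derivative (\<lambda>h. (0, axis i (X' (fst h)))))
      (at (snd (fchart c) (x, u)))"
    unfolding w by (rule has_derivative_transform_within_open[OF _ oS wS vlift_field_rep[OF cA(1), where X = X and i = i]])
qed

section \<open>Brackets of lifts\<close>

lemma lift_field_at [simp]:
  "hor X (x, u) = hlift A D (x, u) (X x)" "ver i X (x, u) = vlift A i (x, u) (X x)"
  by (simp_all add: hlift_field_def vlift_field_def)

text \<open>For two horizontal lifts, the derivatives of \<Gamma> and the products from the frame
  slots add up in slot k to -\<Gamma>([X, Y], u_k) minus the curvature expression. In the mixed case
  the frame derivative of the horizontal lift supplies the \<Gamma> term of the covariant
  derivative.\<close>

lemma
  assumes X: "near x X" and Y: "near x Y" and xu: "(x, u) \<in> LM"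
  shows lie_bracket_hh: "lie_bracket FB (hor X) (hor Y) (x, u) =
      hlift A D (x, u) (lie_bracket A X Y x) - (\<Sum>k\<in>UNIV. vlift A k (x, u) (curvature A D x (X x) (Y x) (u k)))"
    and lie_bracket_hv: "lie_bracket FB (hor X) (ver i Y) (x, u) = vlift A i (x, u) (D x (X x) Y)"
    and lie_bracket_vv: "lie_bracket FB (ver i X) (ver j Y) (x, u) = 0"
proof -
  obtain c where c: "c \<in> charts x" by (rule frame_chartE[OF xu])
  note cA = charts_atD[OF c] and fc = frame_chart_at[OF xu c]
  have zc: "snd c x \<in> snd c ` fst c" using cA by blast
  note TX = field_near_tangent[OF X] and TY = field_near_tangent[OF Y]
  note near = hlift_field_near[OF X xu] hlift_field_near[OF Y xu] vlift_field_near[OF X xu] vlift_field_near[OF Y xu]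
  note dH = hlift_field_has_derivative[OF X xu c] hlift_field_has_derivative[OF Y xu c]
  note dV = vlift_field_has_derivative[OF X xu c] vlift_field_has_derivative[OF Y xu c]
  \<comment> \<open>Vertical vectors have base component 0, so the derivatives along the base vanish
    on them.\<close>
  have X'0: "drep c X (snd c x) 0 = 0" and Y'0: "drep c Y (snd c x) 0 = 0"
    using linear_0 has_derivative_linear field_near_has_derivative[OF X c] field_near_has_derivative[OF Y c] by blast+
  have d0: "dchristoffel c (snd c x) 0 a b = 0" for a b
    by (rule linear_0[OF has_derivative_linear[OF dchristoffel_has_derivative[OF cA(1) zc]]])
  note l = linear_christoffel_left[OF cA(1) zc] linear_christoffel_right[OF cA(1) zc]
  note lsimps = linear_0[OF l(1)] linear_0[OF l(2)] linear_diff[OF l(1)] linear_neg[OF l(2)]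
  note br = lie_bracket_coords[OF c field_near_has_derivative[OF X c] field_near_has_derivative[OF Y c]]
  note R = curvature_tangent[OF TX TY frame_tangent[OF xu] c] curvature_coords[OF TX TY frame_tangent[OF xu] c]
  have sum: "(\<Sum>k\<in>UNIV. (0 :: real^'n, axis k (r k) :: (real^'n)^'n)) = (0, \<chi> k. r k)" for r :: "'n \<Rightarrow> real^'n"
    by (simp add: prod_eq_iff fst_sum snd_sum vec_eq_iff axis_def if_distrib cong: if_cong)
  show "lie_bracket FB (hor X) (hor Y) (x, u) =
      hlift A D (x, u) (lie_bracket A X Y x) - (\<Sum>k\<in>UNIV. vlift A k (x, u) (curvature A D x (X x) (Y x) (u k)))"
  proof (rule F.tangent_eqI[OF F.lie_bracket_tangent[OF near(1,2)] _ fc])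
    show "hlift A D (x, u) (lie_bracket A X Y x) - (\<Sum>k\<in>UNIV. vlift A k (x, u) (curvature A D x (X x) (Y x) (u k)))
        \<in> F.TM (x, u)"
      by (intro F.tangent_diff F.tangent_sum hlift_tangent vlift_tangent xu lie_bracket_tangent X Y R(1))
    show "coords (lie_bracket FB (hor X) (hor Y) (x, u)) (fchart c) =
      coords (hlift A D (x, u) (lie_bracket A X Y x) - (\<Sum>k\<in>UNIV. vlift A k (x, u) (curvature A D x (X x) (Y x) (u k))))
        (fchart c)"
      unfolding F.lie_bracket_coords[OF fc dH] lift_field_at F.coords_simps F.coords_sum
        hlift_coords[OF xu TX c] hlift_coords[OF xu TY c] hlift_coords[OF xu lie_bracket_tangent[OF X Y] c]
        vlift_coords[OF xu c] R(2) sum br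
      by (simp add: horizontal_rep_def vec_eq_iff curvature_rep_def lsimps)
  qed
  show "lie_bracket FB (hor X) (ver i Y) (x, u) = vlift A i (x, u) (D x (X x) Y)"
  proof (rule F.tangent_eqI[OF F.lie_bracket_tangent[OF near(1,4)] vlift_tangent[OF xu D_tangent[OF Y TX]] fc])
    show "coords (lie_bracket FB (hor X) (ver i Y) (x, u)) (fchart c) =
      coords (vlift A i (x, u) (D x (X x) Y)) (fchart c)"
      unfolding F.lie_bracket_coords[OF fc dH(1) dV(2)] lift_field_at
        hlift_coords[OF xu TX c] vlift_coords[OF xu c] D_coords[OF Y c TX]
      by (simp add: horizontal_rep_def vec_eq_iff axis_def lsimps X'0 d0)
  qed
  show "lie_bracket FB (ver i X) (ver j Y) (x, u) = 0"
  proof (rule F.tangent_eqI[OF F.lie_bracket_tangent[OF near(3,4)] F.tangent_0 fc])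
    show "coords (lie_bracket FB (ver i X) (ver j Y) (x, u)) (fchart c) = coords 0 (fchart c)"
      unfolding F.lie_bracket_coords[OF fc dV(1) dV(2)] lift_field_at vlift_coords[OF xu c]
      by (simp add: X'0 Y'0 prod_eq_iff vec_eq_iff axis_def)
  qed
qed

lemma lie_bracket_vh:
  assumes X: "near x X" and Y: "near x Y" and xu: "(x, u) \<in> LM"
  shows "lie_bracket FB (ver i X) (hor Y) (x, u) = - vlift A i (x, u) (D x (Y x) X)"
  unfolding F.lie_bracket_swap[OF vlift_field_near[OF X xu] hlift_field_near[OF Y xu]] lie_bracket_hv[OF Y X xu] ..

lemma frame_tangent_eqI:
  assumes xu: "(x, u) \<in> LM" and T: "\<xi> \<in> F.TM (x, u)" "\<eta> \<in> F.TM (x, u)"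
    and h: "\<And>a. a \<in> TM x \<Longrightarrow> G (x, u) \<xi> (hlift A D (x, u) a) = G (x, u) \<eta> (hlift A D (x, u) a)"
    and v: "\<And>k b. b \<in> TM x \<Longrightarrow> G (x, u) \<xi> (vlift A k (x, u) b) = G (x, u) \<eta> (vlift A k (x, u) b)"
  shows "\<xi> = \<eta>"
proof (rule F.nondegenerate[OF T])
  show p: "(x, u) \<in> carrier_of FB" using xu by (simp add: FB_carrier)
  fix \<theta> assume \<theta>: "\<theta> \<in> F.TM (x, u)"
  obtain c where c: "c \<in> charts x" by (rule frame_chartE[OF xu])
  let ?a = "coord_field c (fst (coords \<theta> (fchart c))) x"
  \<comment> \<open>The \<open>christoffel\<close> summand compensates the frame part of the
    horizontal lift of \<open>?a\<close>.\<close>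
  let ?b = "\<lambda>k. coord_field c (snd (coords \<theta> (fchart c)) $ k
     + christoffel c (snd c x) (fst (coords \<theta> (fchart c))) (coords (u k) c)) x"
  note Ta = hlift_tangent[OF xu coord_field_tangent] and Tb = vlift_tangent[OF xu coord_field_tangent]
  have eq: "\<theta> = hlift A D (x, u) ?a + (\<Sum>k\<in>UNIV. vlift A k (x, u) (?b k))"
  proof (rule F.tangent_eqI[OF \<theta> _ frame_chart_at[OF xu c]])
    show "hlift A D (x, u) ?a + (\<Sum>k\<in>UNIV. vlift A k (x, u) (?b k)) \<in> F.TM (x, u)"
      by (intro F.tangent_add F.tangent_sum Ta Tb)
    show "coords \<theta> (fchart c) = coords (hlift A D (x, u) ?a + (\<Sum>k\<in>UNIV. vlift A k (x, u) (?b k))) (fchart c)"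
      unfolding F.coords_simps F.coords_sum hlift_coords[OF xu coord_field_tangent c] vlift_coords[OF xu c]
      by (simp add: c horizontal_rep_def prod_eq_iff fst_sum snd_sum vec_eq_iff axis_def if_distrib cong: if_cong)
  qed
  have exp: "G (x, u) \<zeta> \<theta> = G (x, u) \<zeta> (hlift A D (x, u) ?a) + (\<Sum>k\<in>UNIV. G (x, u) \<zeta> (vlift A k (x, u) (?b k)))"
    if \<zeta>: "\<zeta> \<in> F.TM (x, u)" for \<zeta>
  proof -
    have s: "(\<Sum>k\<in>UNIV. vlift A k (x, u) (?b k)) \<in> F.TM (x, u)" by (intro F.tangent_sum Tb)
    show ?thesis
      unfolding F.g_sym[OF \<zeta> \<theta> p] F.g_sym[OF \<zeta> Ta p] F.g_sym[OF \<zeta> Tb p]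
      by (subst eq) (simp only: F.g_left(1)[OF Ta s \<zeta> p] F.g_sum_left[OF Tb \<zeta> p])
  qed
  show "G (x, u) \<xi> \<theta> = G (x, u) \<eta> \<theta>"
    unfolding exp[OF T(1)] exp[OF T(2)] by (simp add: h v coord_field_tangent)
qed

end

section \<open>The Levi-Civita connection of the frame bundle\<close>

locale frame_natural = frame_metric A g D G DL
  for A :: "('m, real^'n::finite) atlas" and g :: "('m, real^'n) metric_tensor" and D :: "('m, real^'n) connection"
    and G :: "(('m, 'n) frame, 'n frame_model) metric_tensor" and DL :: "(('m, 'n) frame, 'n frame_model) connection" +
  fixes \<alpha> \<beta> :: "real \<Rightarrow> real"
  assumes natural: "frame_bundle_metric A g D \<alpha> \<beta> G"
    and smooth_\<alpha>: "smooth_on {0..} \<alpha>" and smooth_\<beta>: "smooth_on {0..} \<beta>"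
    and positive: "\<forall>t\<ge>0. \<alpha> t > 0 \<and> \<alpha> t + t * \<beta> t > 0"
begin

definition fibre_metric :: "'m \<Rightarrow> ('m, real^'n) tvec \<Rightarrow> ('m, real^'n) tvec \<Rightarrow> ('m, real^'n) tvec \<Rightarrow> real" where
  "fibre_metric x e a b = \<alpha> (g x e e) * g x a b + \<beta> (g x e e) * g x a e * g x b e"

abbreviation \<alpha>' :: "real \<Rightarrow> real" where "\<alpha>' t \<equiv> vector_derivative \<alpha> (at t within {0..})"
abbreviation \<beta>' :: "real \<Rightarrow> real" where "\<beta>' t \<equiv> vector_derivative \<beta> (at t within {0..})"

text \<open>At an interior point the derivative within the half line is the ordinary one. It is
  applied at squared norms of frame vectors, which are positive.\<close>

lemma half_line_derivative:
  assumes "smooth_on {0..} f" "t > 0"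
  shows "(f has_field_derivative vector_derivative f (at t within {0..})) (at t)"
proof -
  have "t \<in> interior {0..}" using assms(2) by simp
  then have at: "at t within {0..} = at t" by (rule at_within_interior)
  have "k_smooth_on (Suc 0) {0..} f" using assms(1) unfolding smooth_on_def by blast
  then have "f differentiable (at t within {0..})" using assms(2) by simp
  then have "f differentiable (at t)" by (simp only: at)
  then show ?thesis
    unfolding at by (simp add: vector_derivative_works has_real_derivative_iff_has_vector_derivative)
qed

section \<open>Inner products of lifts and their derivatives\<close>

lemma G_lifts:
  assumes xu: "(x, u) \<in> LM" and a: "a \<in> TM x" and b: "b \<in> TM x"
  shows "G (x, u) (hlift A D (x, u) a) (hlift A D (x, u) b) = g x a b"
    and "G (x, u) (hlift A D (x, u) a) (vlift A i (x, u) b) = 0"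
    and "G (x, u) (vlift A i (x, u) b) (hlift A D (x, u) a) = 0"
    and "G (x, u) (vlift A i (x, u) a) (vlift A j (x, u) b) = (if i = j then fibre_metric x (u i) a b else 0)"
proof -
  note * = natural[unfolded frame_bundle_metric_def, THEN conjunct2, THEN bspec, OF xu, unfolded prod.case,
      THEN bspec, OF a, THEN bspec, OF b]
  show "G (x, u) (hlift A D (x, u) a) (hlift A D (x, u) b) = g x a b"
    and hv: "G (x, u) (hlift A D (x, u) a) (vlift A i (x, u) b) = 0"
    and "G (x, u) (vlift A i (x, u) a) (vlift A j (x, u) b) = (if i = j then fibre_metric x (u i) a b else 0)"
    using * by (auto simp: fibre_metric_def)
  show "G (x, u) (vlift A i (x, u) b) (hlift A D (x, u) a) = 0"
    using hv F.g_sym[OF vlift_tangent[OF xu b] hlift_tangent[OF xu a]] xu by (simp add: FB_carrier)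
qed

lemma fibre_metric_sym:
  assumes "a \<in> TM x" "b \<in> TM x" "x \<in> carrier_of A"
  shows "fibre_metric x e a b = fibre_metric x e b a"
  using g_sym[OF assms] by (simp add: fibre_metric_def)

lemma D_zero: "near x Y \<Longrightarrow> D x 0 Y = 0"
  using D_linear[OF _ tangent_0 tangent_0, of x Y 0 0] by simp

lemma dir_deriv_frame:
  assumes xu: "(x, u) \<in> LM" and \<xi>: "\<xi> \<in> F.TM (x, u)" and c: "c \<in> charts x"
    and W: "open_in W" "x \<in> W"
    and eq: "\<And>y u. (y, u) \<in> LM \<Longrightarrow> y \<in> W \<Longrightarrow> c \<in> charts y \<Longrightarrow> \<phi> (snd c y, frame_coords c u) = f (y, u)"
    and \<phi>: "(\<phi> has_derivative \<phi>') (at (snd c x, frame_coords c u))"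
  shows "dir_deriv FB (x, u) \<xi> f = \<phi>' (coords \<xi> (fchart c))"
proof (rule F.dir_deriv_chart[OF frame_chart_at[OF xu c] \<xi>])
  note cA = charts_atD[OF c]
  let ?S = "(snd c ` (W \<inter> fst c)) \<times> GL"
  have wS: "(snd c x, frame_coords c u) \<in> ?S" using frame_coords_GL[OF xu c] cA W(2) by auto
  have "\<phi> w = (f \<circ> chart_inv (fchart c)) w" if w: "w \<in> ?S" for w
  proof -
    obtain y u where yu: "chart_inv (fchart c) w = (y, u)" "chart_inv c (fst w) = y" "(y, u) \<in> LM" "y \<in> W"
      "c \<in> charts y" "fst w = snd c y" "snd w = frame_coords c u"
      by (rule frame_chart_invE[OF cA(1) w])
    have "w = (snd c y, frame_coords c u)" using yu(6,7) by (simp add: prod_eq_iff)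
    then show ?thesis using eq[OF yu(3,4,5)] yu(1) by simp
  qed
  from has_derivative_transform_within_open[OF \<phi> open_frame_domain[OF W(1) cA(1)] wS this]
  show "((f \<circ> chart_inv (fchart c)) has_derivative \<phi>') (at (snd (fchart c) (x, u)))"
    unfolding frame_chart_map .
qed

lemma local_rep_at: "c \<in> charts y \<Longrightarrow> rep c Y (snd c y) = coords (Y y) c"
  by (simp add: chart_inv_chart charts_atD)

text \<open>\<open>P\<close> and \<open>Q\<close> stand for the coordinates of a base field or for a
  row of the frame. The vectors \<open>p'\<close> and \<open>q'\<close> are their covariant
  derivatives along \<open>h\<close>: for a field that along \<open>v\<close>, for a row the
  vertical part of \<open>h\<close> in its slot.\<close>

lemma gram_lift_derivative:
  assumes c: "c \<in> charts x" and h: "fst h = coords v c" and v: "v \<in> TM x"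
    and P: "((\<lambda>w :: 'n frame_model. P w) has_derivative P') (at (snd c x, U))"
    and Q: "((\<lambda>w. Q w) has_derivative Q') (at (snd c x, U))"
    and p: "p \<in> TM x" "P (snd c x, U) = coords p c"
      "p' \<in> TM x" "P' h + christoffel c (snd c x) (coords v c) (coords p c) = coords p' c"
    and q: "q \<in> TM x" "Q (snd c x, U) = coords q c"
      "q' \<in> TM x" "Q' h + christoffel c (snd c x) (coords v c) (coords q c) = coords q' c"
  obtains m' where "((\<lambda>w. gram c (fst w) (P w) (Q w)) has_derivative m') (at (snd c x, U))"
    "m' h = g x p' q + g x p q'"
proof
  note cA = charts_atD[OF c]
  let ?m' = "\<lambda>h. gram c (snd c x) (P' h + christoffel c (snd c x) (fst h) (P (snd c x, U))) (Q (snd c x, U))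
     + gram c (snd c x) (P (snd c x, U)) (Q' h + christoffel c (snd c x) (fst h) (Q (snd c x, U)))"
  have "fst (snd c x, U) \<in> snd c ` fst c" using cA by simp
  from gram_has_derivative[OF cA(1) this bounded_linear_imp_has_derivative[OF bounded_linear_fst] P Q]
  show "((\<lambda>w. gram c (fst w) (P w) (Q w)) has_derivative ?m') (at (snd c x, U))" by simp
  show "?m' h = g x p' q + g x p q'"
    unfolding h p(2) q(2) p(4) q(4) using gram_at[OF c p(3) q(1)] gram_at[OF c p(1) q(3)] by simp
qed

lemma local_rep_lift_derivative:
  assumes Y: "near x Y" and c: "c \<in> charts x" and v: "v \<in> TM x"
  obtains Y' where "((\<lambda>w :: 'n frame_model. rep c Y (fst w)) has_derivative Y') (at (snd c x, U))"
    "\<And>h. fst h = coords v c \<Longrightarrow> Y' h + christoffel c (snd c x) (coords v c) (coords (Y x) c) = coords (D x v Y) c"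
proof
  let ?Y' = "drep c Y (snd c x)"
  have "(rep c Y has_derivative ?Y') (at (fst (snd c x, U)))" using field_near_has_derivative[OF Y c] by simp
  from diff_chain_at[OF bounded_linear_imp_has_derivative[OF bounded_linear_fst] this]
  show "((\<lambda>w :: 'n frame_model. rep c Y (fst w)) has_derivative (\<lambda>h. ?Y' (fst h))) (at (snd c x, U))"
    by (simp add: o_def)
  show "?Y' (fst h) + christoffel c (snd c x) (coords v c) (coords (Y x) c) = coords (D x v Y) c"
    if "fst h = coords v c" for h :: "'n frame_model"
    unfolding D_coords[OF Y c v] that ..
qed

text \<open>The inner product of horizontal lifts is a function pulled back from the base, so only
  the base component \<open>v\<close> of \<open>\<xi>\<close> counts.\<close>

lemma dir_deriv_hh:
  assumes xu: "(x, u) \<in> LM" and \<xi>: "\<xi> \<in> F.TM (x, u)" and c: "c \<in> charts x"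
    and Y: "near x Y" and Z: "near x Z"
    and v: "v \<in> TM x" "fst (coords \<xi> (fchart c)) = coords v c"
  shows "dir_deriv FB (x, u) \<xi> (\<lambda>q. G q (hor Y q) (hor Z q)) =
    g x (D x v Y) (Z x) + g x (Y x) (D x v Z)"
proof -
  obtain W where W: "open_in W" "x \<in> W" "vf_on W Y" "vf_on W Z"
    by (rule field_nearE2[OF Y Z c])
  let ?w = "(snd c x, frame_coords c u)" and ?h = "coords \<xi> (fchart c)"
  note T = field_near_tangent[OF Y] field_near_tangent[OF Z]
  obtain Y' where Y': "((\<lambda>w. rep c Y (fst w)) has_derivative Y') (at ?w)"
    "Y' ?h + christoffel c (snd c x) (coords v c) (coords (Y x) c) = coords (D x v Y) c"
    using local_rep_lift_derivative[OF Y c v(1)] v(2) by metis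
  obtain Z' where Z': "((\<lambda>w. rep c Z (fst w)) has_derivative Z') (at ?w)"
    "Z' ?h + christoffel c (snd c x) (coords v c) (coords (Z x) c) = coords (D x v Z) c"
    using local_rep_lift_derivative[OF Z c v(1)] v(2) by metis
  obtain m' where m': "((\<lambda>w. gram c (fst w) (rep c Y (fst w)) (rep c Z (fst w))) has_derivative m') (at ?w)"
    "m' ?h = g x (D x v Y) (Z x) + g x (Y x) (D x v Z)"
    by (rule gram_lift_derivative[OF c v(2,1) Y'(1) Z'(1) T(1) _ D_tangent[OF Y v(1)] Y'(2)
          T(2) _ D_tangent[OF Z v(1)] Z'(2)]) (simp_all add: local_rep_at[OF c])
  have eq: "gram c (fst (snd c y, frame_coords c u)) (rep c Y (fst (snd c y, frame_coords c u)))
      (rep c Z (fst (snd c y, frame_coords c u))) = G (y, u) (hor Y (y, u)) (hor Z (y, u))"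
    if yu: "(y, u) \<in> LM" "y \<in> W" "c \<in> charts y" for y u
  proof -
    have t: "Y y \<in> TM y" "Z y \<in> TM y" using W(3,4) yu(2) by (auto simp: vector_field_on_def)
    show ?thesis unfolding fst_conv local_rep_at[OF yu(3)] gram_at[OF yu(3) t] lift_field_at G_lifts(1)[OF yu(1) t] ..
  qed
  have "dir_deriv FB (x, u) \<xi> (\<lambda>q. G q (hor Y q) (hor Z q)) = m' ?h"
    by (rule dir_deriv_frame[OF xu \<xi> c W(1,2) eq m'(1)])
  then show ?thesis unfolding m'(2) .
qed

text \<open>\<open>b\<close> is the vertical part of \<open>\<xi>\<close> in slot \<open>i\<close>,
  the covariant change of u_i along \<open>\<xi>\<close>. Hence |u_i|^2 changes at the rate 2 g(b,
  u_i), which brings in \<alpha>' and \<beta>'; the other terms come from the product rule.\<close>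

lemma dir_deriv_vv:
  assumes xu: "(x, u) \<in> LM" and \<xi>: "\<xi> \<in> F.TM (x, u)" and c: "c \<in> charts x"
    and Y: "near x Y" and Z: "near x Z"
    and v: "v \<in> TM x" "fst (coords \<xi> (fchart c)) = coords v c"
    and b: "b \<in> TM x" "snd (coords \<xi> (fchart c)) $ i
      + christoffel c (snd c x) (coords v c) (coords (u i) c) = coords b c"
  defines "t \<equiv> g x (u i) (u i)"
  shows "dir_deriv FB (x, u) \<xi> (\<lambda>q. G q (ver i Y q) (ver i Z q)) =
    fibre_metric x (u i) (D x v Y) (Z x) + fibre_metric x (u i) (Y x) (D x v Z)
    + 2 * g x b (u i) * (\<alpha>' t * g x (Y x) (Z x) + \<beta>' t * g x (Y x) (u i) * g x (Z x) (u i))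
    + \<beta> t * (g x (Y x) b * g x (Z x) (u i) + g x (Y x) (u i) * g x (Z x) b)"
proof -
  obtain W where W: "open_in W" "x \<in> W" "vf_on W Y" "vf_on W Z"
    by (rule field_nearE2[OF Y Z c])
  let ?w = "(snd c x, frame_coords c u)" and ?h = "coords \<xi> (fchart c)"
  note T = field_near_tangent[OF Y] field_near_tangent[OF Z] frame_tangent[OF xu, of i]
  have x: "x \<in> carrier_of A" by (rule frame_carrier[OF xu])
  \<comment> \<open>A basis vector is nonzero, so \<open>t\<close> is interior to the half line and
    \<alpha>, \<beta> have ordinary derivatives there.\<close>
  have "u i \<noteq> 0"
  proof
    assume "u i = 0"
    then have "0 \<in> range u" by (metis rangeI)
    then show False using xu dependent_zero by (auto simp: frame_bundle_def)
  qed
  then have t: "t > 0" unfolding t_def using g_pos[OF T(3) x] by simp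
  obtain Y' where Y': "((\<lambda>w. rep c Y (fst w)) has_derivative Y') (at ?w)"
    "Y' ?h + christoffel c (snd c x) (coords v c) (coords (Y x) c) = coords (D x v Y) c"
    using local_rep_lift_derivative[OF Y c v(1)] v(2) by metis
  obtain Z' where Z': "((\<lambda>w. rep c Z (fst w)) has_derivative Z') (at ?w)"
    "Z' ?h + christoffel c (snd c x) (coords v c) (coords (Z x) c) = coords (D x v Z) c"
    using local_rep_lift_derivative[OF Z c v(1)] v(2) by metis
  have e': "((\<lambda>w. snd w $ i) has_derivative (\<lambda>h. snd h $ i)) (at ?w)"
    by (rule bounded_linear_imp_has_derivative[OF bounded_linear_compose[OF bounded_linear_vec_nth bounded_linear_snd]])
  let ?yz = "\<lambda>w. gram c (fst w) (rep c Y (fst w)) (rep c Z (fst w))"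
    and ?ye = "\<lambda>w. gram c (fst w) (rep c Y (fst w)) (snd w $ i)"
    and ?ze = "\<lambda>w. gram c (fst w) (rep c Z (fst w)) (snd w $ i)"
    and ?ee = "\<lambda>w. gram c (fst w) (snd w $ i) (snd w $ i)"
  obtain yz where yz: "(?yz has_derivative yz) (at ?w)" "yz ?h = g x (D x v Y) (Z x) + g x (Y x) (D x v Z)"
    by (rule gram_lift_derivative[OF c v(2,1) Y'(1) Z'(1) T(1) _ D_tangent[OF Y v(1)] Y'(2)
          T(2) _ D_tangent[OF Z v(1)] Z'(2)]) (simp_all add: local_rep_at[OF c])
  obtain ye where ye: "(?ye has_derivative ye) (at ?w)" "ye ?h = g x (D x v Y) (u i) + g x (Y x) b"
    by (rule gram_lift_derivative[OF c v(2,1) Y'(1) e' T(1) _ D_tangent[OF Y v(1)] Y'(2)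
          T(3) _ b]) (simp_all add: local_rep_at[OF c])
  obtain ze where ze: "(?ze has_derivative ze) (at ?w)" "ze ?h = g x (D x v Z) (u i) + g x (Z x) b"
    by (rule gram_lift_derivative[OF c v(2,1) Z'(1) e' T(2) _ D_tangent[OF Z v(1)] Z'(2)
          T(3) _ b]) (simp_all add: local_rep_at[OF c])
  obtain ee where ee: "(?ee has_derivative ee) (at ?w)" "ee ?h = g x b (u i) + g x (u i) b"
    by (rule gram_lift_derivative[OF c v(2,1) e' e' T(3) _ b T(3) _ b]) simp_all
  have val: "?yz ?w = g x (Y x) (Z x)" "?ye ?w = g x (Y x) (u i)" "?ze ?w = g x (Z x) (u i)" "?ee ?w = t"
    using gram_at[OF c] T by (simp_all add: local_rep_at[OF c] t_def)
  have d\<alpha>: "((\<lambda>w. \<alpha> (?ee w)) has_derivative (\<lambda>h. ee h * \<alpha>' t)) (at ?w)"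
    by (rule DERIV_compose_FDERIV[OF _ ee(1)]) (unfold val(4), rule half_line_derivative[OF smooth_\<alpha> t])
  have d\<beta>: "((\<lambda>w. \<beta> (?ee w)) has_derivative (\<lambda>h. ee h * \<beta>' t)) (at ?w)"
    by (rule DERIV_compose_FDERIV[OF _ ee(1)]) (unfold val(4), rule half_line_derivative[OF smooth_\<beta> t])
  let ?\<phi> = "\<lambda>w. \<alpha> (?ee w) * ?yz w + \<beta> (?ee w) * ?ye w * ?ze w"
  note d = has_derivative_add[OF has_derivative_mult[OF d\<alpha> yz(1)]
      has_derivative_mult[OF has_derivative_mult[OF d\<beta> ye(1)] ze(1)], unfolded val]
  have eq: "?\<phi> (snd c y, frame_coords c u) = G (y, u) (ver i Y (y, u)) (ver i Z (y, u))"
    if yu: "(y, u) \<in> LM" "y \<in> W" "c \<in> charts y" for y u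
  proof -
    have s: "Y y \<in> TM y" "Z y \<in> TM y" "u i \<in> TM y"
      using W(3,4) yu(2) frame_tangent[OF yu(1)] by (auto simp: vector_field_on_def)
    show ?thesis
      unfolding fst_conv snd_conv vec_lambda_beta local_rep_at[OF yu(3)] gram_at[OF yu(3) s(1,2)] gram_at[OF yu(3) s(1,3)]
        gram_at[OF yu(3) s(2,3)] gram_at[OF yu(3) s(3,3)] lift_field_at G_lifts(4)[OF yu(1) s(1,2)]
      by (simp add: fibre_metric_def)
  qed
  have "dir_deriv FB (x, u) \<xi> (\<lambda>q. G q (ver i Y q) (ver i Z q)) =
      \<alpha> t * yz ?h + ee ?h * \<alpha>' t * g x (Y x) (Z x)
      + (\<beta> t * g x (Y x) (u i) * ze ?h + (\<beta> t * ye ?h + ee ?h * \<beta>' t * g x (Y x) (u i)) * g x (Z x) (u i))"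
    by (rule dir_deriv_frame[where \<phi> = ?\<phi>, OF xu \<xi> c W(1,2) eq d])
  then show ?thesis
    unfolding yz(2) ye(2) ze(2) ee(2) fibre_metric_def t_def[symmetric]
      g_sym[OF T(3) b(1) x] by (simp add: algebra_simps)
qed

context
  fixes x u
  assumes xu: "(x, u) \<in> LM"
begin

lemma x_in: "x \<in> carrier_of A" and xu_in: "(x, u) \<in> carrier_of FB"
  using xu by (simp_all add: FB_carrier frame_carrier)

abbreviation "T \<equiv> F.TM (x, u)"
abbreviation "H \<equiv> hlift A D (x, u)"
abbreviation "V i \<equiv> vlift A i (x, u)"
abbreviation "R \<equiv> curvature A D x"
abbreviation "ip \<equiv> G (x, u)"
abbreviation "dir \<equiv> dir_deriv FB (x, u)"
abbreviation "pair \<Xi> \<Psi> \<equiv> \<lambda>q. G q (\<Xi> q) (\<Psi> q)"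
abbreviation "fib i \<equiv> fibre_metric x (u i)"
abbreviation "bracket \<Xi> \<Psi> \<equiv> lie_bracket FB \<Xi> \<Psi> (x, u)"

lemma dir_deriv_h_hh:
  assumes "near x Y" "near x Z" "a \<in> TM x"
  shows "dir (H a) (pair (hor Y) (hor Z)) =
    g x (D x a Y) (Z x) + g x (Y x) (D x a Z)"
proof -
  obtain c where c: "c \<in> charts x" by (rule frame_chartE[OF xu])
  show ?thesis
    by (rule dir_deriv_hh[OF xu hlift_tangent[OF xu assms(3)] c assms])
       (simp add: hlift_coords[OF xu assms(3) c] horizontal_rep_def)
qed

text \<open>Along a fibre the base component is 0, and the covariant derivative in direction 0
  vanishes.\<close>

lemma dir_deriv_v_hh:
  assumes "near x Y" "near x Z" "a \<in> TM x"
  shows "dir (V i a) (pair (hor Y) (hor Z)) = 0"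
proof -
  obtain c where c: "c \<in> charts x" by (rule frame_chartE[OF xu])
  have "dir (V i a) (pair (hor Y) (hor Z)) =
    g x (D x 0 Y) (Z x) + g x (Y x) (D x 0 Z)"
    by (rule dir_deriv_hh[OF xu vlift_tangent[OF xu assms(3)] c assms(1,2) tangent_0])
       (simp add: vlift_coords[OF xu c])
  then show ?thesis
    using D_zero assms field_near_tangent g_zero x_in by simp
qed

text \<open>Along a horizontal lift u_i is parallel: its covariant change is 0, and no derivative of
  \<alpha> or \<beta> appears.\<close>

lemma dir_deriv_h_vv:
  assumes "near x Y" "near x Z" "a \<in> TM x"
  shows "dir (H a) (pair (ver i Y) (ver i Z)) =
    fib i (D x a Y) (Z x) + fib i (Y x) (D x a Z)"
proof -
  obtain c where c: "c \<in> charts x" by (rule frame_chartE[OF xu])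
  note z = g_zero[OF _ x_in]
  show ?thesis
    by (subst dir_deriv_vv[OF xu hlift_tangent[OF xu assms(3)] c assms _ tangent_0, where i = i])
       (simp_all add: hlift_coords[OF xu assms(3) c] horizontal_rep_def tangent_0 z field_near_tangent assms frame_tangent[OF xu])
qed

lemma dir_deriv_v_vv:
  fixes i :: 'n
  assumes "near x Y" "near x Z" "a \<in> TM x"
  defines "t \<equiv> g x (u i) (u i)"
  shows "dir (V k a) (pair (ver i Y) (ver i Z)) =
    (if k = i then 2 * g x a (u i) * (\<alpha>' t * g x (Y x) (Z x) + \<beta>' t * g x (Y x) (u i) * g x (Z x) (u i))
      + \<beta> t * (g x (Y x) a * g x (Z x) (u i) + g x (Y x) (u i) * g x (Z x) a) else 0)"
proof -
  obtain c where c: "c \<in> charts x" by (rule frame_chartE[OF xu])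
  note cA = charts_atD[OF c]
  note z = g_zero[OF _ x_in]
  have \<Gamma>0: "christoffel c (snd c x) 0 w = 0" for w
    using linear_0[OF linear_christoffel_left[OF cA(1)]] cA(2) by simp
  \<comment> \<open>The base component is 0, and the vertical part in slot \<open>i\<close> is
    \<open>a\<close> if that slot is the moving one and 0 otherwise.\<close>
  show ?thesis
    using assms(3)
    by (subst dir_deriv_vv[OF xu vlift_tangent[OF xu assms(3)] c assms(1,2) tangent_0, where b = "if k = i then a else 0" and i = i])
       (auto simp: vlift_coords[OF xu c] tangent_0 z field_near_tangent assms(1,2) frame_tangent[OF xu] axis_def \<Gamma>0
          t_def D_zero fibre_metric_def)
qed

text \<open>On all frames over a neighbourhood of \<open>x\<close> these inner products are
  identically 0.\<close>

lemma dir_deriv_vanishing: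
  assumes Y: "near x Y" and Z: "near x Z" and \<xi>: "\<xi> \<in> T"
  shows "dir \<xi> (pair (hor Y) (ver i Z)) = 0"
    and "dir \<xi> (pair (ver i Y) (hor Z)) = 0"
    and "i \<noteq> j \<Longrightarrow> dir \<xi> (pair (ver i Y) (ver j Z)) = 0"
proof -
  obtain c where c: "c \<in> charts x" by (rule frame_chartE[OF xu])
  obtain W where W: "open_in W" "x \<in> W" "W \<subseteq> fst c" "vf_on W Y" "vf_on W Z"
    by (rule field_nearE2[OF Y Z c])
  have o: "F.open_in (frames_over W)" by (rule openin_frames_over[OF W(1) charts_atD(1)[OF c] W(3)])
  have m: "(x, u) \<in> frames_over W" using xu W(2) by simp
  have T: "Y q \<in> TM q" "Z q \<in> TM q" if "q \<in> W" for q
    using W(4,5) that by (auto simp: vector_field_on_def)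
  show "dir \<xi> (pair (hor Y) (ver i Z)) = 0"
    by (rule F.dir_deriv_locally_const[OF o m \<xi>, where r = 0]) (use T in \<open>auto simp: G_lifts\<close>)
  show "dir \<xi> (pair (ver i Y) (hor Z)) = 0"
    by (rule F.dir_deriv_locally_const[OF o m \<xi>, where r = 0]) (use T in \<open>auto simp: G_lifts\<close>)
  show "dir \<xi> (pair (ver i Y) (ver j Z)) = 0" if "i \<noteq> j"
    by (rule F.dir_deriv_locally_const[OF o m \<xi>, where r = 0]) (use T that in \<open>auto simp: G_lifts\<close>)
qed

text \<open>Inner products are tested against vectors, while Koszul's formula takes fields;
  derivatives of the extension cancel in the results.\<close>

lemma extend_to_field:
  assumes "a \<in> TM x"
  obtains Z where "near x Z" "Z x = a"
proof -
  obtain c where c: "c \<in> charts x" by (rule frame_chartE[OF xu])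
  show thesis by (rule that[OF coord_field_near[OF c] coord_field_eqI[OF c assms]])
qed

section \<open>Koszul's formula for the lifts\<close>

lemma G_lie_bracket_hh:
  assumes X: "near x X" and Y: "near x Y" and a: "a \<in> TM x"
  shows "ip (bracket (hor X) (hor Y)) (H a) = g x (lie_bracket A X Y x) a"
    and "ip (bracket (hor X) (hor Y)) (V i a) =
      - fib i (R (X x) (Y x) (u i)) a"
proof -
  obtain c where c: "c \<in> charts x" by (rule frame_chartE[OF xu])
  note R = curvature_tangent[OF field_near_tangent[OF X] field_near_tangent[OF Y] frame_tangent[OF xu] c]
  note br = lie_bracket_tangent[OF X Y]
  note VR = vlift_tangent[OF xu R] and HB = hlift_tangent[OF xu br] and Ha = hlift_tangent[OF xu a] and Va = vlift_tangent[OF xu a]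
  note S = F.tangent_sum[OF VR]
  show "ip (bracket (hor X) (hor Y)) (H a) = g x (lie_bracket A X Y x) a"
    unfolding lie_bracket_hh[OF X Y xu] F.g_left(2)[OF HB S Ha xu_in] F.g_sum_left[OF VR Ha xu_in]
    by (simp add: G_lifts[OF xu] br a R)
  show "ip (bracket (hor X) (hor Y)) (V i a) =
      - fib i (R (X x) (Y x) (u i)) a"
    unfolding lie_bracket_hh[OF X Y xu] F.g_left(2)[OF HB S Va xu_in] F.g_sum_left[OF VR Va xu_in]
    by (simp add: G_lifts[OF xu] br a R)
qed

lemma G_lie_bracket_vh:
  assumes X: "near x X" and Y: "near x Y" and a: "a \<in> TM x"
  shows "ip (bracket (ver i X) (hor Y)) (H a) = 0"
    and "ip (bracket (ver i X) (hor Y)) (V j a) =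
      (if i = j then - fib i (D x (Y x) X) a else 0)"
proof -
  note T = D_tangent[OF X field_near_tangent[OF Y]]
  note m = F.g_minus_left[OF vlift_tangent[OF xu T] _ xu_in]
  show "ip (bracket (ver i X) (hor Y)) (H a) = 0"
    unfolding lie_bracket_vh[OF X Y xu] m[OF hlift_tangent[OF xu a]] by (simp add: G_lifts[OF xu] a T)
  show "ip (bracket (ver i X) (hor Y)) (V j a) =
      (if i = j then - fib i (D x (Y x) X) a else 0)"
    unfolding lie_bracket_vh[OF X Y xu] m[OF vlift_tangent[OF xu a]] by (simp add: G_lifts[OF xu] a T)
qed

text \<open>Against a horizontal lift, every term of Koszul's formula is the corresponding term on
  the base and yields the covariant derivative there. Against vertical lifts only the vertical part
  of [X^h, Y^h] survives, and the factor 2 on the left halves it.\<close>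

lemma connection_hh:
  assumes X: "near x X" and Y: "near x Y"
  shows "DL (x, u) (H (X x)) (hor Y) =
    H (D x (X x) Y) - (1/2) *\<^sub>R (\<Sum>k\<in>UNIV. V k (R (X x) (Y x) (u k)))"
proof -
  obtain c where c: "c \<in> charts x" by (rule frame_chartE[OF xu])
  note TX = field_near_tangent[OF X] and TY = field_near_tangent[OF Y]
  note R = curvature_tangent[OF TX TY frame_tangent[OF xu] c]
  note DXY = D_tangent[OF Y TX]
  note nX = hlift_field_near[OF X xu] and nY = hlift_field_near[OF Y xu]
  note VR = vlift_tangent[OF xu R] and HD = hlift_tangent[OF xu DXY]
  note S = F.tangent_sum[OF VR]
  note S2 = F.tangent_scale[OF S, of "1/2"]
  let ?\<xi> = "DL (x, u) (H (X x)) (hor Y)"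
  let ?\<eta> = "H (D x (X x) Y) - (1/2) *\<^sub>R (\<Sum>k\<in>UNIV. V k (R (X x) (Y x) (u k)))"
  show ?thesis
  proof (rule frame_tangent_eqI[OF xu])
    show "?\<xi> \<in> T" by (rule F.D_tangent[OF nY hlift_tangent[OF xu TX]])
    show "?\<eta> \<in> T" by (rule F.tangent_diff[OF HD S2])
  next
    fix a assume a: "a \<in> TM x"
    obtain Z where Z: "near x Z" "Z x = a" by (rule extend_to_field[OF a])
    note nZ = hlift_field_near[OF Z(1) xu] and TZ = field_near_tangent[OF Z(1)] and Ha = hlift_tangent[OF xu a]
    have "2 * ip ?\<xi> (H a) = 2 * g x (D x (X x) Y) a"
      using F.koszul[OF nX nY nZ] unfolding lift_field_at Z(2) dir_deriv_h_hh[OF Y Z(1) TX] dir_deriv_h_hh[OF X Z(1) TY]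
        dir_deriv_h_hh[OF X Y a] G_lie_bracket_hh(1)[OF X Y a] G_lie_bracket_hh(1)[OF X Z(1) TY]
        G_lie_bracket_hh(1)[OF Y Z(1) TX] torsion_freeD[OF X Y] torsion_freeD[OF X Z(1)] torsion_freeD[OF Y Z(1)]
      by (simp add: g_left(2) D_tangent X Y Z TX TY a x_in g_sym[OF TX _ x_in] g_sym[OF TY _ x_in])
    moreover have "ip ?\<eta> (H a) = g x (D x (X x) Y) a"
      unfolding F.g_left(2)[OF HD S2 Ha xu_in] F.g_left(3)[OF S S Ha xu_in] F.g_sum_left[OF VR Ha xu_in]
      by (simp add: G_lifts[OF xu] DXY a R)
    ultimately show "ip ?\<xi> (H a) = ip ?\<eta> (H a)" by simp
  next
    fix k b assume b: "b \<in> TM x"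
    obtain Z where Z: "near x Z" "Z x = b" by (rule extend_to_field[OF b])
    note nZ = vlift_field_near[OF Z(1) xu] and Vb = vlift_tangent[OF xu b]
    \<comment> \<open>The brackets of X^h and Y^h with the vertical lift of \<open>Z\<close> are
      vertical, hence orthogonal to the other horizontal field.\<close>
    have "2 * ip ?\<xi> (V k b) = - fib k (R (X x) (Y x) (u k)) b"
      using F.koszul[OF nX nY nZ] unfolding lift_field_at Z(2) dir_deriv_vanishing(1)[OF Y Z(1) hlift_tangent[OF xu TX]]
        dir_deriv_vanishing(1)[OF X Z(1) hlift_tangent[OF xu TY]] dir_deriv_v_hh[OF X Y b] G_lie_bracket_hh(2)[OF X Y b]
        lie_bracket_hv[OF X Z(1) xu] lie_bracket_hv[OF Y Z(1) xu]
      by (simp add: G_lifts[OF xu] D_tangent X Y Z TX TY)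
    moreover have "ip ?\<eta> (V k b) = - (1/2) * fib k (R (X x) (Y x) (u k)) b"
      unfolding F.g_left(2)[OF HD S2 Vb xu_in] F.g_left(3)[OF S S Vb xu_in] F.g_sum_left[OF VR Vb xu_in]
      by (simp add: G_lifts[OF xu] DXY b R)
    ultimately show "ip ?\<xi> (V k b) = ip ?\<eta> (V k b)" by simp
  qed
qed

text \<open>Skewness gives g(R(a, b) u_i, u_i) = 0, which removes the \<beta> term; pair symmetry
  moves u_i and w to the first two places.\<close>

lemma fibre_metric_curvature:
  assumes a: "a \<in> TM x" and b: "b \<in> TM x" and w: "w \<in> TM x"
  shows "fib i (R a b (u i)) w =
    \<alpha> (g x (u i) (u i)) * g x (R (u i) w a) b"
proof -
  obtain c where c: "c \<in> charts x" by (rule frame_chartE[OF xu])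
  note ui = frame_tangent[OF xu, of i]
  have "g x (R a b (u i)) (u i) = 0"
    using curvature_skew[OF a b ui ui x_in] g_sym[OF ui curvature_tangent[OF a b ui c] x_in] by simp
  then show ?thesis by (simp add: fibre_metric_def curvature_pair_sym[OF a b ui w x_in])
qed

text \<open>Against Z^h the single contribution is the curvature part of [X^h, Z^h], rewritten by
  the previous lemma so that \<open>Z\<close> stands in the last place.\<close>

lemma connection_hv:
  assumes X: "near x X" and Y: "near x Y"
  shows "DL (x, u) (H (X x)) (ver i Y) =
    (\<alpha> (g x (u i) (u i)) / 2) *\<^sub>R H (R (u i) (Y x) (X x)) + V i (D x (X x) Y)"
proof -
  obtain c where c: "c \<in> charts x" by (rule frame_chartE[OF xu])
  note TX = field_near_tangent[OF X] and TY = field_near_tangent[OF Y]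
  note R = curvature_tangent[OF frame_tangent[OF xu, of i] TY TX c]
  note DXY = D_tangent[OF Y TX]
  note nX = hlift_field_near[OF X xu] and nY = vlift_field_near[OF Y xu, of i]
  note HR = hlift_tangent[OF xu R] and VD = vlift_tangent[OF xu DXY, of i]
  let ?r = "\<alpha> (g x (u i) (u i)) / 2"
  note HR2 = F.tangent_scale[OF HR, of ?r]
  let ?\<xi> = "DL (x, u) (H (X x)) (ver i Y)"
  let ?\<eta> = "?r *\<^sub>R H (R (u i) (Y x) (X x)) + V i (D x (X x) Y)"
  show ?thesis
  proof (rule frame_tangent_eqI[OF xu])
    show "?\<xi> \<in> T" by (rule F.D_tangent[OF nY hlift_tangent[OF xu TX]])
    show "?\<eta> \<in> T" by (rule F.tangent_add[OF HR2 VD])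
  next
    fix a assume a: "a \<in> TM x"
    obtain Z where Z: "near x Z" "Z x = a" by (rule extend_to_field[OF a])
    note nZ = hlift_field_near[OF Z(1) xu] and Ha = hlift_tangent[OF xu a]
    have "2 * ip ?\<xi> (H a) = fib i (R (X x) a (u i)) (Y x)"
      using F.koszul[OF nX nY nZ] unfolding lift_field_at Z(2) dir_deriv_vanishing(2)[OF Y Z(1) hlift_tangent[OF xu TX]]
        dir_deriv_v_hh[OF X Z(1) TY] dir_deriv_vanishing(1)[OF X Y Ha] G_lie_bracket_hh(2)[OF X Z(1) TY]
        G_lie_bracket_vh(1)[OF Y Z(1) TX] lie_bracket_hv[OF X Y xu]
      by (simp add: G_lifts[OF xu] D_tangent X Y Z TX TY a)
    moreover have "ip ?\<eta> (H a) = ?r * g x (R (u i) (Y x) (X x)) a"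
      unfolding F.g_left(1)[OF HR2 VD Ha xu_in] F.g_left(3)[OF HR HR Ha xu_in]
      by (simp add: G_lifts[OF xu] DXY a R)
    ultimately show "ip ?\<xi> (H a) = ip ?\<eta> (H a)"
      by (simp add: fibre_metric_curvature TX TY a)
  next
    fix k b assume b: "b \<in> TM x"
    obtain Z where Z: "near x Z" "Z x = b" by (rule extend_to_field[OF b])
    note nZ = vlift_field_near[OF Z(1) xu, of k] and Vb = vlift_tangent[OF xu b, of k]
    have XYZ: "dir (H (X x)) (pair (ver i Y) (ver k Z)) =
       (if i = k then fib i (D x (X x) Y) b + fib i (Y x) (D x (X x) Z) else 0)"
      using dir_deriv_h_vv[OF Y Z(1) TX, of i] dir_deriv_vanishing(3)[OF Y Z(1) hlift_tangent[OF xu TX], of i k] Z(2)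
      by (cases "i = k") auto
    \<comment> \<open>For \<open>k = i\<close> the derivative along X^h combines with the two mixed
      brackets: the terms with the derivative of \<open>Z\<close> cancel and those with the
      derivative of \<open>Y\<close> double.\<close>
    have "2 * ip ?\<xi> (V k b) = (if i = k then 2 * fib i (D x (X x) Y) b else 0)"
      using F.koszul[OF nX nY nZ] unfolding lift_field_at Z(2) XYZ dir_deriv_vanishing(1)[OF X Z(1) vlift_tangent[OF xu TY]]
        dir_deriv_vanishing(1)[OF X Y Vb] lie_bracket_hv[OF X Z(1) xu] lie_bracket_hv[OF X Y xu] lie_bracket_vv[OF Y Z(1) xu]
      by (simp add: G_lifts[OF xu] D_tangent X Y Z TX TY b F.g_zero[OF hlift_tangent[OF xu TX] xu_in]
          fibre_metric_sym[OF TY D_tangent[OF Z(1) TX] x_in])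
    moreover have "ip ?\<eta> (V k b) = (if i = k then fib i (D x (X x) Y) b else 0)"
      unfolding F.g_left(1)[OF HR2 VD Vb xu_in] F.g_left(3)[OF HR HR Vb xu_in]
      by (simp add: G_lifts[OF xu] DXY b R)
    ultimately show "ip ?\<xi> (V k b) = ip ?\<eta> (V k b)" by (simp split: if_splits)
  qed
qed

text \<open>By torsion-freeness from the preceding formula with the fields exchanged; the bracket is
  exactly its vertical part.\<close>

lemma connection_vh:
  assumes X: "near x X" and Y: "near x Y"
  shows "DL (x, u) (V i (X x)) (hor Y) =
    (\<alpha> (g x (u i) (u i)) / 2) *\<^sub>R H (R (u i) (X x) (Y x))"
  using F.torsion_freeD[OF hlift_field_near[OF Y xu] vlift_field_near[OF X xu, of i]]
    lie_bracket_hv[OF Y X xu, of i] connection_hv[OF Y X, of i] by simp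

lemma connection_vv_distinct:
  assumes X: "near x X" and Y: "near x Y" and ij: "i \<noteq> j"
  shows "DL (x, u) (V i (X x)) (ver j Y) = 0"
proof -
  note TX = field_near_tangent[OF X] and TY = field_near_tangent[OF Y]
  note nX = vlift_field_near[OF X xu, of i] and nY = vlift_field_near[OF Y xu, of j]
  let ?\<xi> = "DL (x, u) (V i (X x)) (ver j Y)"
  show ?thesis
  proof (rule frame_tangent_eqI[OF xu _ F.tangent_0])
    show "?\<xi> \<in> T" by (rule F.D_tangent[OF nY vlift_tangent[OF xu TX]])
  next
    fix a assume a: "a \<in> TM x"
    obtain Z where Z: "near x Z" "Z x = a" by (rule extend_to_field[OF a])
    note nZ = hlift_field_near[OF Z(1) xu] and Ha = hlift_tangent[OF xu a]
    have "2 * ip ?\<xi> (H a) = 0"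
      using F.koszul[OF nX nY nZ]
      unfolding lift_field_at Z(2) G_lie_bracket_vh(2)[OF X Z(1) TY] G_lie_bracket_vh(2)[OF Y Z(1) TX] dir_deriv_vanishing(2)[OF Y Z(1) vlift_tangent[OF xu TX]]
        dir_deriv_vanishing(2)[OF X Z(1) vlift_tangent[OF xu TY]] dir_deriv_vanishing(3)[OF X Y Ha ij]
        lie_bracket_vv[OF X Y xu]
      using ij by (simp add: F.g_zero[OF Ha xu_in])
    then show "ip ?\<xi> (H a) = ip 0 (H a)" by (simp add: F.g_zero[OF Ha xu_in])
  next
    fix k b assume b: "b \<in> TM x"
    obtain Z where Z: "near x Z" "Z x = b" by (rule extend_to_field[OF b])
    note nZ = vlift_field_near[OF Z(1) xu, of k] and Vb = vlift_tangent[OF xu b, of k]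
    \<comment> \<open>For \<open>m\<close> distinct from \<open>k\<close> the two lifts are
      orthogonal; for \<open>m = k\<close> their inner product involves only the frame vector of
      slot \<open>k\<close>, which a vertical lift in slot \<open>l\<close> leaves fixed.\<close>
    have 0: "dir (V l a) (pair (ver m W) (ver k Z)) = 0"
      if "near x W" "a \<in> TM x" "l \<noteq> m" for a W l m
      using dir_deriv_v_vv[OF that(1) Z(1) that(2), of l k] dir_deriv_vanishing(3)[OF that(1) Z(1) vlift_tangent[OF xu that(2)], of m k] that(3)
      by (cases "m = k") auto
    have "2 * ip ?\<xi> (V k b) = 0"
      using F.koszul[OF nX nY nZ]
      unfolding lift_field_at Z(2) 0[OF Y TX ij] 0[OF X TY ij[symmetric]] dir_deriv_vanishing(3)[OF X Y Vb ij]
        lie_bracket_vv[OF X Y xu] lie_bracket_vv[OF X Z(1) xu] lie_bracket_vv[OF Y Z(1) xu]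
      by (simp add: F.g_zero[OF _ xu_in] vlift_tangent[OF xu] TX TY b)
    then show "ip ?\<xi> (V k b) = ip 0 (V k b)" by (simp add: F.g_zero[OF Vb xu_in])
  qed
qed

text \<open>The coefficients are those that match the inner products with \<open>V i b\<close>; the
  inner products with horizontal lifts and with the other slots vanish on both sides.\<close>

lemma connection_vv_same:
  fixes i :: 'n
  assumes X: "near x X" and Y: "near x Y"
  defines "t \<equiv> g x (u i) (u i)"
  shows "DL (x, u) (V i (X x)) (ver i Y) =
    (\<alpha>' t / \<alpha> t) *\<^sub>R (g x (X x) (u i) *\<^sub>R V i (Y x) + g x (Y x) (u i) *\<^sub>R V i (X x))
    + ((\<beta>' t * \<alpha> t - 2 * \<alpha>' t * \<beta> t) / (\<alpha> t * (\<alpha> t + t * \<beta> t)) * g x (X x) (u i) * g x (Y x) (u i)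
       + (\<beta> t - \<alpha>' t) / (\<alpha> t + t * \<beta> t) * g x (X x) (Y x)) *\<^sub>R V i (u i)"
proof -
  note TX = field_near_tangent[OF X] and TY = field_near_tangent[OF Y] and Tu = frame_tangent[OF xu, of i]
  note nX = vlift_field_near[OF X xu, of i] and nY = vlift_field_near[OF Y xu, of i]
  note VX = vlift_tangent[OF xu TX, of i] and VY = vlift_tangent[OF xu TY, of i] and Vu = vlift_tangent[OF xu Tu, of i]
  have "t \<ge> 0"
    using g_pos[OF Tu x_in] g_zero[OF tangent_0 x_in] unfolding t_def by (cases "u i = 0") (auto intro: less_imp_le)
  then have pos: "\<alpha> t > 0" "\<alpha> t + t * \<beta> t > 0" using positive by auto
  let ?C = "(\<beta>' t * \<alpha> t - 2 * \<alpha>' t * \<beta> t) / (\<alpha> t * (\<alpha> t + t * \<beta> t)) * g x (X x) (u i) * g x (Y x) (u i)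
       + (\<beta> t - \<alpha>' t) / (\<alpha> t + t * \<beta> t) * g x (X x) (Y x)"
  let ?\<xi> = "DL (x, u) (V i (X x)) (ver i Y)"
  let ?\<eta> = "(\<alpha>' t / \<alpha> t) *\<^sub>R (g x (X x) (u i) *\<^sub>R V i (Y x) + g x (Y x) (u i) *\<^sub>R V i (X x))
    + ?C *\<^sub>R V i (u i)"
  note sX = F.tangent_scale[OF VX] and sY = F.tangent_scale[OF VY] and su = F.tangent_scale[OF Vu]
  note sXY = F.tangent_add[OF sY sX]
  note ssXY = F.tangent_scale[OF sXY]
  have G\<eta>: "ip ?\<eta> \<zeta> = (\<alpha>' t / \<alpha> t) * (g x (X x) (u i) * ip (V i (Y x)) \<zeta>
      + g x (Y x) (u i) * ip (V i (X x)) \<zeta>) + ?C * ip (V i (u i)) \<zeta>"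
    if \<zeta>: "\<zeta> \<in> T" for \<zeta>
    unfolding F.g_left(1)[OF ssXY su \<zeta> xu_in] F.g_left(3)[OF sXY sXY \<zeta> xu_in] F.g_left(1)[OF sY sX \<zeta> xu_in]
      F.g_left(3)[OF VX VX \<zeta> xu_in] F.g_left(3)[OF VY VY \<zeta> xu_in] F.g_left(3)[OF Vu Vu \<zeta> xu_in] ..
  show ?thesis
  proof (rule frame_tangent_eqI[OF xu])
    show "?\<xi> \<in> T" by (rule F.D_tangent[OF nY VX])
    show "?\<eta> \<in> T" by (rule F.tangent_add[OF ssXY su])
  next
    fix a assume a: "a \<in> TM x"
    obtain Z where Z: "near x Z" "Z x = a" by (rule extend_to_field[OF a])
    note nZ = hlift_field_near[OF Z(1) xu] and Ha = hlift_tangent[OF xu a]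
    \<comment> \<open>The derivative along the horizontal lift is cancelled by the brackets of the
      two vertical fields with Z^h.\<close>
    have "2 * ip ?\<xi> (H a) = 0"
      using F.koszul[OF nX nY nZ] unfolding lift_field_at Z(2) dir_deriv_vanishing(2)[OF Y Z(1) VX]
        dir_deriv_vanishing(2)[OF X Z(1) VY] dir_deriv_h_vv[OF X Y a] G_lie_bracket_vh(2)[OF X Z(1) TY] G_lie_bracket_vh(2)[OF Y Z(1) TX]
        lie_bracket_vv[OF X Y xu] F.g_zero(1)[OF Ha xu_in] fibre_metric_sym[OF TX D_tangent[OF Y a] x_in]
      by (simp add: Z(2))
    moreover have "ip ?\<eta> (H a) = 0"
      unfolding G\<eta>[OF Ha] G_lifts(3)[OF xu a TX] G_lifts(3)[OF xu a TY] G_lifts(3)[OF xu a Tu] by simp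
    ultimately show "ip ?\<xi> (H a) = ip ?\<eta> (H a)" by simp
  next
    fix k b assume b: "b \<in> TM x"
    obtain Z where Z: "near x Z" "Z x = b" by (rule extend_to_field[OF b])
    note nZ = vlift_field_near[OF Z(1) xu, of k] and Vb = vlift_tangent[OF xu b, of k]
    note lhs = F.koszul[OF nX nY nZ, unfolded lift_field_at Z(2) lie_bracket_vv[OF X Y xu] lie_bracket_vv[OF X Z(1) xu]
        lie_bracket_vv[OF Y Z(1) xu] F.g_zero(1)[OF VX xu_in] F.g_zero(1)[OF VY xu_in] F.g_zero(1)[OF Vb xu_in]]
    show "ip ?\<xi> (V k b) = ip ?\<eta> (V k b)"
    proof (cases "k = i")
      case False
      have "2 * ip ?\<xi> (V k b) = 0"
        using lhs False unfolding dir_deriv_vanishing(3)[OF Y Z(1) VX False[symmetric]] dir_deriv_vanishing(3)[OF X Z(1) VY False[symmetric]]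
          dir_deriv_v_vv[OF X Y b] by simp
      moreover have "ip ?\<eta> (V k b) = 0"
        using False unfolding G\<eta>[OF Vb] G_lifts(4)[OF xu TX b] G_lifts(4)[OF xu TY b] G_lifts(4)[OF xu Tu b] by simp
      ultimately show ?thesis by simp
    next
      case True
      \<comment> \<open>With the six inner products as plain reals the comparison becomes field
        arithmetic.\<close>
      define xe ye ze xy xz yz where v: "xe = g x (X x) (u i)" "ye = g x (Y x) (u i)" "ze = g x b (u i)"
        "xy = g x (X x) (Y x)" "xz = g x (X x) b" "yz = g x (Y x) b"
      note v' = v[symmetric] g_sym[OF b TX x_in, folded v] g_sym[OF b TY x_in, folded v] g_sym[OF TY TX x_in, folded v]
        g_sym[OF Tu b x_in, folded v]
      have L: "ip ?\<xi> (V k b) =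
          \<alpha>' t * (xe * yz + ye * xz - ze * xy) + \<beta>' t * xe * ye * ze + \<beta> t * xy * ze"
        using lhs unfolding True dir_deriv_v_vv[OF Y Z(1) TX] dir_deriv_v_vv[OF X Z(1) TY] dir_deriv_v_vv[OF X Y b]
          t_def[symmetric] Z(2) v' by (simp add: algebra_simps)
      \<comment> \<open>The last factor is \<open>fib i (u i) b\<close>, since
        \<open>g x (u i) (u i)\<close> is \<open>t\<close>.\<close>
      have R: "ip ?\<eta> (V k b) =
          (\<alpha>' t / \<alpha> t) * (xe * (\<alpha> t * yz + \<beta> t * ye * ze) + ye * (\<alpha> t * xz + \<beta> t * xe * ze)) + ?C * ((\<alpha> t + t * \<beta> t) * ze)"
        unfolding True G\<eta>[OF Vb[unfolded True]]
        unfolding G_lifts(4)[OF xu TX b] G_lifts(4)[OF xu TY b] G_lifts(4)[OF xu Tu b]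
        unfolding fibre_metric_def t_def[symmetric] v' by (simp add: algebra_simps)
      \<comment> \<open>Stated with a single real \<open>s\<close> in place of
        \<open>\<alpha> t + t * \<beta> t\<close>, so that this sum cancels as one quantity.\<close>
      have quot: "(p / (a * s) * xe * ye + q / s * xy) * (s * ze) = p / a * xe * ye * ze + q * xy * ze"
        if "a \<noteq> 0" "s \<noteq> 0" for a s p q :: real
        using that by (simp add: field_simps)
      have C: "?C * ((\<alpha> t + t * \<beta> t) * ze) =
          (\<beta>' t * \<alpha> t - 2 * \<alpha>' t * \<beta> t) / \<alpha> t * xe * ye * ze + (\<beta> t - \<alpha>' t) * xy * ze"
        unfolding v' using pos by (intro quot) auto
      show ?thesis unfolding L R C using pos(1) by (simp add: field_simps)
    qed
  qed
qed

end

end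

theorem proposition3p1:
  fixes A :: "('m, real^'n::finite) atlas"
    and g :: "('m, real^'n) metric_tensor"
    and D :: "('m, real^'n) connection"
    and \<alpha> \<beta> :: "real \<Rightarrow> real"
    and G :: "(('m, 'n) frame, 'n frame_model) metric_tensor"
    and DL :: "(('m, 'n) frame, 'n frame_model) connection"
    and X Y :: "('m, real^'n) vfield"
    and x :: 'm
    and u :: "'n \<Rightarrow> ('m, real^'n) tvec"
  assumes "smooth_manifold A"
    and "riemannian_metric A g"
    and "levi_civita A g D"
    and "smooth_on {0..} \<alpha>"
    and "smooth_on {0..} \<beta>"
    and "\<forall>t\<ge>0. \<alpha> t > 0 \<and> \<alpha> t + t * \<beta> t > 0"
    and "frame_bundle_metric A g D \<alpha> \<beta> G"
    and "levi_civita (frame_atlas A) G DL"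
    and "vector_field_on A (carrier_of A) X"
    and "vector_field_on A (carrier_of A) Y"
    and "(x, u) \<in> frame_bundle A"
  shows
    "cov_deriv DL (hlift_field A D X) (hlift_field A D Y) (x, u)
       = hlift_field A D (cov_deriv D X Y) (x, u)
         - (1/2) *\<^sub>R (\<Sum>k\<in>UNIV. vlift A k (x, u) (curvature A D x (X x) (Y x) (u k))) \<and>
     (\<forall>i. cov_deriv DL (hlift_field A D X) (vlift_field A i Y) (x, u)
       = (\<alpha> (g x (u i) (u i)) / 2) *\<^sub>R hlift A D (x, u) (curvature A D x (u i) (Y x) (X x))
         + vlift_field A i (cov_deriv D X Y) (x, u)) \<and>
     (\<forall>i. cov_deriv DL (vlift_field A i X) (hlift_field A D Y) (x, u)
       = (\<alpha> (g x (u i) (u i)) / 2) *\<^sub>R hlift A D (x, u) (curvature A D x (u i) (X x) (Y x))) \<and>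
     (\<forall>i j. i \<noteq> j \<longrightarrow> cov_deriv DL (vlift_field A i X) (vlift_field A j Y) (x, u) = 0) \<and>
     (\<forall>i. let t = g x (u i) (u i);
             a = \<alpha> t; b = \<beta> t;
             a' = vector_derivative \<alpha> (at t within {0..});
             b' = vector_derivative \<beta> (at t within {0..})
         in cov_deriv DL (vlift_field A i X) (vlift_field A i Y) (x, u)
            = (a' / a) *\<^sub>R (g x (X x) (u i) *\<^sub>R vlift_field A i Y (x, u)
                            + g x (Y x) (u i) *\<^sub>R vlift_field A i X (x, u))
              + ((b' * a - 2 * a' * b) / (a * (a + t * b)) * g x (X x) (u i) * g x (Y x) (u i)
                 + (b - a') / (a + t * b) * g x (X x) (Y x)) *\<^sub>R tautological_field A i (x, u))"
proof -
  interpret frames A g D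
    using assms(1-3) by unfold_locales (simp_all add: smooth_manifold_def)
  \<comment> \<open>Registers the atlas axiom of the frame bundle, which the next interpretation
    requires.\<close>
  interpret F: atlas "frame_atlas A" by unfold_locales (rule smooth_frame_atlas)
  interpret frame_natural A g D G DL \<alpha> \<beta>
    using assms by unfold_locales (simp_all add: frame_bundle_metric_def)
  note xu = assms(11)
  \<comment> \<open>The whole carrier serves as the neighbourhood of \<open>x\<close>.\<close>
  have X: "field_near A x X" and Y: "field_near A x Y"
    using assms(9,10) openin_carrier frame_carrier[OF xu] by (auto intro: field_nearI)
  show ?thesis
    unfolding lift_field_at Let_def tautological_field_def snd_conv
    by (intro conjI allI impI connection_hh[OF xu X Y] connection_hv[OF xu X Y] connection_vh[OF xu X Y]
        connection_vv_distinct[OF xu X Y] connection_vv_same[OF xu X Y])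
qed

end
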